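(* There is a polynomial-time algorithm which, given an instance $(G;T;k)$ of Subset FVS in Split Graphs, returns an instance $(G';T';k')$ of Subset FVS in Split Graphs such that (i) $(G;T;k)$ is a YES instance if and only if $(G';T';k')$ is a YES instance, and (ii) $|V(G')|=\mathcal{O}(k^{2})$, $|E(G')|=\mathcal{O}(k^{2})$, and $k'\leq k$. Moreover, the split graph $G'$ has a split partition $(K',I')$ with $|K'|\leq 10k$.
   Context: All graphs are finite, simple, undirected. A graph is a split graph if its vertex set can be partitioned into a clique $K$ and an independent set $I$; such a pair $(K,I)$ is a split partition. For a set $T$ of vertices ("terminals"), a $T$-cycle is a cycle containing at least one vertex of $T$. The problem Subset FVS in Split Graphs: given a split graph $G$, a set $T\subseteq V(G)$ and an integer $k$, decide whether there is a set $S\subseteq V(G)$ with $|S|\leq k$ such that $G-S$ contains no $T$-cycle. An instance is a YES instance if such an $S$ exists. *)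

theory Defs
  imports Complex_Main "HOL-Computational_Algebra.Polynomial"
begin

section \<open>Graphs and Subset Feedback Vertex Set\<close>

record 'a ugraph =
  verts :: "'a set"
  edges :: "'a set set"

definition simple_graph :: "'a ugraph \<Rightarrow> bool" where
  "simple_graph G \<longleftrightarrow> finite (verts G) \<and> (\<forall>e\<in>edges G. e \<subseteq> verts G \<and> card e = 2)"

definition clique :: "'a ugraph \<Rightarrow> 'a set \<Rightarrow> bool" where
  "clique G K \<longleftrightarrow> K \<subseteq> verts G \<and> (\<forall>u\<in>K. \<forall>v\<in>K. u \<noteq> v \<longrightarrow> {u, v} \<in> edges G)"

definition independent_set :: "'a ugraph \<Rightarrow> 'a set \<Rightarrow> bool" where
  "independent_set G I \<longleftrightarrow> I \<subseteq> verts G \<and> (\<forall>u\<in>I. \<forall>v\<in>I. {u, v} \<notin> edges G)"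

definition split_partition :: "'a ugraph \<Rightarrow> 'a set \<Rightarrow> 'a set \<Rightarrow> bool" where
  "split_partition G K I \<longleftrightarrow>
     K \<union> I = verts G \<and> K \<inter> I = {} \<and> clique G K \<and> independent_set G I"

definition split_graph :: "'a ugraph \<Rightarrow> bool" where
  "split_graph G \<longleftrightarrow> simple_graph G \<and> (\<exists>K I. split_partition G K I)"

definition del_verts :: "'a ugraph \<Rightarrow> 'a set \<Rightarrow> 'a ugraph" where
  "del_verts G S = \<lparr>verts = verts G - S, edges = {e \<in> edges G. e \<inter> S = {}}\<rparr>"

text \<open>A cycle is given by the list of its vertices in cyclic order.\<close>

definition is_cycle :: "'a ugraph \<Rightarrow> 'a list \<Rightarrow> bool" where
  "is_cycle G xs \<longleftrightarrow> 3 \<le> length xs \<and> distinct xs \<and> set xs \<subseteq> verts G \<and>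
     (\<forall>i<length xs. {xs ! i, xs ! (Suc i mod length xs)} \<in> edges G)"

definition is_T_cycle :: "'a ugraph \<Rightarrow> 'a set \<Rightarrow> 'a list \<Rightarrow> bool" where
  "is_T_cycle G T xs \<longleftrightarrow> is_cycle G xs \<and> set xs \<inter> T \<noteq> {}"

definition split_sfvs_instance :: "'a ugraph \<Rightarrow> 'a set \<Rightarrow> int \<Rightarrow> bool" where
  "split_sfvs_instance G T k \<longleftrightarrow> split_graph G \<and> T \<subseteq> verts G"

definition yes_instance :: "'a ugraph \<Rightarrow> 'a set \<Rightarrow> int \<Rightarrow> bool" where
  "yes_instance G T k \<longleftrightarrow>
     (\<exists>S. S \<subseteq> verts G \<and> int (card S) \<le> k \<and> \<not> (\<exists>xs. is_T_cycle (del_verts G S) T xs))"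

section \<open>Model of computation\<close>

text \<open>
  Algorithms are programs of the language WHILE of N. D. Jones (\<^emph>\<open>Computability and
  Complexity from a Programming Perspective\<close>), an imperative language whose data are
  binary trees and whose programs use finitely many variables. Every evaluation of a
  subexpression is charged the size of its value, so that sharing of subtrees gives no
  speed-up: a run of cost \<open>t\<close> only handles trees of size at most \<open>t\<close>. Hence polynomial
  time in this model is polynomial time on Turing machines.
\<close>

datatype tree = Leaf | Node tree tree

primrec tsize :: "tree \<Rightarrow> nat" where
  "tsize Leaf = 1"
| "tsize (Node l r) = 1 + tsize l + tsize r"

primrec left :: "tree \<Rightarrow> tree" where
  "left Leaf = Leaf"
| "left (Node l r) = l"

primrec right :: "tree \<Rightarrow> tree" where
  "right Leaf = Leaf"
| "right (Node l r) = r"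

definition enc_bool :: "bool \<Rightarrow> tree" where
  "enc_bool b = (if b then Node Leaf Leaf else Leaf)"

datatype expr =
    Var nat
  | ENil
  | ECons expr expr
  | EHd expr
  | ETl expr
  | EEq expr expr

type_synonym state = "nat \<Rightarrow> tree"

primrec eval :: "expr \<Rightarrow> state \<Rightarrow> tree" where
  "eval (Var x) s = s x"
| "eval ENil s = Leaf"
| "eval (ECons a b) s = Node (eval a s) (eval b s)"
| "eval (EHd a) s = left (eval a s)"
| "eval (ETl a) s = right (eval a s)"
| "eval (EEq a b) s = enc_bool (eval a s = eval b s)"

primrec ecost :: "expr \<Rightarrow> state \<Rightarrow> nat" where
  "ecost (Var x) s = tsize (s x)"
| "ecost ENil s = 1"
| "ecost (ECons a b) s = ecost a s + ecost b s + tsize (eval (ECons a b) s)"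
| "ecost (EHd a) s = ecost a s + tsize (eval (EHd a) s)"
| "ecost (ETl a) s = ecost a s + tsize (eval (ETl a) s)"
| "ecost (EEq a b) s = ecost a s + ecost b s + tsize (eval (EEq a b) s)"

datatype com =
    Skip
  | Assign nat expr
  | Seq com com
  | Cond expr com com
  | While expr com

text \<open>\<open>exec c s t s'\<close>: started in \<open>s\<close>, \<open>c\<close> halts in \<open>s'\<close> with cost \<open>t\<close>.
  A test succeeds iff its value is not \<open>Leaf\<close>.\<close>

inductive exec :: "com \<Rightarrow> state \<Rightarrow> nat \<Rightarrow> state \<Rightarrow> bool" where
  Skip: "exec Skip s 1 s"
| Assign: "exec (Assign x a) s (1 + ecost a s) (s(x := eval a s))"
| Seq: "exec c1 s t1 s1 \<Longrightarrow> exec c2 s1 t2 s2 \<Longrightarrow> exec (Seq c1 c2) s (1 + t1 + t2) s2"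
| CondTrue: "eval a s \<noteq> Leaf \<Longrightarrow> exec c1 s t s1 \<Longrightarrow> exec (Cond a c1 c2) s (1 + ecost a s + t) s1"
| CondFalse: "eval a s = Leaf \<Longrightarrow> exec c2 s t s1 \<Longrightarrow> exec (Cond a c1 c2) s (1 + ecost a s + t) s1"
| WhileFalse: "eval a s = Leaf \<Longrightarrow> exec (While a c) s (1 + ecost a s) s"
| WhileTrue: "eval a s \<noteq> Leaf \<Longrightarrow> exec c s t1 s1 \<Longrightarrow> exec (While a c) s1 t2 s2 \<Longrightarrow>
    exec (While a c) s (1 + ecost a s + t1 + t2) s2"

inductive_cases exec_SkipE: "exec Skip s t s'"
inductive_cases exec_AssignE: "exec (Assign x a) s t s'"
inductive_cases exec_SeqE: "exec (Seq c1 c2) s t s'"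
inductive_cases exec_CondE: "exec (Cond a c1 c2) s t s'"
inductive_cases exec_WhileE: "exec (While a c) s t s'"

lemma exec_deterministic: "exec c s t s1 \<Longrightarrow> exec c s t' s2 \<Longrightarrow> t' = t \<and> s2 = s1"
proof (induction arbitrary: t' s2 rule: exec.induct)
  case (Skip s)
  then show ?case by (auto elim: exec_SkipE)
next
  case (Assign x a s)
  then show ?case by (auto elim: exec_AssignE)
next
  case (Seq c1 s t1 s1 c2 t2 s2')
  show ?case by (rule exec_SeqE[OF Seq.prems]) (use Seq.IH in fastforce)
next
  case (CondTrue a s c1 t s1 c2)
  show ?case by (rule exec_CondE[OF CondTrue.prems]) (use CondTrue.IH CondTrue.hyps in fastforce)+
next
  case (CondFalse a s c2 t s1 c1)
  show ?case by (rule exec_CondE[OF CondFalse.prems]) (use CondFalse.IH CondFalse.hyps in fastforce)+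
next
  case (WhileFalse a s c)
  show ?case by (rule exec_WhileE[OF WhileFalse.prems]) (use WhileFalse.hyps in auto)
next
  case (WhileTrue a s c t1 s1 t2 s2')
  show ?case by (rule exec_WhileE[OF WhileTrue.prems]) (use WhileTrue.IH WhileTrue.hyps in fastforce)+
qed

text \<open>Input and output are both held in variable 0; all other variables are initially \<open>Leaf\<close>.\<close>

definition runs :: "com \<Rightarrow> tree \<Rightarrow> nat \<Rightarrow> tree \<Rightarrow> bool" where
  "runs P x t y \<longleftrightarrow> (\<exists>s. exec P ((\<lambda>_. Leaf)(0 := x)) t s \<and> s 0 = y)"

definition computes :: "com \<Rightarrow> tree \<Rightarrow> tree \<Rightarrow> bool" where
  "computes P x y \<longleftrightarrow> (\<exists>t. runs P x t y)"

definition polynomial_time_on :: "com \<Rightarrow> tree set \<Rightarrow> bool" where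
  "polynomial_time_on P X \<longleftrightarrow>
     (\<exists>p :: nat poly. \<forall>x\<in>X. \<exists>t y. runs P x t y \<and> t \<le> poly p (tsize x))"

section \<open>Encoding of instances\<close>

text \<open>Numbers are written in binary, least significant bit first.\<close>

fun enc_nat :: "nat \<Rightarrow> tree" where
  "enc_nat n = (if n = 0 then Leaf else Node (enc_bool (odd n)) (enc_nat (n div 2)))"

declare enc_nat.simps [simp del]

definition enc_int :: "int \<Rightarrow> tree" where
  "enc_int k = Node (enc_bool (k < 0)) (enc_nat (nat \<bar>k\<bar>))"

primrec enc_list :: "('b \<Rightarrow> tree) \<Rightarrow> 'b list \<Rightarrow> tree" where
  "enc_list f [] = Leaf"
| "enc_list f (x # xs) = Node (f x) (enc_list f xs)"

definition enc_edge :: "nat \<times> nat \<Rightarrow> tree" where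
  "enc_edge e = Node (enc_nat (fst e)) (enc_nat (snd e))"

text \<open>An instance on vertices named by natural numbers is presented as a list of its vertices,
  a list of its edges, a list of its terminals, and the budget. Each item is listed exactly once,
  in arbitrary order, and each edge in one of its two orientations.\<close>

definition encodes_instance :: "tree \<Rightarrow> nat ugraph \<Rightarrow> nat set \<Rightarrow> int \<Rightarrow> bool" where
  "encodes_instance x G T k \<longleftrightarrow>
     (\<exists>vs es ts.
        distinct vs \<and> set vs = verts G \<and>
        distinct (map (\<lambda>(u, v). {u, v}) es) \<and> set (map (\<lambda>(u, v). {u, v}) es) = edges G \<and>
        distinct ts \<and> set ts = T \<and>
        x = Node (enc_list enc_nat vs)
              (Node (enc_list enc_edge es) (Node (enc_list enc_nat ts) (enc_int k))))"

end

theory Submission imports Defs begin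

text \<open>
  In a split graph every cycle through a terminal yields a triangle through a terminal, so the
  problem is to hit these triangles. If the clique \<open>K\<close> is so small that deleting all but at most two
  of its vertices is a solution within the budget, the answer is YES; otherwise every terminal in
  \<open>K\<close> belongs to every solution. It remains to choose \<open>D \<subseteq> K\<close> and to pay one for every element of
  \<open>D\<close> and for every terminal that keeps at least two neighbours outside \<open>D\<close>.

  A maximal packing of disjoint terminal triangles has at most \<open>k\<close> members in a YES instance; a
  crown with two private vertices per head, between the rest of \<open>K\<close> and the packing, leaves at most
  \<open>8k\<close> vertices in \<open>K\<close>. Finally, for each \<open>v \<in> K\<close> a crown \<open>(A, B)\<close> in the graph of triangles at \<open>v\<close>
  shows that some optimal solution contains \<open>v\<close> or all of \<open>A\<close>: detach \<open>v\<close> from \<open>B\<close> and add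
  for every \<open>a \<in> A\<close> one terminal with neighbourhood \<open>{v, a}\<close>. Afterwards \<open>v\<close> accounts for at most
  \<open>|K|\<close> incidences, which gives \<open>O(k\<^sup>2)\<close> edges.

  Polynomial time is obtained from closure properties: a function between encodable types
  is polynomial-time if it is built from pairing, case distinction and list folds whose
  accumulator stays polynomially bounded.
\<close>

section \<open>Polynomial-time functions\<close>

text \<open>The instance comes without a split partition and with a budget in binary, so a partition
  has to be searched for, and the budget is capped at the number of vertices before it is handled in
  unary. Everything must be a fold with a polynomially bounded accumulator, which shapes the
  combinatorics: instead of augmenting paths, crowns come from an auction whose whole state is a
  growing log, and one routine serves both reductions, since the 2-expansion is an ordinary crown in
  a graph in which every head occurs twice. The choice between a clique vertex \<open>v\<close> and
  its set \<open>A\<close> must survive in the kernel; it is first recorded as a set of pairs to be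
  hit and only at the end turned into terminals, whose names must be fresh. Counting gives the
  constants: a packed triangle contributes two vertices to the clique, and two copies of its three
  corners are matched to at most six further ones, hence \<open>2 + 2 * 3 = 8\<close> per unit of
  budget; the edges number at most three times the square of the clique size, and
  \<open>3 * 8 * 8 = 192\<close> is rounded up to 200.\<close>

class enc =
  fixes encode :: "'a \<Rightarrow> tree"
  assumes encode_inj: "encode x = encode y \<Longrightarrow> x = y"

lemma encode_eq_iff [simp]: "encode x = encode y \<longleftrightarrow> x = y"
  using encode_inj by blast

instantiation bool :: enc begin
definition "encode = enc_bool"
instance by standard (auto simp: encode_bool_def enc_bool_def split: if_splits)
end

instantiation unit :: enc begin
definition "encode (x :: unit) = Leaf"
instance by standard auto
end

instantiation prod :: (enc, enc) enc begin
definition "encode p = Node (encode (fst p)) (encode (snd p))"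
instance by standard (auto simp: encode_prod_def prod_eq_iff)
end

instantiation list :: (enc) enc begin
definition "encode xs = enc_list encode xs"
instance
proof
  fix xs ys :: "'a list"
  show "encode xs = encode ys \<Longrightarrow> xs = ys"
  proof (induction xs arbitrary: ys)
    case Nil
    then show ?case by (cases ys) (auto simp: encode_list_def)
  next
    case (Cons x xs)
    then show ?case by (cases ys) (auto simp: encode_list_def)
  qed
qed
end

lemma enc_nat_inj: "enc_nat m = enc_nat n \<Longrightarrow> m = n"
proof (induction m arbitrary: n rule: less_induct)
  case (less m)
  show ?case
  proof (cases "m = 0 \<or> n = 0")
    case True
    then show ?thesis using less.prems
      by (subst (asm) enc_nat.simps, subst (asm) (2) enc_nat.simps) (auto split: if_splits)
  next
    case False
    then have "enc_bool (odd m) = enc_bool (odd n)" "enc_nat (m div 2) = enc_nat (n div 2)"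
      using less.prems enc_nat.simps[of m] enc_nat.simps[of n] by auto
    then have "odd m = odd n" "m div 2 = n div 2"
      using less.IH[of "m div 2"] False by (auto simp: enc_bool_def split: if_splits)
    then show ?thesis
      by (metis div_mult_mod_eq parity_cases)
  qed
qed

instantiation nat :: enc begin
definition "encode = enc_nat"
instance by standard (auto simp: encode_nat_def intro: enc_nat_inj)
end

lemma enc_simps:
  "encode True = Node Leaf Leaf" "encode False = Leaf"
  "encode (a, b) = Node (encode a) (encode b)"
  "encode [] = Leaf" "encode (x # xs) = Node (encode x) (encode xs)"
  "encode () = Leaf" "encode (0 :: nat) = Leaf"
  by (auto simp: encode_bool_def enc_bool_def encode_prod_def encode_list_def encode_unit_def encode_nat_def
      enc_nat.simps)

abbreviation size_enc :: "'a::enc \<Rightarrow> nat" where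
  "size_enc x \<equiv> tsize (encode x)"

lemma size_enc_simps:
  "size_enc (a, b) = 1 + size_enc a + size_enc b"
  "size_enc ([] :: 'a::enc list) = 1"
  "size_enc (x # xs) = 1 + size_enc x + size_enc xs"
  "size_enc () = 1"
  by (auto simp: enc_simps)

lemma size_enc_append: "size_enc (xs @ ys) + 1 = size_enc xs + size_enc (ys :: 'a::enc list)"
  by (induction xs) (auto simp: enc_simps)

lemma size_enc_mem: "x \<in> set xs \<Longrightarrow> size_enc x < size_enc xs"
  by (induction xs) (auto simp: enc_simps)

lemma length_le_size_enc: "length xs < size_enc xs"
  by (induction xs) (auto simp: enc_simps)

lemma size_enc_filter_le: "size_enc (filter P xs) \<le> size_enc xs"
  by (induction xs) (auto simp: enc_simps)

lemma size_enc_le_sum: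
  assumes "\<And>x. x \<in> set xs \<Longrightarrow> size_enc x \<le> b"
  shows "size_enc xs \<le> 1 + length xs * (b + 1)"
  using assms by (induction xs) (auto simp: enc_simps, fastforce)

lemma poly_nat_mono:
  fixes p :: "nat poly"
  assumes "x \<le> y" shows "poly p x \<le> poly p y"
  by (induction p) (auto intro!: mult_mono assms)

section \<open>Programs computing a function in one cell\<close>

lemma exec_size: "exec c s t s' \<Longrightarrow> tsize (s' i) \<le> tsize (s i) + t"
proof (induction rule: exec.induct)
  case (Assign x a s)
  have "tsize (eval a s) \<le> ecost a s" by (cases a) auto
  then show ?case by auto
qed auto

text \<open>Variables from \<open>n\<close> upwards are scratch space: this lets a program be used inside another
  one without renaming variables.\<close>

definition realizes :: "nat \<Rightarrow> com \<Rightarrow> nat poly \<Rightarrow> ('a::enc \<Rightarrow> 'b::enc) \<Rightarrow> bool" where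
  "realizes n P p f \<longleftrightarrow> (\<forall>s x. s n = encode x \<longrightarrow> (\<exists>t s'. exec P s t s' \<and>
     s' n = encode (f x) \<and> (\<forall>i<n. s' i = s i) \<and> t \<le> poly p (size_enc x)))"

text \<open>The offset \<open>n\<close> is arbitrary so that a combinator can place a sub-program
  above its own live cells. Program and polynomial may differ from one offset to the next.\<close>

definition ptime :: "('a::enc \<Rightarrow> 'b::enc) \<Rightarrow> bool" where
  "ptime f \<longleftrightarrow> (\<forall>n. \<exists>P p. realizes n P p f)"

lemma realizesE:
  assumes "realizes n P p f" "s n = encode x"
  obtains t s' where "exec P s t s'" "s' n = encode (f x)" "\<And>i. i < n \<Longrightarrow> s' i = s i"
    "t \<le> poly p (size_enc x)"
  using assms unfolding realizes_def by blast

lemma ptimeE: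
  assumes "ptime f"
  obtains P p where "realizes n P p f"
  using assms unfolding ptime_def by blast

text \<open>A run cannot build a tree larger than its input plus its cost, so the time bound also
  bounds the output. Composing time bounds rests on this.\<close>

lemma ptime_size:
  assumes "ptime f"
  obtains q :: "nat poly" where "\<And>x. size_enc (f x) \<le> poly q (size_enc x)"
proof -
  obtain P p where P: "realizes 0 P p f" using ptimeE[OF assms] .
  have "size_enc (f x) \<le> poly ([:0, 1:] + p) (size_enc x)" for x
  proof -
    obtain t s' where *: "exec P (\<lambda>_. encode x) t s'" "s' 0 = encode (f x)" "t \<le> poly p (size_enc x)"
      by (rule realizesE[OF P, of "\<lambda>_. encode x" x]) auto
    from exec_size[OF *(1), of 0] *(2,3) show ?thesis by simp
  qed
  then show ?thesis using that by blast
qed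

lemma ptime_by_expr:
  fixes f :: "'a::enc \<Rightarrow> 'b::enc"
  assumes "\<And>s x. s n = encode x \<Longrightarrow> eval (a n) s = encode (f x) \<and> ecost (a n) s \<le> poly (p n) (size_enc x)"
  shows "\<exists>P p. realizes n P p f"
proof (intro exI)
  show "realizes n (Assign n (a n)) (1 + p n) f"
    unfolding realizes_def
  proof (intro allI impI)
    fix s and x :: 'a assume "s n = encode x"
    from assms[of s, OF this] show "\<exists>t s'. exec (Assign n (a n)) s t s' \<and> s' n = encode (f x) \<and>
        (\<forall>i<n. s' i = s i) \<and> t \<le> poly (1 + p n) (size_enc x)"
      using exec.Assign[of n "a n" s] by fastforce
  qed
qed

lemma ptime_same_enc:
  assumes "\<And>x. encode (f x) = encode x"
  shows "ptime f"
  unfolding ptime_def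
  by (intro allI ptime_by_expr[where a = Var and p = "\<lambda>_. [:0, 1:]"]) (auto simp: assms)

named_theorems ptime_intros

lemma ptime_id [ptime_intros]: "ptime (\<lambda>x. x)"
  by (rule ptime_same_enc) simp

primrec expr_of :: "tree \<Rightarrow> expr" where
  "expr_of Leaf = ENil"
| "expr_of (Node l r) = ECons (expr_of l) (expr_of r)"

lemma eval_expr_of [simp]: "eval (expr_of t) s = t"
  by (induction t) auto

lemma ecost_expr_of: "ecost (expr_of t) s = ecost (expr_of t) s'"
  by (induction t) auto

lemma ptime_const [ptime_intros]: "ptime (\<lambda>_. c)"
  unfolding ptime_def
proof (intro allI ptime_by_expr[where a = "\<lambda>_. expr_of (encode c)"
      and p = "\<lambda>_. [:ecost (expr_of (encode c)) (\<lambda>_. Leaf):]"] conjI)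
  fix s :: state
  show "ecost (expr_of (encode c)) s \<le> poly [:ecost (expr_of (encode c)) (\<lambda>_. Leaf):] (size_enc (x :: 'a))" for x
    using ecost_expr_of[of "encode c" s "\<lambda>_. Leaf"] by simp
qed auto

lemma ptime_comp:
  fixes f :: "'a::enc \<Rightarrow> 'b::enc" and g :: "'b \<Rightarrow> 'c::enc"
  assumes "ptime g" "ptime f"
  shows "ptime (\<lambda>x. g (f x))"
  unfolding ptime_def
proof
  fix n
  obtain P p where P: "realizes n P p f" using ptimeE[OF assms(2)] .
  obtain Q q where Q: "realizes n Q q g" using ptimeE[OF assms(1)] .
  obtain b where b: "\<And>x. size_enc (f x) \<le> poly b (size_enc x)" by (rule ptime_size[OF assms(2)]) blast
  have "realizes n (Seq P Q) (1 + p + pcompose q b) (\<lambda>x. g (f x))"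
    unfolding realizes_def
  proof (intro allI impI)
    fix s and x :: 'a assume s: "s n = encode x"
    obtain t1 s1 where 1: "exec P s t1 s1" "s1 n = encode (f x)" "\<And>i. i < n \<Longrightarrow> s1 i = s i"
      "t1 \<le> poly p (size_enc x)" by (rule realizesE[OF P, of s, OF s]) blast
    obtain t2 s2 where 2: "exec Q s1 t2 s2" "s2 n = encode (g (f x))" "\<And>i. i < n \<Longrightarrow> s2 i = s1 i"
      "t2 \<le> poly q (size_enc (f x))" by (rule realizesE[OF Q, of s1, OF 1(2)]) blast
    have "t2 \<le> poly q (poly b (size_enc x))"
      using 2(4) poly_nat_mono[OF b] by (meson le_trans)
    then show "\<exists>t s'. exec (Seq P Q) s t s' \<and> s' n = encode (g (f x)) \<and> (\<forall>i<n. s' i = s i) \<and>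
        t \<le> poly (1 + p + pcompose q b) (size_enc x)"
      using exec.Seq[OF 1(1) 2(1)] 1 2 by (auto simp: poly_pcompose intro!: exI[of _ s2])
  qed
  then show "\<exists>P p. realizes n P p (\<lambda>x. g (f x))" by blast
qed

lemma ptime_fst [ptime_intros]:
  assumes "ptime f" shows "ptime (\<lambda>x. fst (f x))"
proof (rule ptime_comp[OF _ assms])
  show "ptime (fst :: 'b \<times> 'c \<Rightarrow> 'b)"
    unfolding ptime_def
    by (intro allI ptime_by_expr[where a = "\<lambda>n. EHd (Var n)" and p = "\<lambda>_. [:0, 2:]"])
      (auto simp: encode_prod_def)
qed

lemma ptime_snd [ptime_intros]:
  assumes "ptime f" shows "ptime (\<lambda>x. snd (f x))"
proof (rule ptime_comp[OF _ assms])
  show "ptime (snd :: 'b \<times> 'c \<Rightarrow> 'c)"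
    unfolding ptime_def
    by (intro allI ptime_by_expr[where a = "\<lambda>n. ETl (Var n)" and p = "\<lambda>_. [:0, 2:]"])
      (auto simp: encode_prod_def)
qed

lemma ptime_pair [ptime_intros]:
  fixes f :: "'a::enc \<Rightarrow> _"
  assumes "ptime f" "ptime g"
  shows "ptime (\<lambda>x. (f x, g x))"
  unfolding ptime_def
proof
  fix n
  obtain P p where P: "realizes (n+1) P p f" using ptimeE[OF assms(1)] .
  obtain Q q where Q: "realizes (n+2) Q q g" using ptimeE[OF assms(2)] .
  obtain b where b: "\<And>x. size_enc (f x) \<le> poly b (size_enc x)" by (rule ptime_size[OF assms(1)]) blast
  obtain c where c: "\<And>x. size_enc (g x) \<le> poly c (size_enc x)" by (rule ptime_size[OF assms(2)]) blast
  \<comment> \<open>Offset \<open>n+1\<close> protects the input in cell \<open>n\<close>; offset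
    \<open>n+2\<close> protects the first result in cell \<open>n+1\<close> as well.\<close>
  let ?C = "Seq (Assign (n+1) (Var n)) (Seq P (Seq (Assign (n+2) (Var n)) (Seq Q
              (Assign n (ECons (Var (n+1)) (Var (n+2)))))))"
  have "realizes n ?C (8 + [:0, 2:] + p + q + 2 * b + 2 * c) (\<lambda>x. (f x, g x))"
    unfolding realizes_def
  proof (intro allI impI)
    fix s and x :: 'a assume s: "s n = encode x"
    let ?s = "s(n+1 := s n)"
    have "?s (n+1) = encode x" using s by simp
    then obtain t1 s1 where 1: "exec P ?s t1 s1" "s1 (n+1) = encode (f x)"
      "\<And>i. i < n+1 \<Longrightarrow> s1 i = ?s i" "t1 \<le> poly p (size_enc x)" using realizesE[OF P] by metis
    let ?s1 = "s1(n+2 := s1 n)"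
    have "?s1 (n+2) = encode x" using s 1(3)[of n] by simp
    then obtain t2 s2 where 2: "exec Q ?s1 t2 s2" "s2 (n+2) = encode (g x)"
      "\<And>i. i < n+2 \<Longrightarrow> s2 i = ?s1 i" "t2 \<le> poly q (size_enc x)" using realizesE[OF Q] by metis
    let ?a = "ECons (Var (n+1)) (Var (n+2))"
    have e1: "s2 (n+1) = encode (f x)" using 1(2) 2(3)[of "n+1"] by simp
    have X1: "exec (Assign (n+1) (Var n)) s (1 + ecost (Var n) s) ?s"
      using exec.Assign[of "n+1" "Var n" s] by simp
    have X2: "exec (Assign (n+2) (Var n)) s1 (1 + ecost (Var n) s1) ?s1"
      using exec.Assign[of "n+2" "Var n" s1] by simp
    have E: "exec ?C s (1 + (1 + ecost (Var n) s) + (1 + t1 + (1 + (1 + ecost (Var n) s1) +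
         (1 + t2 + (1 + ecost ?a s2))))) (s2(n := eval ?a s2))"
      by (rule X1 X2 1(1) 2(1) exec.Seq exec.Assign)+
    have "ecost ?a s2 \<le> 1 + 2 * poly b (size_enc x) + 2 * poly c (size_enc x)"
      using b[of x] c[of x] e1 2(2) by simp
    moreover have "ecost (Var n) s = size_enc x" "ecost (Var n) s1 = size_enc x"
      using s 1(3)[of n] by auto
    ultimately have T: "1 + (1 + ecost (Var n) s) + (1 + t1 + (1 + (1 + ecost (Var n) s1) +
         (1 + t2 + (1 + ecost ?a s2)))) \<le> poly (8 + [:0, 2:] + p + q + 2 * b + 2 * c) (size_enc x)"
      using 1(4) 2(4) by simp
    show "\<exists>t s'. exec ?C s t s' \<and> s' n = encode (f x, g x) \<and> (\<forall>i<n. s' i = s i) \<and>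
        t \<le> poly (8 + [:0, 2:] + p + q + 2 * b + 2 * c) (size_enc x)"
      using E T e1 2(2) 1(3) 2(3) by (intro exI conjI) (assumption, auto simp: encode_prod_def)
  qed
  then show "\<exists>P p. realizes n P p (\<lambda>x. (f x, g x))" by blast
qed

text \<open>Complexity depends on trees only, so functions between different types with equal
  encodings share a program: \<open>#\<close> is pairing, and a conditional is a case distinction on
  \<open>[()]\<close> and \<open>[]\<close>.\<close>

lemma ptime_cong_enc:
  assumes "ptime f" "\<And>x. encode (g x) = encode (f x)"
  shows "ptime g"
  using assms unfolding ptime_def realizes_def by simp

lemma ptime_Cons [ptime_intros]:
  assumes "ptime f" "ptime g"
  shows "ptime (\<lambda>x. f x # g x)"
  by (rule ptime_cong_enc[OF ptime_pair[OF assms]]) (simp add: enc_simps)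

lemma ptime_eq [ptime_intros]:
  assumes "ptime f" "ptime g"
  shows "ptime (\<lambda>x. f x = g x)"
proof -
  have "ptime (\<lambda>p :: 'b \<times> 'b. fst p = snd p)"
    unfolding ptime_def
    by (intro allI ptime_by_expr[where a = "\<lambda>n. EEq (EHd (Var n)) (ETl (Var n))"
          and p = "\<lambda>_. [:3, 4:]"]) (auto simp: encode_prod_def encode_bool_def enc_bool_def)
  from ptime_comp[OF this ptime_pair[OF assms]] show ?thesis by simp
qed

lemma ptime_case_list [ptime_intros]:
  fixes f :: "'a::enc \<Rightarrow> _"
  assumes "ptime f" "ptime g" "ptime (\<lambda>w. h (fst w) (fst (snd w)) (snd (snd w)))"
  shows "ptime (\<lambda>x. case f x of [] \<Rightarrow> g x | y # ys \<Rightarrow> h x y ys)"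
  unfolding ptime_def
proof
  fix n
  let ?h = "\<lambda>w. h (fst w) (fst (snd w)) (snd (snd w))"
  let ?r = "\<lambda>x. case f x of [] \<Rightarrow> g x | y # ys \<Rightarrow> h x y ys"
  obtain B pb where B: "realizes (n+1) B pb f" using ptimeE[OF assms(1)] .
  obtain bf where bf: "\<And>x. size_enc (f x) \<le> poly bf (size_enc x)" by (rule ptime_size[OF assms(1)]) blast
  obtain P p where P: "realizes n P p ?h" using ptimeE[OF assms(3)] .
  obtain Q q where Q: "realizes n Q q g" using ptimeE[OF assms(2)] .
  \<comment> \<open>The tree of \<open>y # ys\<close> is that of the pair \<open>(y, ys)\<close>, so
    joining cells \<open>n\<close> and \<open>n+1\<close> already forms the argument
    \<open>(x, (y, ys))\<close> of \<open>h\<close>.\<close>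
  let ?P = "Seq (Assign n (ECons (Var n) (Var (n+1)))) P"
  let ?C = "Seq (Assign (n+1) (Var n)) (Seq B (Cond (Var (n+1)) ?P Q))"
  define b where "b = (1 + [:0, 1:] + bf)"
  define T where "T = (9 + [:0, 2:] + 2 * b + pb + bf + pcompose p b + q)"
  have "realizes n ?C T ?r"
    unfolding realizes_def
  proof (intro allI impI)
    fix s and x :: 'a assume s: "s n = encode x"
    let ?s = "s(n+1 := s n)"
    have "?s (n+1) = encode x" using s by simp
    then obtain t1 s1 where 1: "exec B ?s t1 s1" "s1 (n+1) = encode (f x)"
      "\<And>i. i < n+1 \<Longrightarrow> s1 i = ?s i" "t1 \<le> poly pb (size_enc x)" using realizesE[OF B] by metis
    have s1: "s1 n = encode x" using 1(3)[of n] s by simp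
    have X1: "exec (Assign (n+1) (Var n)) s (1 + ecost (Var n) s) ?s"
      using exec.Assign[of "n+1" "Var n" s] by simp
    have "\<exists>t s'. exec (Cond (Var (n+1)) ?P Q) s1 t s' \<and> s' n = encode (?r x) \<and> (\<forall>i<n. s' i = s1 i) \<and>
        t \<le> 4 + 2 * poly b (size_enc x) + poly bf (size_enc x) + poly p (poly b (size_enc x)) + poly q (size_enc x)"
    proof (cases "f x")
      case Nil
      obtain tq sq where q: "exec Q s1 tq sq" "sq n = encode (g x)"
        "\<And>i. i < n \<Longrightarrow> sq i = s1 i" "tq \<le> poly q (size_enc x)" using realizesE[OF Q, of s1, OF s1] by metis
      have "exec (Cond (Var (n+1)) ?P Q) s1 (1 + ecost (Var (n+1)) s1 + tq) sq"
        using 1(2) Nil by (intro exec.CondFalse q) (auto simp: enc_simps)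
      then show ?thesis using Nil 1(2) q bf[of x] by (intro exI conjI) (assumption, auto simp: enc_simps)
    next
      case (Cons y ys)
      let ?a = "ECons (Var n) (Var (n+1))"
      let ?s1 = "s1(n := eval ?a s1)"
      have ev: "?s1 n = encode (x, (y, ys))" using s1 1(2) Cons by (simp add: enc_simps)
      have sb: "size_enc (x, (y, ys)) \<le> poly b (size_enc x)"
        using bf[of x] Cons by (simp add: enc_simps b_def)
      obtain tp sp where p: "exec P ?s1 tp sp" "sp n = encode (h x y ys)"
        "\<And>i. i < n \<Longrightarrow> sp i = ?s1 i" "tp \<le> poly p (size_enc (x, (y, ys)))"
        using realizesE[OF P, of ?s1, OF ev] by (metis fst_conv snd_conv)
      have "exec (Cond (Var (n+1)) ?P Q) s1 (1 + ecost (Var (n+1)) s1 + (1 + (1 + ecost ?a s1) + tp)) sp"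
        using 1(2) Cons by (intro exec.CondTrue exec.Seq[OF exec.Assign p(1)]) (auto simp: enc_simps)
      moreover have "tp \<le> poly p (poly b (size_enc x))" using p(4) poly_nat_mono[OF sb] le_trans by blast
      moreover have "ecost ?a s1 \<le> 2 * poly b (size_enc x)"
        using s1 1(2) Cons bf[of x] by (simp add: enc_simps b_def)
      ultimately show ?thesis using Cons 1(2) p bf[of x] by (intro exI conjI) (assumption, auto simp: enc_simps)
    qed
    then obtain t s' where t: "exec (Cond (Var (n+1)) ?P Q) s1 t s'" "s' n = encode (?r x)" "\<forall>i<n. s' i = s1 i"
      "t \<le> 4 + 2 * poly b (size_enc x) + poly bf (size_enc x) + poly p (poly b (size_enc x)) + poly q (size_enc x)"
      by blast
    have E: "exec ?C s (1 + (1 + ecost (Var n) s) + (1 + t1 + t)) s'"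
      by (rule X1 1(1) t(1) exec.Seq)+
    have "1 + (1 + ecost (Var n) s) + (1 + t1 + t) \<le> poly T (size_enc x)"
      using t(4) 1(4) s unfolding T_def by (simp add: poly_pcompose)
    then show "\<exists>t s'. exec ?C s t s' \<and> s' n = encode (?r x) \<and> (\<forall>i<n. s' i = s i) \<and>
        t \<le> poly T (size_enc x)"
      using E t(2,3) 1(3) by (intro exI conjI) (assumption, auto)
  qed
  then show "\<exists>P p. realizes n P p ?r" by blast
qed

lemma ptime_if [ptime_intros]:
  assumes "ptime b" "ptime f" "ptime g"
  shows "ptime (\<lambda>x. if b x then f x else g x)"
proof -
  have "ptime (\<lambda>x. if b x then [()] else [])"
    by (rule ptime_cong_enc[OF assms(1)]) (simp add: enc_simps)
  from ptime_case_list[OF this assms(3) ptime_comp[OF assms(2) ptime_fst[OF ptime_id]]]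
  show ?thesis by (rule ptime_cong_enc) simp
qed

section \<open>Folds with a bounded accumulator\<close>

abbreviation fold_loop :: "nat \<Rightarrow> com \<Rightarrow> com" where
  "fold_loop n G \<equiv> While (Var (n+1))
      (Seq (Assign (n+3) (ECons (Var n) (ECons (Var (n+2)) (EHd (Var (n+1))))))
      (Seq G (Seq (Assign (n+2) (Var (n+3))) (Assign (n+1) (ETl (Var (n+1)))))))"

text \<open>Cell \<open>n\<close> keeps the environment, \<open>n+1\<close> the unread list,
  \<open>n+2\<close> the accumulator, and the body runs at \<open>n+3\<close>. The bound
  \<open>b\<close> covers the accumulator after every prefix because each round copies it;
  \<open>2 + m + b + m\<close> bounds the size of the body's argument \<open>(e, (a, x))\<close>,
  and 20 is a generous count of the copies per round.\<close>

lemma exec_foldl_loop: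
  fixes e :: "'e::enc" and xs :: "'x::enc list" and a :: "'a::enc" and g :: "'e \<Rightarrow> 'a \<Rightarrow> 'x \<Rightarrow> 'a"
  assumes G: "realizes (n+3) G q (\<lambda>w. g (fst w) (fst (snd w)) (snd (snd w)))"
    and bnd: "\<And>i. size_enc (foldl (g e) a (take i xs)) \<le> b"
    and "s n = encode e" "s (n+1) = encode xs" "s (n+2) = encode a"
    and "size_enc e \<le> m" "size_enc xs \<le> m"
  shows "\<exists>t s'. exec (fold_loop n G) s t s' \<and>
      s' (n+2) = encode (foldl (g e) a xs) \<and> (\<forall>i\<le>n. s' i = s i) \<and>
      t \<le> 1 + m + length xs * (20 + 20 * m + 20 * b + poly q (2 + m + b + m))"
  using assms(2-)
proof (induction xs arbitrary: a s)
  case Nil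
  show ?case
    by (intro exI conjI, rule exec.WhileFalse) (use Nil in \<open>auto simp: enc_simps\<close>)
next
  case (Cons x xs)
  let ?W = "fold_loop n G"
  let ?a = "ECons (Var n) (ECons (Var (n+2)) (EHd (Var (n+1))))"
  let ?s1 = "s(n+3 := eval ?a s)"
  have sz: "size_enc a \<le> b" "size_enc (g e a x) \<le> b" "size_enc x \<le> m" "size_enc xs \<le> m"
    using Cons.prems(1)[of 0] Cons.prems(1)[of 1] Cons.prems(6) by (auto simp: enc_simps)
  have s1: "?s1 (n+3) = encode (e, (a, x))" using Cons.prems by (simp add: enc_simps)
  obtain t1 s2 where 1: "exec G ?s1 t1 s2" "s2 (n+3) = encode (g e a x)"
    "\<And>i. i < n+3 \<Longrightarrow> s2 i = ?s1 i" "t1 \<le> poly q (size_enc (e, (a, x)))"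
    by (rule realizesE[OF G, of ?s1, OF s1]) fastforce
  let ?s3 = "s2(n+2 := s2 (n+3))"
  let ?s4 = "?s3(n+1 := right (?s3 (n+1)))"
  have s4: "?s4 n = encode e" "?s4 (n+1) = encode xs" "?s4 (n+2) = encode (g e a x)"
    using 1(2) 1(3)[of n] 1(3)[of "n+1"] Cons.prems by (auto simp: enc_simps)
  have b4: "size_enc (foldl (g e) (g e a x) (take i xs)) \<le> b" for i
    using Cons.prems(1)[of "Suc i"] by simp
  obtain t2 s' where 2: "exec ?W ?s4 t2 s'" "s' (n+2) = encode (foldl (g e) (g e a x) xs)"
    "\<forall>i\<le>n. s' i = ?s4 i" "t2 \<le> 1 + m + length xs * (20 + 20 * m + 20 * b + poly q (2 + m + b + m))"
    using Cons.IH[OF b4 s4 Cons.prems(5) sz(4)] by blast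
  have A1: "exec (Assign (n+3) ?a) s (1 + ecost ?a s) ?s1" by (rule exec.Assign)
  have A2: "exec (Assign (n+2) (Var (n+3))) s2 (1 + ecost (Var (n+3)) s2) ?s3"
    using exec.Assign[of "n+2" "Var (n+3)" s2] by simp
  have A3: "exec (Assign (n+1) (ETl (Var (n+1)))) ?s3 (1 + ecost (ETl (Var (n+1))) ?s3) ?s4"
    using exec.Assign[of "n+1" "ETl (Var (n+1))" ?s3] by simp
  have ne: "eval (Var (n+1)) s \<noteq> Leaf" using Cons.prems by (simp add: enc_simps)
  note E = exec.WhileTrue[OF ne exec.Seq[OF A1 exec.Seq[OF 1(1) exec.Seq[OF A2 A3]]] 2(1)]
  have c: "ecost ?a s \<le> 6 + 3 * m + 3 * b + 3 * m + m" "ecost (Var (n+3)) s2 \<le> b"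
    "ecost (ETl (Var (n+1))) ?s3 \<le> 2 * m" "ecost (Var (n+1)) s \<le> m"
    using Cons.prems(2-6) sz 1(2) 1(3)[of "n+1"] by (auto simp: enc_simps)
  have "t1 \<le> poly q (2 + m + b + m)"
    by (rule order_trans[OF 1(4) poly_nat_mono]) (use sz Cons.prems(5) in \<open>simp add: enc_simps\<close>)
  then have "1 + ecost (Var (n+1)) s + (1 + (1 + ecost ?a s) + (1 + t1 + (1 + (1 + ecost (Var (n+3)) s2) +
        (1 + ecost (ETl (Var (n+1))) ?s3)))) + t2
      \<le> 1 + m + length (x # xs) * (20 + 20 * m + 20 * b + poly q (2 + m + b + m))"
    using c 2(4) by simp
  then show ?case
    using E 2(2,3) 1(3) by (intro exI[of _ s'] exI conjI) (assumption, auto)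
qed

text \<open>A polynomial-time body alone would not do: one that doubles its accumulator makes it
  exponential in the number of rounds. Hence the explicit bound on all intermediate
  accumulators.\<close>

lemma ptime_foldl:
  fixes init :: "'e::enc \<Rightarrow> 'a::enc" and xs :: "'e \<Rightarrow> 'x::enc list"
  assumes "ptime (\<lambda>w. g (fst w) (fst (snd w)) (snd (snd w)))" "ptime init" "ptime xs"
    and bnd: "\<And>e i. size_enc (foldl (g e) (init e) (take i (xs e))) \<le> poly b (size_enc e)"
  shows "ptime (\<lambda>e. foldl (g e) (init e) (xs e))"
  unfolding ptime_def
proof
  fix n
  obtain G q where G: "realizes (n+3) G q (\<lambda>w. g (fst w) (fst (snd w)) (snd (snd w)))"
    using ptimeE[OF assms(1)] .
  obtain I pi where I: "realizes (n+2) I pi init" using ptimeE[OF assms(2)] .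
  obtain X px where X: "realizes (n+1) X px xs" using ptimeE[OF assms(3)] .
  obtain bx where bx: "\<And>x. size_enc (xs x) \<le> poly bx (size_enc x)"
    by (rule ptime_size[OF assms(3)]) blast
  let ?W = "fold_loop n G"
  let ?C = "Seq (Assign (n+1) (Var n)) (Seq X (Seq (Assign (n+2) (Var n)) (Seq I
     (Seq ?W (Assign n (Var (n+2)))))))"
  define M where "M = [:0, 1:] + bx"
  define T where "T = 9 + [:0, 2:] + px + pi + b + 1 + M +
    bx * (20 + 20 * M + 20 * b + pcompose q (2 + M + b + M))"
  have "realizes n ?C T (\<lambda>e. foldl (g e) (init e) (xs e))"
    unfolding realizes_def
  proof (intro allI impI)
    fix s and e :: 'e assume s: "s n = encode e"
    let ?m = "poly M (size_enc e)" and ?b = "poly b (size_enc e)"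
    let ?s = "s(n+1 := s n)"
    have s0: "?s (n+1) = encode e" using s by simp
    obtain t1 s1 where 1: "exec X ?s t1 s1" "s1 (n+1) = encode (xs e)"
      "\<And>i. i < n+1 \<Longrightarrow> s1 i = ?s i" "t1 \<le> poly px (size_enc e)"
      by (rule realizesE[OF X, of ?s, OF s0]) blast
    let ?s1 = "s1(n+2 := s1 n)"
    have s1: "?s1 (n+2) = encode e" using s 1(3)[of n] by simp
    obtain t2 s2 where 2: "exec I ?s1 t2 s2" "s2 (n+2) = encode (init e)"
      "\<And>i. i < n+2 \<Longrightarrow> s2 i = ?s1 i" "t2 \<le> poly pi (size_enc e)"
      by (rule realizesE[OF I, of ?s1, OF s1]) blast
    have s2: "s2 n = encode e" "s2 (n+1) = encode (xs e)"
      using s 1(2) 1(3)[of n] 2(3)[of n] 2(3)[of "n+1"] by auto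
    have m: "size_enc e \<le> ?m" "size_enc (xs e) \<le> ?m"
      using bx[of e] by (auto simp: M_def)
    obtain t3 s3 where 3: "exec ?W s2 t3 s3" "s3 (n+2) = encode (foldl (g e) (init e) (xs e))"
      "\<forall>i\<le>n. s3 i = s2 i"
      "t3 \<le> 1 + ?m + length (xs e) * (20 + 20 * ?m + 20 * ?b + poly q (2 + ?m + ?b + ?m))"
      using exec_foldl_loop[OF G bnd s2 2(2) m] by blast
    have "length (xs e) \<le> poly bx (size_enc e)"
      using length_le_size_enc[of "xs e"] bx[of e] by linarith
    then have t3: "t3 \<le> 1 + ?m + poly bx (size_enc e) * (20 + 20 * ?m + 20 * ?b + poly q (2 + ?m + ?b + ?m))"
      using 3(4) by (meson add_left_mono le_trans mult_right_mono zero_le)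
    have A1: "exec (Assign (n+1) (Var n)) s (1 + ecost (Var n) s) ?s"
      using exec.Assign[of "n+1" "Var n" s] by simp
    have A2: "exec (Assign (n+2) (Var n)) s1 (1 + ecost (Var n) s1) ?s1"
      using exec.Assign[of "n+2" "Var n" s1] by simp
    note E = exec.Seq[OF A1 exec.Seq[OF 1(1) exec.Seq[OF A2 exec.Seq[OF 2(1) exec.Seq[OF 3(1)
      exec.Assign[of n "Var (n+2)"]]]]]]
    have fb: "size_enc (foldl (g e) (init e) (xs e)) \<le> ?b"
      using bnd[of e "length (xs e)"] by simp
    have "1 + (1 + ecost (Var n) s) + (1 + t1 + (1 + (1 + ecost (Var n) s1) + (1 + t2 +
       (1 + t3 + (1 + ecost (Var (n+2)) s3))))) \<le> poly T (size_enc e)"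
      using t3 1(4) 2(4) fb 3(2) s 1(3)[of n] unfolding T_def by (simp add: poly_pcompose)
    then show "\<exists>t s'. exec ?C s t s' \<and> s' n = encode (foldl (g e) (init e) (xs e)) \<and>
        (\<forall>i<n. s' i = s i) \<and> t \<le> poly T (size_enc e)"
      using E 1(3) 2(3) 3(2,3) by (intro exI conjI) (assumption, auto)
  qed
  then show "\<exists>P p. realizes n P p (\<lambda>e. foldl (g e) (init e) (xs e))" by blast
qed

text \<open>If a round adds an amount that does not depend on the accumulator, the total growth is
  at most the number of rounds times that amount. Most folds below have this form.\<close>

lemma ptime_foldl_additive:
  fixes init :: "'e::enc \<Rightarrow> 'a::enc" and xs :: "'e \<Rightarrow> 'x::enc list"
  assumes "ptime (\<lambda>w. g (fst w) (fst (snd w)) (snd (snd w)))" "ptime init" "ptime xs"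
    and inc: "\<And>e a x. x \<in> set (xs e) \<Longrightarrow> size_enc (g e a x) \<le> size_enc a + poly q (size_enc (e, x))"
  shows "ptime (\<lambda>e. foldl (g e) (init e) (xs e))"
proof -
  obtain bx where bx: "\<And>x. size_enc (xs x) \<le> poly bx (size_enc x)"
    by (rule ptime_size[OF assms(3)]) blast
  obtain bi where bi: "\<And>x. size_enc (init x) \<le> poly bi (size_enc x)"
    by (rule ptime_size[OF assms(2)]) blast
  define B where "B = bi + bx * pcompose q (1 + [:0, 1:] + bx)"
  show ?thesis
  proof (rule ptime_foldl[OF assms(1-3)])
    fix e :: 'e and i
    let ?c = "poly q (1 + size_enc e + poly bx (size_enc e))"
    have inc': "size_enc (g e a x) \<le> size_enc a + ?c" if "x \<in> set (xs e)" for a x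
    proof -
      have "size_enc (e, x) \<le> 1 + size_enc e + poly bx (size_enc e)"
        using size_enc_mem[OF that] bx[of e] by (simp add: enc_simps)
      then show ?thesis using inc[OF that, of a] poly_nat_mono by (meson add_left_mono le_trans)
    qed
    have *: "set ys \<subseteq> set (xs e) \<Longrightarrow> size_enc (foldl (g e) a ys) \<le> size_enc a + length ys * ?c" for ys a
    proof (induction ys arbitrary: a)
      case (Cons y ys)
      then have "size_enc (foldl (g e) (g e a y) ys) \<le> size_enc (g e a y) + length ys * ?c" by simp
      also have "size_enc (g e a y) \<le> size_enc a + ?c" using Cons.prems inc' by simp
      finally show ?case by simp
    qed simp
    have "size_enc (foldl (g e) (init e) (take i (xs e))) \<le> size_enc (init e) + length (take i (xs e)) * ?c"
      by (rule *) (auto dest: in_set_takeD)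
    also have "length (take i (xs e)) \<le> poly bx (size_enc e)"
      using length_le_size_enc[of "xs e"] bx[of e] by simp
    also note bi[of e]
    finally show "size_enc (foldl (g e) (init e) (take i (xs e))) \<le> poly B (size_enc e)"
      by (simp add: B_def poly_pcompose)
  qed
qed

lemma ptime_foldl_bool [ptime_intros]:
  fixes init :: "'e::enc \<Rightarrow> bool" and xs :: "'e \<Rightarrow> 'x::enc list"
  assumes "ptime (\<lambda>w. g (fst w) (fst (snd w)) (snd (snd w)))" "ptime init" "ptime xs"
  shows "ptime (\<lambda>e. foldl (g e) (init e) (xs e))"
proof (rule ptime_foldl_additive[OF assms, where q = "[:3:]"])
  show "size_enc (g e a x) \<le> size_enc a + poly [:3:] (size_enc (e, x))" for e a x
    by (cases "g e a x") (auto simp: enc_simps)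
qed

section \<open>Closure under logic and list operations\<close>

lemma ptime_comp2:
  assumes "ptime (\<lambda>w. P (fst w) (snd w))" "ptime f" "ptime g"
  shows "ptime (\<lambda>x. P (f x) (g x))"
  using ptime_comp[OF assms(1) ptime_pair[OF assms(2,3)]] by simp

lemma ptime_comp3:
  assumes "ptime (\<lambda>w. P (fst w) (fst (snd w)) (snd (snd w)))" "ptime f" "ptime g" "ptime h"
  shows "ptime (\<lambda>x. P (f x) (g x) (h x))"
  using ptime_comp[OF assms(1) ptime_pair[OF assms(2) ptime_pair[OF assms(3,4)]]] by simp

lemma ptime_Let [ptime_intros]:
  assumes "ptime (\<lambda>w. g (fst w) (snd w))" "ptime f"
  shows "ptime (\<lambda>x. let y = f x in g x y)"
  using ptime_comp[OF assms(1) ptime_pair[OF ptime_id assms(2)]] by simp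

lemma ptime_not [ptime_intros]: "ptime f \<Longrightarrow> ptime (\<lambda>x. \<not> f x)"
  by (rule ptime_cong_enc[OF ptime_if[of f "\<lambda>_. False" "\<lambda>_. True"]]) (auto intro: ptime_const)

lemma ptime_conj [ptime_intros]: "ptime f \<Longrightarrow> ptime g \<Longrightarrow> ptime (\<lambda>x. f x \<and> g x)"
  by (rule ptime_cong_enc[OF ptime_if[of f g "\<lambda>_. False"]]) (auto intro: ptime_const)

lemma ptime_disj [ptime_intros]: "ptime f \<Longrightarrow> ptime g \<Longrightarrow> ptime (\<lambda>x. f x \<or> g x)"
  by (rule ptime_cong_enc[OF ptime_if[of f "\<lambda>_. True" g]]) (auto intro: ptime_const)

lemma ptime_imp [ptime_intros]: "ptime f \<Longrightarrow> ptime g \<Longrightarrow> ptime (\<lambda>x. f x \<longrightarrow> g x)"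
  by (rule ptime_cong_enc[OF ptime_if[of f g "\<lambda>_. True"]]) (auto intro: ptime_const)

lemma ptime_Bex [ptime_intros]:
  assumes "ptime (\<lambda>w. P (fst w) (snd w))" "ptime xs"
  shows "ptime (\<lambda>e. \<exists>x\<in>set (xs e). P e x)"
proof -
  have eq: "(\<exists>x\<in>set ys. P e x) \<or> a \<longleftrightarrow> foldl (\<lambda>a x. P e x \<or> a) a ys" for e ys a
    by (induction ys arbitrary: a) force+
  have "ptime (\<lambda>e. foldl (\<lambda>a x. P e x \<or> a) False (xs e))"
    by (intro ptime_intros ptime_comp2[of P, OF assms(1)] assms(2))
  then show ?thesis using eq[of _ _ False] by simp
qed

lemma ptime_Ball [ptime_intros]:
  assumes "ptime (\<lambda>w. P (fst w) (snd w))" "ptime xs"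
  shows "ptime (\<lambda>e. \<forall>x\<in>set (xs e). P e x)"
  using ptime_not[OF ptime_Bex[OF ptime_not[OF assms(1)] assms(2)]] by simp

lemma ptime_mem [ptime_intros]:
  assumes "ptime f" "ptime xs"
  shows "ptime (\<lambda>e. f e \<in> set (xs e))"
proof -
  have "ptime (\<lambda>e. \<exists>x\<in>set (xs e). f e = x)"
    by (intro ptime_intros assms(2) ptime_comp[OF assms(1)])
  then show ?thesis by simp
qed

text \<open>A left fold with \<open>#\<close> naturally yields the reversal. Reversing is itself the
  case of the constant predicate, so a second pass repairs the order.\<close>

lemma ptime_filter_rev:
  assumes "ptime (\<lambda>w. P (fst w) (snd w))" "ptime xs"
  shows "ptime (\<lambda>e. rev (filter (P e) (xs e)))"
proof -
  have eq: "foldl (\<lambda>a x. if P e x then x # a else a) a ys = rev (filter (P e) ys) @ a" for e ys a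
    by (induction ys arbitrary: a) auto
  have "ptime (\<lambda>e. foldl (\<lambda>a x. if P e x then x # a else a) [] (xs e))"
    by (intro ptime_foldl_additive[where q = "[:0, 1:]"] ptime_intros
        ptime_comp2[of P, OF assms(1)] assms(2)) (auto simp: enc_simps)
  then show ?thesis by (simp add: eq)
qed

lemma ptime_rev [ptime_intros]: "ptime xs \<Longrightarrow> ptime (\<lambda>e. rev (xs e))"
  using ptime_filter_rev[where P = "\<lambda>_ _. True"] by (simp add: ptime_const)

lemma ptime_filter [ptime_intros]:
  assumes "ptime (\<lambda>w. P (fst w) (snd w))" "ptime xs"
  shows "ptime (\<lambda>e. filter (\<lambda>x. P e x) (xs e))"
  using ptime_rev[OF ptime_filter_rev[OF assms]] by simp

lemma ptime_map [ptime_intros]: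
  assumes "ptime (\<lambda>w. f (fst w) (snd w))" "ptime xs"
  shows "ptime (\<lambda>e. map (\<lambda>x. f e x) (xs e))"
proof -
  obtain q where q: "\<And>w. size_enc (f (fst w) (snd w)) \<le> poly q (size_enc w)"
    by (rule ptime_size[OF assms(1)]) blast
  have eq: "foldl (\<lambda>a x. f e x # a) a ys = rev (map (f e) ys) @ a" for e ys a
    by (induction ys arbitrary: a) auto
  have "ptime (\<lambda>e. foldl (\<lambda>a x. f e x # a) [] (xs e))"
  proof (rule ptime_foldl_additive[where q = "1 + q"])
    show "ptime (\<lambda>w. f (fst w) (snd (snd w)) # fst (snd w))"
      by (intro ptime_intros ptime_comp2[of f, OF assms(1)])
    show "size_enc (f e x # a) \<le> size_enc a + poly (1 + q) (size_enc (e, x))" for e x a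
      using q[of "(e, x)"] by (simp add: enc_simps)
  qed (intro ptime_intros assms(2))+
  from ptime_rev[OF this] show ?thesis by (simp add: eq)
qed

lemma ptime_append [ptime_intros]:
  assumes "ptime xs" "ptime ys"
  shows "ptime (\<lambda>e. xs e @ ys e)"
proof -
  have eq: "foldl (\<lambda>a x. x # a) ys xs = rev xs @ ys" for xs ys :: "'b list"
    by (induction xs arbitrary: ys) auto
  have "ptime (\<lambda>e. foldl (\<lambda>a x. x # a) (ys e) (rev (xs e)))"
    by (intro ptime_foldl_additive[where q = "[:0, 1:]"] ptime_intros assms) (auto simp: enc_simps)
  then show ?thesis by (simp add: eq)
qed

lemma ptime_concat [ptime_intros]:
  assumes "ptime xs"
  shows "ptime (\<lambda>e. concat (xs e))"
proof -
  have eq: "foldl (\<lambda>a x. a @ x) a xs = a @ concat xs" for xs and a :: "'b list"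
    by (induction xs arbitrary: a) auto
  have "ptime (\<lambda>e. foldl (\<lambda>a x. a @ x) [] (xs e))"
  proof (intro ptime_foldl_additive[where q = "[:0, 1:]"] ptime_intros assms)
    show "size_enc (a @ x) \<le> size_enc a + poly [:0, 1:] (size_enc (e, x))" for e :: 'a and x a :: "'b list"
      using size_enc_append[of a x] by (simp add: enc_simps)
  qed
  then show ?thesis by (simp add: eq)
qed

text \<open>Lengths are compared without arithmetic: \<open>ys\<close> is read only to drop one
  element of \<open>xs\<close> per round.\<close>

lemma ptime_drop_length [ptime_intros]:
  fixes ys :: "'a::enc \<Rightarrow> 'c::enc list"
  assumes "ptime xs" "ptime ys"
  shows "ptime (\<lambda>e. drop (length (ys e)) (xs e))"
proof -
  have eq: "foldl (\<lambda>a x. case a of [] \<Rightarrow> [] | _ # b \<Rightarrow> b) xs ys = drop (length ys) xs"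
    for xs :: "'b list" and ys :: "'c list"
    by (induction ys arbitrary: xs) (auto split: list.split)
  have "ptime (\<lambda>e. foldl (\<lambda>a x. case a of [] \<Rightarrow> [] | _ # b \<Rightarrow> b) (xs e) (ys e))"
    by (intro ptime_intros ptime_foldl_additive[where q = 0] assms) (auto simp: enc_simps split: list.split)
  then show ?thesis by (simp add: eq)
qed

lemma ptime_length_le [ptime_intros]:
  assumes "ptime xs" "ptime ys"
  shows "ptime (\<lambda>e. length (xs e) \<le> length (ys e))"
proof -
  have "ptime (\<lambda>e. drop (length (ys e)) (xs e) = [])" by (intro ptime_intros assms)
  then show ?thesis by simp
qed

section \<open>Crown decompositions of bipartite graphs\<close>

text \<open>An auction: a left vertex that owns nothing takes the cheapest of its neighbours and raises the
  price of that neighbour by one. The state is just the log of all bids, newest first: the price of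
  \<open>r\<close> is the number of bids for \<open>r\<close>, and its owner is the newest bidder. A left vertex gives up once
  all its neighbours cost more than \<open>length rs\<close>. Hence some number \<open>c \<le> length rs\<close> is not the price
  of any right vertex, and cutting at this price level yields the decomposition.\<close>

definition price :: "('l \<times> 'r) list \<Rightarrow> 'r \<Rightarrow> unit list" where
  "price lg r = map (\<lambda>_. ()) (filter (\<lambda>p. snd p = r) lg)"

definition owns :: "('l \<times> 'r) list \<Rightarrow> 'l \<Rightarrow> 'r \<Rightarrow> bool" where
  "owns lg l r = (case filter (\<lambda>p. snd p = r) lg of [] \<Rightarrow> False | p # ps \<Rightarrow> fst p = l)"

text \<open>All currently admissible bids, of which \<open>bid_step\<close> makes the first;
  emptiness certifies that the auction is over.\<close>

definition bids :: "('l \<times> 'r list) list \<Rightarrow> 'r list \<Rightarrow> ('l \<times> 'r) list \<Rightarrow> ('l \<times> 'r) list" where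
  "bids ls rs lg = concat (map (\<lambda>p. if \<exists>r\<in>set rs. owns lg (fst p) r then [] else
     map (\<lambda>r. (fst p, r)) (filter (\<lambda>r. length (price lg r) \<le> length rs \<and>
       (\<forall>r'\<in>set (snd p). length (price lg r) \<le> length (price lg r'))) (snd p))) ls)"

definition bid_step :: "('l \<times> 'r list) list \<Rightarrow> 'r list \<Rightarrow> ('l \<times> 'r) list \<Rightarrow> ('l \<times> 'r) list" where
  "bid_step ls rs lg = (case bids ls rs lg of [] \<Rightarrow> lg | b # bs \<Rightarrow> b # lg)"

text \<open>Unit lists are the unary numerals in which prices, levels and budgets are kept, since
  comparing them needs list operations only.\<close>

definition units :: "'a list \<Rightarrow> unit list" where
  "units xs = map (\<lambda>_. ()) xs"

text \<open>The fold runs over a dummy list of \<open>(length rs + 1)^2\<close> units. No price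
  exceeds \<open>length rs + 1\<close>, so fewer bids than that can be made and the auction has
  stopped by then.\<close>

definition auction :: "('l \<times> 'r list) list \<Rightarrow> 'r list \<Rightarrow> ('l \<times> 'r) list" where
  "auction ls rs = foldl (\<lambda>lg _. bid_step ls rs lg) []
     (concat (map (\<lambda>_. () # units rs) (() # units rs)))"

text \<open>The least number that is not a price is zero or one more than some price, so these
  candidates suffice.\<close>

definition gaps :: "'r list \<Rightarrow> ('l \<times> 'r) list \<Rightarrow> unit list list" where
  "gaps rs lg = filter (\<lambda>c. length c \<le> length rs \<and> (\<forall>r\<in>set rs. price lg r \<noteq> c))
     ([] # map (\<lambda>r. () # price lg r) rs)"

definition gap :: "'r list \<Rightarrow> ('l \<times> 'r) list \<Rightarrow> unit list" where
  "gap rs lg = (case gaps rs lg of [] \<Rightarrow> [] | c # cs \<Rightarrow> c)"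

text \<open>The implication holds vacuously for left vertices that own nothing. These have given up,
  so all their neighbours lie above the level and they belong on the crown side.\<close>

definition crown :: "('l \<times> 'r list) list \<Rightarrow> 'r list \<Rightarrow> 'l list \<times> 'r list" where
  "crown ls rs = (let lg = auction ls rs; c = gap rs lg in
     (map (\<lambda>p. fst p) (filter (\<lambda>p. \<forall>r\<in>set rs. owns lg (fst p) r \<longrightarrow> \<not> length (price lg r) \<le> length c) ls),
      filter (\<lambda>r. \<not> length (price lg r) \<le> length c) rs))"

lemma length_price_Cons:
  "length (price (b # lg) r) = (if r = snd b then Suc else id) (length (price lg r))"
  by (auto simp: price_def)

lemma owns_Cons: "owns (b # lg) l r = (if r = snd b then l = fst b else owns lg l r)"
  by (auto simp: owns_def)

lemma owns_mem: "owns lg l r \<Longrightarrow> (l, r) \<in> set lg"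
proof (induction lg)
  case (Cons b lg)
  then show ?case by (cases b) (auto simp: owns_Cons split: if_splits)
qed (simp add: owns_def)

lemma owner_exists: "price lg r \<noteq> [] \<Longrightarrow> \<exists>l. owns lg l r"
  by (cases "filter (\<lambda>p. snd p = r) lg") (auto simp: price_def owns_def)

lemma owns_unique: "owns lg l r \<Longrightarrow> owns lg l' r \<Longrightarrow> l = l'"
  by (auto simp: owns_def split: list.splits)

text \<open>The third clause is the approximate complementary slackness of auction algorithms: a
  bidder takes a cheapest neighbour and raises it by one, and later bids only raise the other
  prices.\<close>

definition auction_inv :: "('l \<times> 'r list) list \<Rightarrow> 'r list \<Rightarrow> ('l \<times> 'r) list \<Rightarrow> bool" where
  "auction_inv ls rs lg \<longleftrightarrow>
     (\<forall>(l, r) \<in> set lg. \<exists>ns. (l, ns) \<in> set ls \<and> r \<in> set ns) \<and>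
     (\<forall>l r r'. owns lg l r \<longrightarrow> owns lg l r' \<longrightarrow> r = r') \<and>
     (\<forall>(l, ns) \<in> set ls. \<forall>r r'. owns lg l r \<longrightarrow> r' \<in> set ns \<longrightarrow>
        length (price lg r) \<le> Suc (length (price lg r'))) \<and>
     (\<forall>r. length (price lg r) \<le> Suc (length rs))"

lemma bids_mem:
  "(l, r) \<in> set (bids ls rs lg) \<longleftrightarrow> (\<exists>ns. (l, ns) \<in> set ls \<and> r \<in> set ns \<and>
     (\<forall>r\<in>set rs. \<not> owns lg l r) \<and> length (price lg r) \<le> length rs \<and>
     (\<forall>r'\<in>set ns. length (price lg r) \<le> length (price lg r')))"
proof
  assume "(l, r) \<in> set (bids ls rs lg)"
  then obtain p where p: "p \<in> set ls" and
    "(l, r) \<in> set (if \<exists>r\<in>set rs. owns lg (fst p) r then [] else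
     map (\<lambda>r. (fst p, r)) (filter (\<lambda>r. length (price lg r) \<le> length rs \<and>
       (\<forall>r'\<in>set (snd p). length (price lg r) \<le> length (price lg r'))) (snd p)))"
    unfolding bids_def by auto
  then show "\<exists>ns. (l, ns) \<in> set ls \<and> r \<in> set ns \<and>
     (\<forall>r\<in>set rs. \<not> owns lg l r) \<and> length (price lg r) \<le> length rs \<and>
     (\<forall>r'\<in>set ns. length (price lg r) \<le> length (price lg r'))"
    by (intro exI[of _ "snd p"]) (auto split: if_splits)
next
  assume "\<exists>ns. (l, ns) \<in> set ls \<and> r \<in> set ns \<and>
     (\<forall>r\<in>set rs. \<not> owns lg l r) \<and> length (price lg r) \<le> length rs \<and>
     (\<forall>r'\<in>set ns. length (price lg r) \<le> length (price lg r'))"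
  then obtain ns where "(l, ns) \<in> set ls" "r \<in> set ns" "\<forall>r\<in>set rs. \<not> owns lg l r"
    "length (price lg r) \<le> length rs" "\<forall>r'\<in>set ns. length (price lg r) \<le> length (price lg r')"
    by blast
  then show "(l, r) \<in> set (bids ls rs lg)"
    unfolding bids_def set_concat set_map by (intro UN_I[of "(l, ns)"] UnionI[OF imageI]) auto
qed

lemma auction_inv_step:
  assumes inv: "auction_inv ls rs lg" and ls: "distinct (map fst ls)" "\<forall>(l, ns) \<in> set ls. set ns \<subseteq> set rs"
  shows "auction_inv ls rs (bid_step ls rs lg)"
proof (cases "bids ls rs lg")
  case Nil
  then show ?thesis using inv by (simp add: bid_step_def)
next
  case (Cons b bs)
  obtain l r where b: "b = (l, r)" by fastforce
  then obtain ns where ns: "(l, ns) \<in> set ls" "r \<in> set ns" "\<forall>r\<in>set rs. \<not> owns lg l r"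
    "length (price lg r) \<le> length rs" "\<forall>r'\<in>set ns. length (price lg r) \<le> length (price lg r')"
    using bids_mem[of l r ls rs lg] Cons by (metis list.set_intros(1))
  \<comment> \<open>\<open>bids\<close> looks for ownership inside \<open>rs\<close> only; every
    owned vertex was bid for along an edge and hence lies in \<open>rs\<close>.\<close>
  have free: "\<not> owns lg l r'" for r'
  proof
    assume o: "owns lg l r'"
    have "\<forall>(l, r) \<in> set lg. \<exists>ns. (l, ns) \<in> set ls \<and> r \<in> set ns"
      using inv unfolding auction_inv_def by (rule conjunct1)
    then obtain ns' where "(l, ns') \<in> set ls" "r' \<in> set ns'" using owns_mem[OF o] by blast
    then have "r' \<in> set rs" using ls(2) by blast
    then show False using ns(3) o by blast
  qed
  have uniq: "ns' = ns" if "(l, ns') \<in> set ls" for ns'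
    using ls(1) that ns(1) by (metis eq_key_imp_eq_value)
  have mono: "length (price lg r') \<le> length (price (b # lg) r')" for r'
    by (auto simp: length_price_Cons)
  have "auction_inv ls rs (b # lg)"
    unfolding auction_inv_def
  proof (intro conjI)
    show "\<forall>(l, r)\<in>set (b # lg). \<exists>ns. (l, ns) \<in> set ls \<and> r \<in> set ns"
      using conjunct1[OF inv[unfolded auction_inv_def]] ns(1,2) b by auto
    show "\<forall>l r r'. owns (b # lg) l r \<longrightarrow> owns (b # lg) l r' \<longrightarrow> r = r'"
      using conjunct1[OF conjunct2[OF inv[unfolded auction_inv_def]]] free b
      by (simp add: owns_Cons) blast
    show "\<forall>r. length (price (b # lg) r) \<le> Suc (length rs)"
      using inv ns(4) b unfolding auction_inv_def by (auto simp: length_price_Cons)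
    show "\<forall>(l, ns)\<in>set ls. \<forall>r r'. owns (b # lg) l r \<longrightarrow> r' \<in> set ns \<longrightarrow>
        length (price (b # lg) r) \<le> Suc (length (price (b # lg) r'))"
    proof (clarify)
      fix l' ns' r1 r2 assume *: "(l', ns') \<in> set ls" "owns (b # lg) l' r1" "r2 \<in> set ns'"
      show "length (price (b # lg) r1) \<le> Suc (length (price (b # lg) r2))"
      proof (cases "r1 = r")
        case True
        then have "l' = l" using *(2) b by (simp add: owns_Cons)
        then have "length (price lg r) \<le> length (price lg r2)" using uniq * ns(5) by auto
        then show ?thesis using True b mono[of r2] by (auto simp: length_price_Cons)
      next
        case False
        then have "owns lg l' r1" using *(2) b by (simp add: owns_Cons)
        then have "length (price lg r1) \<le> Suc (length (price lg r2))"
          using inv * unfolding auction_inv_def by blast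
        then show ?thesis using False b mono[of r2] by (auto simp: length_price_Cons)
      qed
    qed
  qed
  then show ?thesis using Cons by (simp add: bid_step_def)
qed

lemma auction_final:
  assumes ls: "distinct (map fst ls)" "\<forall>(l, ns) \<in> set ls. set ns \<subseteq> set rs" and "distinct rs"
  shows "auction_inv ls rs (auction ls rs)" "bids ls rs (auction ls rs) = []"
proof -
  let ?run = "\<lambda>us :: unit list. foldl (\<lambda>lg _. bid_step ls rs lg) [] us"
  have inv: "auction_inv ls rs (?run us)" for us
  proof (induction us rule: rev_induct)
    case Nil
    then show ?case by (auto simp: auction_inv_def owns_def price_def)
  next
    case (snoc u us)
    then show ?case using auction_inv_step[OF _ ls] by simp
  qed
  \<comment> \<open>A round without a bid leaves the log unchanged, so either every round has added
    a bid or the auction has stopped for good.\<close>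
  have prog: "length (?run us) = length us \<or> bids ls rs (?run us) = []" for us
  proof (induction us rule: rev_induct)
    case (snoc u us)
    then show ?case
      by (cases "bids ls rs (?run us)") (auto simp: bid_step_def)
  qed simp
  have len: "length lg \<le> length rs * Suc (length rs)" if "auction_inv ls rs lg" for lg
  proof -
    have "\<forall>(l, r) \<in> set lg. \<exists>ns. (l, ns) \<in> set ls \<and> r \<in> set ns"
      using that unfolding auction_inv_def by (rule conjunct1)
    then have "set (map snd lg) \<subseteq> set rs" using ls(2) by fastforce
    then have "length (map snd lg) = (\<Sum>r\<in>set rs. count_list (map snd lg) r)"
      by (simp add: sum_count_set)
    also have "\<dots> \<le> (\<Sum>r\<in>set rs. Suc (length rs))"
    proof (rule sum_mono)
      fix r
      have "count_list (map snd lg) r = length (price lg r)"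
        unfolding price_def by (induction lg) auto
      then show "count_list (map snd lg) r \<le> Suc (length rs)"
        using that unfolding auction_inv_def by simp
    qed
    finally show ?thesis using \<open>distinct rs\<close> by (simp add: distinct_card)
  qed
  show "auction_inv ls rs (auction ls rs)" unfolding auction_def by (rule inv)
  let ?us = "concat (map (\<lambda>_. () # units rs) (() # units rs))"
  have "length ?us = Suc (length rs) * Suc (length rs)"
    by (simp add: length_concat units_def comp_def sum_list_replicate map_replicate_const)
  moreover have "length rs * Suc (length rs) < Suc (length rs) * Suc (length rs)" by simp
  ultimately have "length (?run ?us) \<noteq> length ?us" using len[OF inv[of ?us]] by linarith
  then show "bids ls rs (auction ls rs) = []" using prog[of ?us] unfolding auction_def by blast
qed

lemma gap_props:
  assumes "distinct rs"
  shows "length (gap rs lg) \<le> length rs" "\<forall>r\<in>set rs. price lg r \<noteq> gap rs lg"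
proof -
  let ?pr = "\<lambda>r. length (price lg r)"
  have "\<not> {..length rs} \<subseteq> ?pr ` set rs"
  proof
    assume "{..length rs} \<subseteq> ?pr ` set rs"
    then have "Suc (length rs) \<le> card (?pr ` set rs)"
      using card_mono[of "?pr ` set rs" "{..length rs}"] by simp
    also have "\<dots> \<le> length rs" using card_image_le[of "set rs" ?pr] assms by (simp add: distinct_card)
    finally show False by simp
  qed
  then have ex: "\<exists>c. c \<le> length rs \<and> c \<notin> ?pr ` set rs" by auto
  \<comment> \<open>Pigeonhole: \<open>length rs\<close> prices cannot cover the
    \<open>length rs + 1\<close> levels. The least uncovered level is among the candidates in
    \<open>gaps\<close>.\<close>
  define c where "c = (LEAST c. c \<le> length rs \<and> c \<notin> ?pr ` set rs)"
  have c: "c \<le> length rs" "c \<notin> ?pr ` set rs" using LeastI_ex[OF ex] unfolding c_def by auto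
  have "\<exists>us. us \<in> set ([] # map (\<lambda>r. () # price lg r) rs) \<and> length us = c"
  proof (cases c)
    case (Suc d)
    then have "\<not> (d \<le> length rs \<and> d \<notin> ?pr ` set rs)"
      using not_less_Least[of d "\<lambda>c. c \<le> length rs \<and> c \<notin> ?pr ` set rs"] unfolding c_def by simp
    then obtain r where "r \<in> set rs" "?pr r = d" using Suc c(1) by auto
    then show ?thesis using Suc by (intro exI[of _ "() # price lg r"]) simp
  qed simp
  then obtain us where us: "us \<in> set ([] # map (\<lambda>r. () # price lg r) rs)" "length us = c" by blast
  then have "us \<in> set (gaps rs lg)" using c unfolding gaps_def set_filter by blast
  then obtain v vs where v: "gaps rs lg = v # vs" by (cases "gaps rs lg") auto
  then have "gap rs lg \<in> set (gaps rs lg)" by (simp add: gap_def)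
  then show "length (gap rs lg) \<le> length rs" "\<forall>r\<in>set rs. price lg r \<noteq> gap rs lg"
    unfolding gaps_def set_filter by blast+
qed

text \<open>No right vertex has price exactly \<open>c\<close>, and an owner's price exceeds that of
  each of its neighbours by at most one. So a left vertex owning something above \<open>c\<close>
  has all neighbours above \<open>c\<close>; if it owns nothing, idleness puts them above
  \<open>length rs\<close>. A vertex above \<open>c\<close> has been bid for, and its owner owns
  nothing else: this is the matching into \<open>L\<close>. Left vertices outside \<open>L\<close>
  own distinct right vertices below \<open>c\<close>, which gives the last inequality.\<close>

theorem crown_correct:
  assumes ls: "distinct (map fst ls)" "\<forall>(l, ns) \<in> set ls. set ns \<subseteq> set rs" and rs: "distinct rs"
    and cr: "crown ls rs = (L, R)"
  shows "set L \<subseteq> fst ` set ls" "set R \<subseteq> set rs"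
    "\<And>l ns. (l, ns) \<in> set ls \<Longrightarrow> l \<in> set L \<Longrightarrow> set ns \<subseteq> set R"
    "\<exists>f. inj_on f (set R) \<and> (\<forall>r\<in>set R. f r \<in> set L \<and> (\<exists>ns. (f r, ns) \<in> set ls \<and> r \<in> set ns))"
    "card (fst ` set ls - set L) \<le> card (set rs - set R)"
proof -
  define lg where "lg = auction ls rs"
  define c where "c = gap rs lg"
  let ?pr = "\<lambda>r. length (price lg r)"
  have inv: "auction_inv ls rs lg" and idle: "bids ls rs lg = []"
    using auction_final[OF ls rs] unfolding lg_def by auto
  have unit: "us = vs" if "length us = length vs" for us vs :: "unit list"
    using that by (simp add: list_eq_iff_nth_eq)
  have c: "length c \<le> length rs" "\<And>r. r \<in> set rs \<Longrightarrow> ?pr r \<noteq> length c"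
    using gap_props[OF rs, of lg] unit[of _ c] unfolding c_def by blast+
  note inv' = inv[unfolded auction_inv_def]
  have owned: "\<exists>ns. (l, ns) \<in> set ls \<and> r \<in> set ns \<and> r \<in> set rs" if "owns lg l r" for l r
    using owns_mem[OF that] conjunct1[OF inv'] ls(2) by blast
  have im: "fst ` {p \<in> S. Q (fst p)} = {l \<in> fst ` S. Q l}" for S :: "('a \<times> 'b list) set" and Q
    by blast
  note cr' = cr[unfolded crown_def lg_def[symmetric] Let_def c_def[symmetric] not_le prod.inject]
  have L: "set L = {l \<in> fst ` set ls. \<forall>r\<in>set rs. owns lg l r \<longrightarrow> length c < ?pr r}"
    unfolding conjunct1[OF cr', symmetric] set_map set_filter by (rule im)
  have R: "set R = {r \<in> set rs. length c < ?pr r}"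
    unfolding conjunct2[OF cr', symmetric] set_filter by (rule refl)
  show "set L \<subseteq> fst ` set ls" "set R \<subseteq> set rs" using L R by auto
  show "set ns \<subseteq> set R" if l: "(l, ns) \<in> set ls" "l \<in> set L" for l ns
  proof
    fix r' assume r': "r' \<in> set ns"
    then have r'2: "r' \<in> set rs" using l ls(2) by auto
    show "r' \<in> set R"
    proof (cases "\<exists>r\<in>set rs. owns lg l r")
      case True
      then obtain r where r: "r \<in> set rs" "owns lg l r" by blast
      then have "length c < ?pr r" using l(2) L by blast
      moreover have "?pr r \<le> Suc (?pr r')"
        using conjunct1[OF conjunct2[OF conjunct2[OF inv']]] l(1) r(2) r' by blast
      ultimately show ?thesis using c(2)[OF r'2] R r'2 by simp
    next
      case False
      have "set ns \<noteq> {}" using r' by auto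
      define m where "m = arg_min_on ?pr (set ns)"
      have m: "m \<in> set ns" "\<And>r. r \<in> set ns \<Longrightarrow> ?pr m \<le> ?pr r"
        using arg_min_if_finite(1)[OF _ \<open>set ns \<noteq> {}\<close>, of ?pr]
          arg_min_least[OF _ \<open>set ns \<noteq> {}\<close>, of _ ?pr] unfolding m_def by auto
      have "\<not> ?pr m \<le> length rs"
      proof
        assume "?pr m \<le> length rs"
        then have "(l, m) \<in> set (bids ls rs lg)"
          unfolding bids_mem using l(1) m False by blast
        then show False using idle by simp
      qed
      then show ?thesis using m(2)[OF r'] c(1) R r'2 by simp
    qed
  qed
  define f where "f r = (THE l. owns lg l r)" for r
  have f: "owns lg (f r) r" if "r \<in> set R" for r
  proof -
    have "price lg r \<noteq> []" using that unfolding R by force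
    then obtain l where l: "owns lg l r" using owner_exists[of lg r] by auto
    have "f r = l" unfolding f_def using l by (rule the_equality) (rule owns_unique[OF _ l])
    then show ?thesis using l by simp
  qed
  have inv2: "r = r'" if "owns lg l r" "owns lg l r'" for l r r'
    by (rule conjunct1[OF conjunct2[OF inv'], rule_format, OF that])
  show "\<exists>f. inj_on f (set R) \<and> (\<forall>r\<in>set R. f r \<in> set L \<and> (\<exists>ns. (f r, ns) \<in> set ls \<and> r \<in> set ns))"
  proof (rule exI[of _ f], intro conjI ballI)
    show "inj_on f (set R)" by (rule inj_onI) (rule inv2[OF f], assumption, use f in metis)
    fix r assume r: "r \<in> set R"
    obtain ns where ns: "(f r, ns) \<in> set ls" "r \<in> set ns" using owned[OF f[OF r]] by auto
    then show "\<exists>ns. (f r, ns) \<in> set ls \<and> r \<in> set ns" by auto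
    from ns have "f r \<in> fst ` set ls" by (metis fst_conv imageI)
    moreover have "length c < ?pr r'" if "owns lg (f r) r'" for r'
      using inv2[OF that f[OF r]] r R by simp
    ultimately show "f r \<in> set L" unfolding L by simp
  qed
  show "card (fst ` set ls - set L) \<le> card (set rs - set R)"
  proof -
    have "\<exists>r. r \<in> set rs - set R \<and> owns lg l r" if "l \<in> fst ` set ls - set L" for l
    proof -
      from that obtain r where "r \<in> set rs" "owns lg l r" "\<not> length c < ?pr r"
        unfolding L by blast
      then show ?thesis unfolding R by blast
    qed
    then obtain g where g: "\<And>l. l \<in> fst ` set ls - set L \<Longrightarrow> g l \<in> set rs - set R \<and> owns lg l (g l)"
      by metis
    have "inj_on g (fst ` set ls - set L)" by (rule inj_onI) (metis g owns_unique)
    then show ?thesis by (rule card_inj_on_le) (use g in auto)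
  qed
qed

section \<open>Polynomial time of the auction\<close>

lemma ptime_price [ptime_intros]:
  "ptime lg \<Longrightarrow> ptime r \<Longrightarrow> ptime (\<lambda>e. price (lg e) (r e))"
  by (rule ptime_comp2[rotated]) (simp_all only: price_def, intro ptime_intros)

lemma ptime_owns [ptime_intros]:
  "ptime lg \<Longrightarrow> ptime l \<Longrightarrow> ptime r \<Longrightarrow> ptime (\<lambda>e. owns (lg e) (l e) (r e))"
  by (rule ptime_comp3[rotated]) (simp_all only: owns_def, intro ptime_intros)

lemma ptime_units [ptime_intros]: "ptime xs \<Longrightarrow> ptime (\<lambda>e. units (xs e))"
  unfolding units_def by (intro ptime_intros)

lemma ptime_bids [ptime_intros]:
  "ptime ls \<Longrightarrow> ptime rs \<Longrightarrow> ptime lg \<Longrightarrow> ptime (\<lambda>e. bids (ls e) (rs e) (lg e))"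
  by (rule ptime_comp3[rotated]) (simp_all only: bids_def, intro ptime_intros)

text \<open>A bid consists of names that already occur in \<open>ls\<close>, so the log grows
  additively.\<close>

lemma size_bid_step: "size_enc (bid_step ls rs lg) \<le> size_enc lg + size_enc ls + 2"
proof (cases "bids ls rs lg")
  case (Cons b bs)
  obtain l r where b: "b = (l, r)" by fastforce
  then obtain ns where ns: "(l, ns) \<in> set ls" "r \<in> set ns"
    using bids_mem[of l r ls rs lg] Cons by auto
  have "size_enc r < size_enc ns" "size_enc (l, ns) < size_enc ls"
    using size_enc_mem ns by blast+
  then show ?thesis using Cons b by (simp add: bid_step_def enc_simps)
qed (simp add: bid_step_def)

lemma ptime_auction [ptime_intros]:
  assumes "ptime ls" "ptime rs"
  shows "ptime (\<lambda>e. auction (ls e) (rs e))"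
proof -
  have "ptime (\<lambda>p. auction (fst p) (snd p))"
    unfolding auction_def
  proof (rule ptime_foldl_additive[where q = "[:0, 1:]"])
    show "ptime (\<lambda>w. bid_step (fst (fst w)) (snd (fst w)) (fst (snd w)))"
      unfolding bid_step_def by (intro ptime_intros)
    show "size_enc (bid_step (fst e) (snd e) a) \<le> size_enc a + poly [:0, 1:] (size_enc (e, x))" for e a and x :: unit
      using size_bid_step[of "fst e" "snd e" a] by (cases e) (simp add: enc_simps)
  qed (intro ptime_intros)+
  from ptime_comp2[OF this assms] show ?thesis .
qed

lemma ptime_gap [ptime_intros]:
  "ptime rs \<Longrightarrow> ptime lg \<Longrightarrow> ptime (\<lambda>e. gap (rs e) (lg e))"
  by (rule ptime_comp2[rotated]) (simp_all only: gap_def gaps_def, intro ptime_intros)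

lemma ptime_crown [ptime_intros]:
  "ptime ls \<Longrightarrow> ptime rs \<Longrightarrow> ptime (\<lambda>e. crown (ls e) (rs e))"
  by (rule ptime_comp2[rotated]) (simp_all only: crown_def, intro ptime_intros)

section \<open>The hypergraph problem\<close>

text \<open>Two surviving neighbours in the clique are adjacent, so the heavy terminals are those
  left in a triangle after the deletion of \<open>D\<close>.\<close>

definition heavy :: "'t set \<Rightarrow> ('t \<Rightarrow> 'v set) \<Rightarrow> 'v set \<Rightarrow> 't set" where
  "heavy J N D = {t \<in> J. 2 \<le> card (N t - D)}"

text \<open>\<open>K\<close> is the clique, \<open>J\<close> the set of terminals outside \<open>K\<close>, \<open>N t\<close> the neighbourhood of \<open>t\<close>, and \<open>F\<close>
  a set of pairs that have to be hit. Deleting \<open>D\<close> forces the heavy terminals to be deleted as well.\<close>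

definition hyes :: "'v set \<Rightarrow> 't set \<Rightarrow> ('t \<Rightarrow> 'v set) \<Rightarrow> ('v \<times> 'v) set \<Rightarrow> nat \<Rightarrow> bool" where
  "hyes K J N F k \<longleftrightarrow> (\<exists>D\<subseteq>K. (\<forall>(u, v)\<in>F. u \<in> D \<or> v \<in> D) \<and> card D + card (heavy J N D) \<le> k)"

lemma heavy_subset: "heavy J N D \<subseteq> J"
  by (auto simp: heavy_def)

lemma finite_heavy [simp]: "finite J \<Longrightarrow> finite (heavy J N D)"
  by (rule finite_subset[OF heavy_subset])

lemma heavyI:
  assumes "t \<in> J" "finite (N t)" "u \<in> N t - D" "v \<in> N t - D" "u \<noteq> v"
  shows "t \<in> heavy J N D"
proof -
  have "card {u, v} \<le> card (N t - D)" using assms by (intro card_mono) auto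
  then show ?thesis using assms by (simp add: heavy_def)
qed

lemma card_le_1_eq:
  assumes "finite A" "card A \<le> 1" "x \<in> A" "y \<in> A" shows "x = y"
  using assms card_le_Suc0_iff_eq[of A] by simp

lemma not_heavyI: "N t - D \<subseteq> {u} \<Longrightarrow> t \<notin> heavy J N D"
  using card_mono[of "{u}" "N t - D"] by (auto simp: heavy_def)

text \<open>The packing bound: a choice of one point of \<open>H\<close> in each \<open>W y\<close>
  is injective.\<close>

lemma card_le_disjoint_meets:
  assumes "finite H" "\<And>y. y \<in> Y \<Longrightarrow> W y \<inter> H \<noteq> {}"
    "\<And>y y'. y \<in> Y \<Longrightarrow> y' \<in> Y \<Longrightarrow> y \<noteq> y' \<Longrightarrow> W y \<inter> W y' = {}"
  shows "card Y \<le> card H"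
proof -
  have "\<exists>h. h \<in> W y \<and> h \<in> H" if "y \<in> Y" for y using assms(2)[OF that] by auto
  then obtain g where g: "\<And>y. y \<in> Y \<Longrightarrow> g y \<in> W y \<and> g y \<in> H" by metis
  have "inj_on g Y"
  proof (rule inj_onI, rule ccontr)
    fix y y' assume "y \<in> Y" "y' \<in> Y" "g y = g y'" "y \<noteq> y'"
    then show False using assms(3)[of y y'] g[of y] g[of y'] by auto
  qed
  then show ?thesis by (rule card_inj_on_le) (use g assms in auto)
qed

text \<open>If \<open>v\<close> is kept, \<open>D\<close> may be enlarged by \<open>A\<close>: a new
  element \<open>a\<close> is paid for by its private terminal \<open>f a\<close>, which sees both
  \<open>v\<close> and \<open>a\<close> and so was heavy, but no longer is. Conversely, once
  \<open>v\<close> or all of \<open>A\<close> is deleted, the incidence of \<open>v\<close> with a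
  terminal in \<open>B\<close> does not influence whether that terminal is heavy.\<close>

lemma hyes_crown_vertex:
  assumes fin: "finite K" "finite J" and N: "\<And>t. t \<in> J \<Longrightarrow> N t \<subseteq> K"
    and B: "B \<subseteq> J" and A: "A \<subseteq> K" and NB: "\<And>t. t \<in> B \<Longrightarrow> v \<in> N t \<and> N t - {v} \<subseteq> A" "v \<notin> A"
    and f: "inj_on f A" "\<And>a. a \<in> A \<Longrightarrow> f a \<in> B \<and> a \<in> N (f a)"
  shows "hyes K J N F k \<longleftrightarrow> hyes K J (\<lambda>t. if t \<in> B then N t - {v} else N t) (F \<union> {v} \<times> A) k"
    (is "_ \<longleftrightarrow> hyes K J ?N _ k")
proof
  assume "hyes K J N F k"
  then obtain D where D: "D \<subseteq> K" "\<forall>(u, v)\<in>F. u \<in> D \<or> v \<in> D" "card D + card (heavy J N D) \<le> k"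
    unfolding hyes_def by blast
  have finN: "finite (N t)" if "t \<in> J" for t using N[OF that] fin finite_subset by metis
  have sub: "heavy J ?N E \<subseteq> heavy J N E'" if "E' \<subseteq> E" for E E'
  proof
    fix t assume t: "t \<in> heavy J ?N E"
    then have "t \<in> J" by (simp add: heavy_def)
    have "card (?N t - E) \<le> card (N t - E')" using that finN[OF \<open>t \<in> J\<close>] by (intro card_mono) auto
    then show "t \<in> heavy J N E'" using t by (simp add: heavy_def)
  qed
  show "hyes K J ?N (F \<union> {v} \<times> A) k"
  proof (cases "v \<in> D")
    case True
    have "card (heavy J ?N D) \<le> card (heavy J N D)" using sub[of D D] fin by (intro card_mono) auto
    then have "card D + card (heavy J ?N D) \<le> k" using D(3) by linarith
    moreover have "\<forall>(u, w)\<in>F \<union> {v} \<times> A. u \<in> D \<or> w \<in> D" using D(2) True by blast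
    ultimately show ?thesis unfolding hyes_def using D(1) by blast
  next
    case False
    let ?D = "D \<union> A"
    have finD: "finite D" "finite A" using D(1) A fin finite_subset by metis+
    \<comment> \<open>In the new instance \<open>f a\<close> sees only vertices of \<open>A\<close>,
      all of which are now deleted.\<close>
    have img: "f ` (A - D) \<subseteq> heavy J N D - heavy J ?N ?D"
    proof
      fix t assume "t \<in> f ` (A - D)"
      then obtain a where a: "a \<in> A" "a \<notin> D" "t = f a" by blast
      have t: "t \<in> B" "a \<in> N t" using f(2)[OF a(1)] a(3) by auto
      have tJ: "t \<in> J" using t B by blast
      have "t \<in> heavy J N D"
        using NB(1)[OF t(1)] NB(2) a t False by (intro heavyI[of _ _ _ a _ v] tJ finN[OF tJ]) auto
      moreover have "t \<notin> heavy J ?N ?D" using NB(1)[OF t(1)] t(1) by (intro not_heavyI[of _ _ _ a]) auto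
      ultimately show "t \<in> heavy J N D - heavy J ?N ?D" by blast
    qed
    have "card (A - D) = card (f ` (A - D))"
      using f(1) by (metis card_image inj_on_subset Diff_subset)
    also have "\<dots> \<le> card (heavy J N D - heavy J ?N ?D)" using img fin by (intro card_mono) auto
    also have "\<dots> = card (heavy J N D) - card (heavy J ?N ?D)"
      using sub[of D ?D] fin by (intro card_Diff_subset) auto
    finally have 1: "card (A - D) \<le> card (heavy J N D) - card (heavy J ?N ?D)" .
    have 2: "card (heavy J ?N ?D) \<le> card (heavy J N D)" using sub[of D ?D] fin by (intro card_mono) auto
    have "card ?D = card D + card (A - D)"
      using finD by (metis Un_Diff_cancel card_Un_disjoint Diff_disjoint finite_Diff)
    then have "card ?D + card (heavy J ?N ?D) \<le> k" using 1 2 D(3) by linarith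
    moreover have "\<forall>(u, w)\<in>F \<union> {v} \<times> A. u \<in> ?D \<or> w \<in> ?D" using D(2) by blast
    ultimately show ?thesis unfolding hyes_def using D(1) A by (intro exI[of _ ?D]) simp
  qed
next
  assume "hyes K J ?N (F \<union> {v} \<times> A) k"
  then obtain D where D: "D \<subseteq> K" "\<forall>(u, w)\<in>F \<union> {v} \<times> A. u \<in> D \<or> w \<in> D"
    "card D + card (heavy J ?N D) \<le> k"
    unfolding hyes_def by blast
  have "heavy J N D \<subseteq> heavy J ?N D"
  proof
    fix t assume t: "t \<in> heavy J N D"
    show "t \<in> heavy J ?N D"
    proof (cases "t \<in> B \<and> v \<notin> D")
      case True
      then have "N t - D \<subseteq> {v}" using NB(1)[of t] D(2) by blast
      then show ?thesis using not_heavyI t by metis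
    next
      case False
      then have "?N t - D = N t - D" by auto
      then show ?thesis using t unfolding heavy_def by simp
    qed
  qed
  then have "card (heavy J N D) \<le> card (heavy J ?N D)"
    using fin by (intro card_mono) auto
  then have "card D + card (heavy J N D) \<le> k" using D(3) by linarith
  moreover have "\<forall>(u, w)\<in>F. u \<in> D \<or> w \<in> D" using D(2) by blast
  ultimately show "hyes K J N F k" unfolding hyes_def using D(1) by blast
qed

text \<open>The crown is a 2-expansion: every element \<open>y\<close> to be deleted owns the two vertices \<open>f (b, y)\<close>, so
  that the \<open>y\<close> correspond to disjoint triangles.\<close>

lemma hyes_crown_delete:
  fixes K :: "'a set"
  assumes fin: "finite K" "finite J" and N: "\<And>t. t \<in> J \<Longrightarrow> N t \<subseteq> K" and KJ: "K \<inter> J = {}"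
    and X: "X \<subseteq> K" and P: "P \<subseteq> J" and L: "L \<subseteq> K - X" and Y: "Y \<subseteq> X \<union> P"
    and one: "\<And>t. t \<in> J - P \<Longrightarrow> card (N t - X) \<le> 1"
    and cl1: "\<And>u t. u \<in> L \<Longrightarrow> t \<in> J - P \<Longrightarrow> u \<in> N t \<Longrightarrow> N t \<inter> X \<subseteq> Y"
    and cl2: "\<And>u p. u \<in> L \<Longrightarrow> p \<in> P \<Longrightarrow> u \<in> N p \<Longrightarrow> p \<in> Y"
    and f: "inj_on f (UNIV \<times> Y)" "\<And>b y. y \<in> Y \<Longrightarrow> f (b :: bool, y) \<in> L"
    and fX: "\<And>b y. y \<in> Y \<inter> X \<Longrightarrow> \<exists>t\<in>J - P. y \<in> N t \<and> f (b, y) \<in> N t"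
    and fP: "\<And>b y. y \<in> Y \<inter> P \<Longrightarrow> f (b, y) \<in> N y"
  shows "hyes K J N {} k \<longleftrightarrow>
    card Y \<le> k \<and> hyes (K - L - Y) (J - Y) (\<lambda>t. N t \<inter> (K - L - Y)) {} (k - card Y)"
    (is "_ \<longleftrightarrow> _ \<and> hyes ?K ?J ?N {} _")
proof -
  have finN: "finite (N t)" if "t \<in> J" for t using N[OF that] fin finite_subset by metis
  have finY: "finite Y" using Y X P fin by (meson finite_UnI finite_subset)
  have single: "u = u'" if "t \<in> J - P" "u \<in> L" "u' \<in> L" "u \<in> N t" "u' \<in> N t" for t u u'
    using card_le_1_eq[OF _ one[OF that(1)], of u u'] that L finN by blast
  have small: "N t - Y \<subseteq> {u}" if t: "t \<in> J - P" "u \<in> L" "u \<in> N t" for t u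
  proof
    fix x assume x: "x \<in> N t - Y"
    have "x \<notin> X" using cl1[OF t(2) t(1) t(3)] x by blast
    moreover have "u \<notin> X" using t L by blast
    ultimately show "x \<in> {u}"
      using card_le_1_eq[OF _ one[OF t(1)], of x u] x t finN by blast
  qed
  show ?thesis
  proof
    assume "hyes K J N {} k"
    then obtain D where D: "D \<subseteq> K" "card D + card (heavy J N D) \<le> k" unfolding hyes_def by blast
    let ?D = "D - L - Y"
    \<comment> \<open>\<open>M\<close> collects the terminals that the crown takes care of, and
      \<open>H\<close> the part of the solution that is charged to the crown. The rest of the
      solution serves for the remaining instance, so \<open>H\<close> must be shown to have at least
      \<open>card Y\<close> elements.\<close>
    define M where "M = {t \<in> J - P. N t \<inter> L \<noteq> {}} \<union> (Y \<inter> P)"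
    define H where "H = (D \<inter> (L \<union> Y)) \<union> (heavy J N D \<inter> M)"
    have finD: "finite D" using D(1) fin finite_subset by metis
    have finHH: "finite H" unfolding H_def using finD fin by simp
    have MJ: "M \<subseteq> J" unfolding M_def using P by blast
    \<comment> \<open>One set covers both kinds of head. For \<open>y\<close> in \<open>X\<close> a
      triangle consists of \<open>y\<close>, \<open>f (False, y)\<close> and a terminal outside
      \<open>P\<close> seeing both; for \<open>y\<close> in \<open>P\<close> it consists of
      \<open>y\<close> and its two private vertices. The sets are disjoint because a terminal
      outside \<open>P\<close> sees at most one vertex of \<open>L\<close>.\<close>
    define W where "W y = {y, f (False, y), f (True, y)} \<union> {t \<in> J - P. f (False, y) \<in> N t}" for y
    have YK: "Y \<inter> L = {}" using Y L P KJ by blast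
    have LJ: "L \<inter> J = {}" using L KJ by blast
    have YJP: "Y \<inter> (J - P) = {}" using Y X KJ by blast
    have "card Y \<le> card H"
    proof (rule card_le_disjoint_meets[of _ _ W])
      show "finite H" by (rule finHH)
    next
      fix y assume y: "y \<in> Y"
      show "W y \<inter> H \<noteq> {}"
      proof (cases "y \<in> X")
        case True
        then obtain t where t: "t \<in> J - P" "y \<in> N t" "f (False, y) \<in> N t" using fX y by blast
        have u: "f (False, y) \<in> L" using f(2)[OF y] .
        show ?thesis
        proof (cases "y \<in> D \<or> f (False, y) \<in> D")
          case True
          then show ?thesis using y u unfolding W_def H_def by blast
        next
          case False
          have "t \<in> heavy J N D"
            using t False y u YK by (intro heavyI[of _ _ _ y _ "f (False, y)"] finN) auto
          moreover have "t \<in> M" using t u unfolding M_def by blast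
          ultimately show ?thesis using t unfolding W_def H_def by blast
        qed
      next
        case False
        then have yP: "y \<in> Y \<inter> P" using y Y by blast
        then have yJ: "y \<in> J" using P by blast
        show ?thesis
        proof (cases "y \<in> heavy J N D")
          case True
          then show ?thesis using yP unfolding W_def H_def M_def by blast
        next
          case False
          have "f (False, y) \<noteq> f (True, y)" using f(1) y by (auto simp: inj_on_def)
          then have "f (False, y) \<in> D \<or> f (True, y) \<in> D"
            using False fP[OF yP] heavyI[of y J N "f (False, y)" D "f (True, y)"] yJ finN by blast
          then show ?thesis using f(2)[OF y] unfolding W_def H_def by blast
        qed
      qed
    next
      fix y y' assume y: "y \<in> Y" "y' \<in> Y" "y \<noteq> y'"
      have ff: "f (b, y) \<noteq> f (b', y')" for b b' using f(1) y unfolding inj_on_def by blast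
      have fl: "f (b, y) \<in> L" "f (b, y') \<in> L" for b using f(2) y by auto
      have "\<not> (t \<in> J - P \<and> f (False, y) \<in> N t \<and> f (False, y') \<in> N t)" for t
        using single[of t "f (False, y)" "f (False, y')"] fl ff by blast
      moreover have "y \<noteq> f (b, y')" "y' \<noteq> f (b, y)" for b using y fl YK by blast+
      moreover have "y \<notin> J - P" "y' \<notin> J - P" using YJP y by blast+
      moreover have "f (b, y) \<notin> J - P" "f (b, y') \<notin> J - P" for b using fl LJ by blast+
      ultimately show "W y \<inter> W y' = {}" unfolding W_def using ff y(3) by blast
    qed
    moreover have "card H = card (D \<inter> (L \<union> Y)) + card (heavy J N D \<inter> M)"
      unfolding H_def using finD fin D(1) heavy_subset[of J N D] KJ
      by (intro card_Un_disjoint) auto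
    moreover have "card ?D + card (D \<inter> (L \<union> Y)) = card D"
    proof -
      have "D = ?D \<union> (D \<inter> (L \<union> Y))" by blast
      then show ?thesis using card_Un_disjoint[of ?D "D \<inter> (L \<union> Y)"] finD by fastforce
    qed
    moreover have "heavy ?J ?N ?D \<subseteq> heavy J N D - M"
    proof
      fix t assume t: "t \<in> heavy ?J ?N ?D"
      have tJ: "t \<in> J" "t \<notin> Y" using t by (auto simp: heavy_def)
      have "card (?N t - ?D) \<le> card (N t - D)" using finN[OF tJ(1)] by (intro card_mono) auto
      then have 1: "t \<in> heavy J N D" using t tJ by (simp add: heavy_def)
      have "t \<notin> M"
      proof
        assume "t \<in> M"
        then obtain u where u: "t \<in> J - P" "u \<in> L" "u \<in> N t" using tJ(2) unfolding M_def by blast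
        have "?N t - ?D \<subseteq> {u}" using small[OF u] by blast
        then show False using not_heavyI[of ?N t ?D u ?J] t by blast
      qed
      then show "t \<in> heavy J N D - M" using 1 by blast
    qed
    then have "card (heavy ?J ?N ?D) \<le> card (heavy J N D - M)" using fin by (intro card_mono) auto
    moreover have "card (heavy J N D - M) + card (heavy J N D \<inter> M) = card (heavy J N D)"
      using card_Diff_subset_Int[of "heavy J N D" M] fin
        card_mono[of "heavy J N D" "heavy J N D \<inter> M"] by simp
    ultimately have *: "card ?D + card (heavy ?J ?N ?D) + card Y \<le> k" using D(2) by linarith
    then have "card ?D + card (heavy ?J ?N ?D) \<le> k - card Y" by linarith
    moreover have "?D \<subseteq> ?K" using D(1) by blast
    ultimately have "hyes ?K ?J ?N {} (k - card Y)" unfolding hyes_def by blast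
    then show "card Y \<le> k \<and> hyes ?K ?J ?N {} (k - card Y)" using * by linarith
  next
    assume "card Y \<le> k \<and> hyes ?K ?J ?N {} (k - card Y)"
    then obtain D where D: "card Y \<le> k" "D \<subseteq> ?K" "card D + card (heavy ?J ?N D) \<le> k - card Y"
      unfolding hyes_def by blast
    \<comment> \<open>Heads in \<open>P\<close> are terminals and cannot be put into
      \<open>D\<close>; they may turn heavy, at a cost of at most
      \<open>card (Y \<inter> P)\<close>.\<close>
    let ?D = "D \<union> (Y \<inter> X)"
    have sub: "heavy J N ?D \<subseteq> heavy ?J ?N D \<union> (Y \<inter> P)"
    proof
      fix t assume t: "t \<in> heavy J N ?D"
      then have tJ: "t \<in> J" by (simp add: heavy_def)
      have NK: "N t \<subseteq> K" using N[OF tJ] .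
      have YP: "t \<in> Y \<Longrightarrow> t \<in> Y \<inter> P" using Y X KJ tJ by blast
      show "t \<in> heavy ?J ?N D \<union> (Y \<inter> P)"
      proof (cases "t \<in> Y \<or> N t \<inter> L = {}")
        case True
        have "card (N t - ?D) \<le> card (?N t - D)" if "N t \<inter> L = {}"
        proof (rule card_mono)
          show "finite (?N t - D)" using finN[OF tJ] by simp
          show "N t - ?D \<subseteq> ?N t - D" using that NK Y P KJ by blast
        qed
        then show ?thesis using t True YP tJ by (auto simp: heavy_def)
      next
        case False
        then obtain u where u: "u \<in> L" "u \<in> N t" by blast
        then have tP: "t \<in> J - P" using cl2[of u t] False tJ by blast
        have "N t - ?D \<subseteq> {u}"
          using small[OF tP u] NK Y P KJ by blast
        then show ?thesis using not_heavyI[of N t ?D u J] t by blast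
      qed
    qed
    have finD: "finite D" using D(2) fin finite_subset by (metis finite_Diff)
    have "card (heavy J N ?D) \<le> card (heavy ?J ?N D \<union> (Y \<inter> P))"
      using sub fin finY by (intro card_mono) auto
    also have "\<dots> \<le> card (heavy ?J ?N D) + card (Y \<inter> P)" by (rule card_Un_le)
    finally have 1: "card (heavy J N ?D) \<le> card (heavy ?J ?N D) + card (Y \<inter> P)" .
    have 2: "card ?D \<le> card D + card (Y \<inter> X)" by (rule card_Un_le)
    have "card (Y \<inter> X) + card (Y \<inter> P) = card ((Y \<inter> X) \<union> (Y \<inter> P))"
      using finY X P KJ by (intro card_Un_disjoint[symmetric]) auto
    also have "\<dots> \<le> card Y" using finY by (intro card_mono) auto
    finally have "card ?D + card (heavy J N ?D) \<le> k" using 1 2 D(1,3) by linarith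
    moreover have "?D \<subseteq> K" using D(2) X by blast
    ultimately show "hyes K J N {} k" unfolding hyes_def by blast
  qed
qed

text \<open>A terminal with neighbourhood \<open>{u, v}\<close> enforces the pair: leaving it heavy
  costs one, and so does deleting \<open>u\<close> instead. The set \<open>J'\<close> allows
  terminals without neighbours to be dropped at the same time.\<close>

lemma hyes_pairs_as_terminals:
  fixes K :: "'a set" and J :: "'t set"
  assumes fin: "finite K" "finite J" "finite F" and F: "\<And>u v. (u, v) \<in> F \<Longrightarrow> u \<in> K \<and> v \<in> K \<and> u \<noteq> v"
    and nm: "inj_on nm F" "nm ` F \<inter> J = {}" and M: "\<And>u v. (u, v) \<in> F \<Longrightarrow> M (nm (u, v)) = {u, v}"
    and MN: "\<And>t. t \<in> J \<Longrightarrow> M t = N t" and J': "J' \<subseteq> J" "\<And>t. t \<in> J - J' \<Longrightarrow> N t = {}"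
  shows "hyes K J N F k \<longleftrightarrow> hyes K (J' \<union> nm ` F) M {} k"
proof
  assume "hyes K J N F k"
  then obtain D where D: "D \<subseteq> K" "\<forall>(u, v)\<in>F. u \<in> D \<or> v \<in> D" "card D + card (heavy J N D) \<le> k"
    unfolding hyes_def by blast
  have "heavy (J' \<union> nm ` F) M D \<subseteq> heavy J N D"
  proof
    fix t assume t: "t \<in> heavy (J' \<union> nm ` F) M D"
    show "t \<in> heavy J N D"
    proof (cases "t \<in> J'")
      case True
      then have "t \<in> J" using J' by blast
      then show ?thesis using t MN[of t] by (simp add: heavy_def)
    next
      case False
      then obtain u v where uv: "(u, v) \<in> F" "t = nm (u, v)" using t unfolding heavy_def by auto
      then have "u \<in> D \<or> v \<in> D" using D(2) by blast
      then have "M t - D \<subseteq> {u} \<or> M t - D \<subseteq> {v}" using M[OF uv(1)] uv(2) by auto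
      then show ?thesis using t not_heavyI by metis
    qed
  qed
  then have "card (heavy (J' \<union> nm ` F) M D) \<le> card (heavy J N D)"
    using fin by (intro card_mono) auto
  then have "card D + card (heavy (J' \<union> nm ` F) M D) \<le> k" using D(3) by linarith
  then show "hyes K (J' \<union> nm ` F) M {} k" unfolding hyes_def using D(1) by blast
next
  assume "hyes K (J' \<union> nm ` F) M {} k"
  then obtain D where D: "D \<subseteq> K" "card D + card (heavy (J' \<union> nm ` F) M D) \<le> k"
    unfolding hyes_def by blast
  \<comment> \<open>Pairs violated by \<open>D\<close>: the unit paid for the heavy terminal is
    spent on the first element of the pair.\<close>
  let ?A = "{p \<in> F. nm p \<in> heavy (J' \<union> nm ` F) M D}"
  let ?D = "D \<union> fst ` ?A"
  have finA: "finite ?A" using fin by simp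
  have finJ: "finite J'" using fin J' finite_subset by metis
  have AK: "fst ` ?A \<subseteq> K" using F by auto
  have finD: "finite D" using D fin finite_subset by metis
  have hit: "u \<in> ?D \<or> v \<in> ?D" if uv: "(u, v) \<in> F" for u v
  proof (rule ccontr)
    assume n: "\<not> (u \<in> ?D \<or> v \<in> ?D)"
    have "nm (u, v) \<in> heavy (J' \<union> nm ` F) M D"
      using uv n F[OF uv] M[OF uv] by (intro heavyI[of _ _ _ u _ v]) auto
    then have "(u, v) \<in> ?A" using uv by simp
    then have "u \<in> fst ` ?A" by (metis (no_types, lifting) fst_conv imageI)
    then show False using n by blast
  qed
  have "heavy J N ?D \<subseteq> heavy J' M D"
  proof
    fix t assume t: "t \<in> heavy J N ?D"
    then have tJ: "t \<in> J" by (simp add: heavy_def)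
    have "N t \<noteq> {}" using t by (auto simp: heavy_def)
    then have tJ': "t \<in> J'" using J'(2) tJ by blast
    have "2 \<le> card (N t - ?D)" using t by (simp add: heavy_def)
    \<comment> \<open>An infinite set has cardinality 0, so a heavy terminal has a finite
      neighbourhood.\<close>
    moreover have "finite (N t)"
    proof (rule ccontr)
      assume "infinite (N t)"
      then have "infinite (N t - ?D)" using finD finA by simp
      then show False using \<open>2 \<le> card (N t - ?D)\<close> by simp
    qed
    then have "card (N t - ?D) \<le> card (N t - D)" by (intro card_mono) auto
    ultimately show "t \<in> heavy J' M D" using MN[OF tJ] tJ' by (simp add: heavy_def)
  qed
  then have 1: "card (heavy J N ?D) \<le> card (heavy J' M D)" using finJ by (intro card_mono) auto
  have "card (fst ` ?A) \<le> card ?A" using finA by (rule card_image_le)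
  also have "\<dots> = card (nm ` ?A)" using nm(1) by (metis (no_types, lifting) card_image inj_on_subset mem_Collect_eq subsetI)
  finally have 2: "card ?D \<le> card D + card (nm ` ?A)" using card_Un_le[of D "fst ` ?A"] by linarith
  have "nm ` ?A \<subseteq> heavy (J' \<union> nm ` F) M D" by blast
  moreover have "heavy J' M D \<subseteq> heavy (J' \<union> nm ` F) M D" by (auto simp: heavy_def)
  ultimately have "card (heavy J' M D \<union> nm ` ?A) \<le> card (heavy (J' \<union> nm ` F) M D)"
    using finJ fin by (intro card_mono Un_least) simp_all
  moreover have "heavy J' M D \<inter> nm ` ?A = {}" using nm(2) J'(1) heavy_subset[of J' M D] by blast
  then have "card (heavy J' M D \<union> nm ` ?A) = card (heavy J' M D) + card (nm ` ?A)"
    using finJ finA by (intro card_Un_disjoint) simp_all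
  ultimately have "card ?D + card (heavy J N ?D) \<le> k" using 1 2 D(2) by linarith
  moreover have "?D \<subseteq> K" using D(1) AK by (rule Un_least)
  moreover have "\<forall>(u, v)\<in>F. u \<in> ?D \<or> v \<in> ?D" by (intro ballI) (metis (no_types, lifting) case_prodI2 hit)
  ultimately show "hyes K J N F k" unfolding hyes_def by (intro exI[of _ ?D] conjI)
qed

section \<open>Terminal triangles in split graphs\<close>

definition T_triangle_free :: "'a ugraph \<Rightarrow> 'a set \<Rightarrow> bool" where
  "T_triangle_free G T \<longleftrightarrow>
     \<not> (\<exists>a b c. a \<in> T \<and> {a, b} \<in> edges G \<and> {b, c} \<in> edges G \<and> {a, c} \<in> edges G)"

lemma simple_graph_edge:
  assumes "simple_graph G" "{u, v} \<in> edges G"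
  shows "u \<noteq> v" "u \<in> verts G" "v \<in> verts G"
  using assms unfolding simple_graph_def by force+

lemma is_cycle_rotate:
  assumes "is_cycle G xs" shows "is_cycle G (rotate m xs)"
  unfolding is_cycle_def
proof (intro conjI allI impI)
  show "3 \<le> length (rotate m xs)" "distinct (rotate m xs)" "set (rotate m xs) \<subseteq> verts G"
    using assms by (auto simp: is_cycle_def)
  fix i assume i: "i < length (rotate m xs)"
  let ?n = "length xs"
  have n: "0 < ?n" using i by (cases xs) auto
  have e: "{xs ! ((m + i) mod ?n), xs ! (Suc ((m + i) mod ?n) mod ?n)} \<in> edges G"
    using assms n by (simp add: is_cycle_def)
  have "rotate m xs ! (Suc i mod ?n) = xs ! ((m + Suc i mod ?n) mod ?n)"
    by (rule nth_rotate) (use n in simp)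
  moreover have "(m + Suc i mod ?n) mod ?n = Suc ((m + i) mod ?n) mod ?n"
    by (simp add: mod_simps)
  ultimately show "{rotate m xs ! i, rotate m xs ! (Suc i mod length (rotate m xs))} \<in> edges G"
    using e i by (simp add: nth_rotate)
qed

text \<open>Rotate the cycle so that a terminal stands at position 0. If both its neighbours on the
  cycle are in the clique, they are adjacent. Otherwise one of them is in \<open>I\<close>; then the
  terminal is in \<open>K\<close>, and so is the vertex two steps away beyond that neighbour, which
  closes a triangle.\<close>

lemma split_T_cycle_iff:
  assumes G: "simple_graph G" and sp: "split_partition G K I"
  shows "(\<exists>xs. is_T_cycle G T xs) \<longleftrightarrow> \<not> T_triangle_free G T"
proof
  assume "\<exists>xs. is_T_cycle G T xs"
  then obtain xs where xs: "is_cycle G xs" "set xs \<inter> T \<noteq> {}" by (auto simp: is_T_cycle_def)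
  then obtain i where i: "i < length xs" "xs ! i \<in> T" by (metis disjoint_iff in_set_conv_nth)
  define ys where "ys = rotate i xs"
  let ?n = "length ys"
  have cyc: "is_cycle G ys" unfolding ys_def using xs(1) by (rule is_cycle_rotate)
  have n: "3 \<le> ?n" and dist: "distinct ys" using cyc by (auto simp: is_cycle_def)
  have ys0: "ys \<noteq> []" using n by auto
  have lt: "0 < ?n" "1 < ?n" "2 < ?n" "?n - 1 < ?n" "?n - 2 < ?n" using n by linarith+
  have y0: "ys ! 0 \<in> T" using nth_rotate[of 0 xs i] i by (cases xs) (auto simp: ys_def)
  have edge: "{ys ! j, ys ! (Suc j mod ?n)} \<in> edges G" if "j < ?n" for j
    using cyc that by (simp add: is_cycle_def)
  have KI: "ys ! j \<in> K \<or> ys ! j \<in> I" if "j < ?n" for j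
    using sp cyc that nth_mem[OF that] unfolding split_partition_def is_cycle_def by blast
  have KK: "{u, v} \<in> edges G" if "u \<in> K" "v \<in> K" "u \<noteq> v" for u v
    using sp that unfolding split_partition_def clique_def by blast
  have II: "{u, v} \<notin> edges G" if "u \<in> I" "v \<in> I" for u v
    using sp that unfolding split_partition_def independent_set_def by blast
  have ne: "ys ! j \<noteq> ys ! l" if "j < ?n" "l < ?n" "j \<noteq> l" for j l
    using dist that by (simp add: nth_eq_iff_index_eq)
  have e1: "{ys ! 0, ys ! 1} \<in> edges G" using edge[of 0] n ys0 by simp
  have el: "{ys ! 0, ys ! (?n - 1)} \<in> edges G"
    using edge[of "?n - 1"] n ys0 by (simp add: insert_commute)
  have e2: "{ys ! 1, ys ! 2} \<in> edges G" using edge[of 1] n by (simp add: numeral_2_eq_2)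
  have ell: "{ys ! (?n - 1), ys ! (?n - 2)} \<in> edges G"
  proof -
    have "Suc (?n - 2) mod ?n = ?n - 1" using n by simp
    then show ?thesis using edge[of "?n - 2"] n by (simp add: insert_commute)
  qed
  show "\<not> T_triangle_free G T"
  proof (cases "ys ! 1 \<in> K \<and> ys ! (?n - 1) \<in> K")
    case True
    have "{ys ! 1, ys ! (?n - 1)} \<in> edges G" using True n by (intro KK ne) auto
    then show ?thesis using y0 e1 el unfolding T_triangle_free_def by blast
  next
    case False
    then have "ys ! 1 \<in> I \<or> ys ! (?n - 1) \<in> I" using KI[OF lt(2)] KI[OF lt(4)] by blast
    then have 0: "ys ! 0 \<in> K" using II e1 el KI[OF lt(1)] by blast
    show ?thesis
    proof (cases "ys ! 1 \<in> I")
      case True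
      then have "ys ! 2 \<in> K" using II e2 KI[OF lt(3)] by blast
      then have "{ys ! 0, ys ! 2} \<in> edges G" using 0 n by (intro KK ne) auto
      then show ?thesis using y0 e1 e2 unfolding T_triangle_free_def by blast
    next
      case False
      then have "ys ! (?n - 1) \<in> I" using \<open>ys ! 1 \<in> I \<or> ys ! (?n - 1) \<in> I\<close> by simp
      then have "ys ! (?n - 2) \<in> K" using II ell KI[OF lt(5)] by blast
      then have "{ys ! 0, ys ! (?n - 2)} \<in> edges G" using 0 n by (intro KK ne) auto
      then show ?thesis using y0 el ell unfolding T_triangle_free_def by blast
    qed
  qed
next
  assume "\<not> T_triangle_free G T"
  then obtain a b c where t: "a \<in> T" "{a, b} \<in> edges G" "{b, c} \<in> edges G" "{a, c} \<in> edges G"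
    unfolding T_triangle_free_def by blast
  have "is_cycle G [a, b, c]"
    unfolding is_cycle_def
  proof (intro conjI allI impI)
    show "3 \<le> length [a, b, c]" by simp
    show "distinct [a, b, c]" using simple_graph_edge[OF G] t by auto
    show "set [a, b, c] \<subseteq> verts G" using simple_graph_edge[OF G] t by auto
    fix i assume "i < length [a, b, c]"
    then consider "i = 0" | "i = 1" | "i = 2" by fastforce
    then show "{[a, b, c] ! i, [a, b, c] ! (Suc i mod length [a, b, c])} \<in> edges G"
      using t by cases (auto simp: insert_commute)
  qed
  then show "\<exists>xs. is_T_cycle G T xs" using t(1) unfolding is_T_cycle_def by fastforce
qed

definition hits :: "'a ugraph \<Rightarrow> 'a set \<Rightarrow> 'a set \<Rightarrow> bool" where
  "hits G T S \<longleftrightarrow> (\<forall>a b c. a \<in> T \<longrightarrow> {a, b} \<in> edges G \<longrightarrow> {b, c} \<in> edges G \<longrightarrow> {a, c} \<in> edges G \<longrightarrow>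
     a \<in> S \<or> b \<in> S \<or> c \<in> S)"

text \<open>Deleting vertices preserves the split partition, so the triangle criterion applies to
  \<open>G - S\<close>.\<close>

lemma yes_instance_iff_hits:
  assumes G: "simple_graph G" and sp: "split_partition G K I"
  shows "yes_instance G T k \<longleftrightarrow> (\<exists>S\<subseteq>verts G. int (card S) \<le> k \<and> hits G T S)"
proof -
  have "\<not> (\<exists>xs. is_T_cycle (del_verts G S) T xs) \<longleftrightarrow> hits G T S" for S
  proof -
    have 1: "simple_graph (del_verts G S)"
      using G unfolding simple_graph_def del_verts_def by auto
    have 2: "split_partition (del_verts G S) (K - S) (I - S)"
      using sp unfolding split_partition_def clique_def independent_set_def del_verts_def by auto
    show ?thesis unfolding split_T_cycle_iff[OF 1 2] T_triangle_free_def hits_def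
      by (simp add: del_verts_def) blast
  qed
  then show ?thesis unfolding yes_instance_def by auto
qed

lemma two_le_cardE:
  assumes "2 \<le> card A"
  obtains u v where "u \<in> A" "v \<in> A" "u \<noteq> v"
proof -
  obtain a B where B: "A = insert a B" "a \<notin> B" "1 \<le> card B"
    using assms card_le_Suc_iff[of 1 A] by (auto simp: numeral_2_eq_2)
  then obtain b where "b \<in> B" by fastforce
  then show ?thesis using that[of a b] B by auto
qed

text \<open>Once the clique terminals are deleted, a terminal triangle consists of a terminal
  outside \<open>K\<close> and two of its neighbours in \<open>K - T\<close>. So a solution
  \<open>S\<close> restricts to \<open>D = S \<inter> (K - T)\<close> and contains every terminal
  that is heavy for \<open>D\<close>; conversely \<open>K \<inter> T\<close>, \<open>D\<close> and
  the heavy terminals form a solution.\<close>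

lemma yes_instance_iff_hyes:
  fixes G :: "'a ugraph"
  assumes G: "simple_graph G" and sp: "split_partition G K I" and T: "T \<subseteq> verts G"
    and forced: "\<And>S. S \<subseteq> verts G \<Longrightarrow> card S \<le> k \<Longrightarrow> hits G T S \<Longrightarrow> K \<inter> T \<subseteq> S"
  shows "yes_instance G T (int k) \<longleftrightarrow> card (K \<inter> T) \<le> k \<and>
    hyes (K - T) (T - K) (\<lambda>t. {u \<in> K - T. {u, t} \<in> edges G}) {} (k - card (K \<inter> T))"
    (is "_ \<longleftrightarrow> _ \<and> hyes ?K ?J ?N {} _")
proof -
  have fin: "finite (verts G)" using G by (simp add: simple_graph_def)
  have KI: "K \<union> I = verts G" "K \<inter> I = {}" using sp by (auto simp: split_partition_def)
  have finK: "finite K" and finT: "finite T" using finite_subset[OF _ fin] KI T by auto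
  have KK: "{u, v} \<in> edges G" if "u \<in> K" "v \<in> K" "u \<noteq> v" for u v
    using sp that unfolding split_partition_def clique_def by blast
  have II: "{u, v} \<notin> edges G" if "u \<in> I" "v \<in> I" for u v
    using sp that unfolding split_partition_def independent_set_def by blast
  note nodes = simple_graph_edge[OF G]
  show ?thesis
  proof
    assume "yes_instance G T (int k)"
    then obtain S where S: "S \<subseteq> verts G" "card S \<le> k" "hits G T S"
      using yes_instance_iff_hits[OF G sp] by auto
    have KT: "K \<inter> T \<subseteq> S" using forced[OF S] .
    have finS: "finite S" using S(1) fin by (rule finite_subset)
    let ?D = "S \<inter> ?K"
    have H: "heavy ?J ?N ?D \<subseteq> S \<inter> ?J"
    proof
      fix t assume t: "t \<in> heavy ?J ?N ?D"
      then have tJ: "t \<in> ?J" and c2: "2 \<le> card (?N t - ?D)" by (auto simp: heavy_def)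
      obtain u v where uv: "u \<in> ?N t - ?D" "v \<in> ?N t - ?D" "u \<noteq> v"
        by (rule two_le_cardE[OF c2])
      have "{u, v} \<in> edges G" using uv by (intro KK) auto
      moreover have "{t, u} \<in> edges G" "{t, v} \<in> edges G" using uv by (auto simp: insert_commute)
      ultimately have "t \<in> S \<or> u \<in> S \<or> v \<in> S" using S(3) tJ unfolding hits_def by blast
      then show "t \<in> S \<inter> ?J" using uv tJ by blast
    qed
    have "card ((K \<inter> T) \<union> ?D \<union> heavy ?J ?N ?D) = card (K \<inter> T) + card ?D + card (heavy ?J ?N ?D)"
    proof -
      have "card ((K \<inter> T) \<union> ?D) = card (K \<inter> T) + card ?D"
        using finK finS by (intro card_Un_disjoint) auto
      moreover have "card ((K \<inter> T) \<union> ?D \<union> heavy ?J ?N ?D) = card ((K \<inter> T) \<union> ?D) + card (heavy ?J ?N ?D)"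
        using finK finS finT H by (intro card_Un_disjoint) auto
      ultimately show ?thesis by simp
    qed
    moreover have "card ((K \<inter> T) \<union> ?D \<union> heavy ?J ?N ?D) \<le> card S"
      using KT H finS by (intro card_mono) auto
    ultimately have *: "card (K \<inter> T) + card ?D + card (heavy ?J ?N ?D) \<le> k" using S(2) by linarith
    then have "card ?D + card (heavy ?J ?N ?D) \<le> k - card (K \<inter> T)" by linarith
    then have "hyes ?K ?J ?N {} (k - card (K \<inter> T))" unfolding hyes_def by (intro exI[of _ ?D]) auto
    then show "card (K \<inter> T) \<le> k \<and> hyes ?K ?J ?N {} (k - card (K \<inter> T))" using * by simp
  next
    assume "card (K \<inter> T) \<le> k \<and> hyes ?K ?J ?N {} (k - card (K \<inter> T))"
    then obtain D where D: "card (K \<inter> T) \<le> k" "D \<subseteq> ?K" "card D + card (heavy ?J ?N D) \<le> k - card (K \<inter> T)"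
      unfolding hyes_def by blast
    let ?S = "(K \<inter> T) \<union> D \<union> heavy ?J ?N D"
    have "card ?S \<le> card (K \<inter> T) + card D + card (heavy ?J ?N D)"
      using card_Un_le[of "(K \<inter> T) \<union> D" "heavy ?J ?N D"] card_Un_le[of "K \<inter> T" D] by linarith
    then have c: "int (card ?S) \<le> int k" using D by linarith
    have sub: "?S \<subseteq> verts G" using D(2) KI T heavy_subset[of ?J ?N D] by blast
    have "hits G T ?S"
      unfolding hits_def
    proof (intro allI impI)
      fix a b c assume t: "a \<in> T" "{a, b} \<in> edges G" "{b, c} \<in> edges G" "{a, c} \<in> edges G"
      show "a \<in> ?S \<or> b \<in> ?S \<or> c \<in> ?S"
      proof (rule ccontr)
        assume n: "\<not> (a \<in> ?S \<or> b \<in> ?S \<or> c \<in> ?S)"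
        have aJ: "a \<in> ?J" using n t(1) by blast
        then have aI: "a \<in> I" using T KI by blast
        have "b \<in> K" "c \<in> K" using nodes(3)[OF t(2)] nodes(3)[OF t(4)] KI II[OF aI] t by blast+
        then have "b \<in> ?K" "c \<in> ?K" using n by blast+
        moreover have "{b, a} \<in> edges G" "{c, a} \<in> edges G" using t by (simp_all add: insert_commute)
        ultimately have "b \<in> ?N a - D" "c \<in> ?N a - D" using n by auto
        then have "a \<in> heavy ?J ?N D"
          using nodes(1)[OF t(3)] aJ finK by (intro heavyI[of _ _ _ b _ c]) auto
        then show False using n by blast
      qed
    qed
    then show "yes_instance G T (int k)" using yes_instance_iff_hits[OF G sp] c sub by blast
  qed
qed

text \<open>The solution deletes all of \<open>K\<close> but \<open>u\<close> and \<open>w\<close>;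
  the choice \<open>u = w\<close> keeps a single vertex.\<close>

definition small_clique :: "'a ugraph \<Rightarrow> 'a set \<Rightarrow> 'a set \<Rightarrow> 'a set \<Rightarrow> nat \<Rightarrow> bool" where
  "small_clique G T K I k \<longleftrightarrow> (\<exists>u\<in>K. \<exists>w\<in>K. card (K - {u, w}) \<le> k \<and>
     \<not> (u \<noteq> w \<and> (\<exists>i\<in>I. {i, u} \<in> edges G \<and> {i, w} \<in> edges G \<and> (u \<in> T \<or> w \<in> T \<or> i \<in> T))))"

text \<open>A surviving triangle has at most one vertex in \<open>I\<close>, so it would consist of
  \<open>u\<close>, \<open>w\<close> and one \<open>i\<close>, which the definition
  excludes.\<close>

lemma small_clique_yes:
  assumes G: "simple_graph G" and sp: "split_partition G K I" and sm: "small_clique G T K I k"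
  shows "yes_instance G T (int k)"
proof -
  obtain u w where uw: "u \<in> K" "w \<in> K" "card (K - {u, w}) \<le> k"
     "\<not> (u \<noteq> w \<and> (\<exists>i\<in>I. {i, u} \<in> edges G \<and> {i, w} \<in> edges G \<and> (u \<in> T \<or> w \<in> T \<or> i \<in> T)))"
    using sm unfolding small_clique_def by blast
  have KI: "K \<union> I = verts G" using sp by (auto simp: split_partition_def)
  have II: "{u, v} \<notin> edges G" if "u \<in> I" "v \<in> I" for u v
    using sp that unfolding split_partition_def independent_set_def by blast
  note nodes = simple_graph_edge[OF G]
  have "hits G T (K - {u, w})"
    unfolding hits_def
  proof (intro allI impI, rule ccontr)
    fix a b c assume t: "a \<in> T" "{a, b} \<in> edges G" "{b, c} \<in> edges G" "{a, c} \<in> edges G"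
      and n: "\<not> (a \<in> K - {u, w} \<or> b \<in> K - {u, w} \<or> c \<in> K - {u, w})"
    have d: "a \<noteq> b" "b \<noteq> c" "a \<noteq> c" using nodes(1) t by blast+
    have v: "a \<in> I \<or> a \<in> {u, w}" "b \<in> I \<or> b \<in> {u, w}" "c \<in> I \<or> c \<in> {u, w}"
      using nodes(2,3) t n KI by blast+
    have ni: "\<not> (a \<in> I \<and> b \<in> I)" "\<not> (b \<in> I \<and> c \<in> I)" "\<not> (a \<in> I \<and> c \<in> I)" using II t by blast+
    have e: "{b, a} \<in> edges G" "{c, b} \<in> edges G" "{c, a} \<in> edges G" using t by (simp_all add: insert_commute)
    show False using d v ni t e uw(4) by (elim disjE; auto)
  qed
  moreover have "K - {u, w} \<subseteq> verts G" using KI by blast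
  ultimately show ?thesis using yes_instance_iff_hits[OF G sp] uw(3) by (metis of_nat_le_iff)
qed

text \<open>A surviving terminal \<open>t\<close> of the clique tolerates at most one further
  surviving clique vertex \<open>w\<close>, as two would close a triangle with it. Since keeping
  \<open>t\<close> and \<open>w\<close> is no small-clique solution, they lie in a terminal triangle
  with some \<open>i\<close> in \<open>I\<close>, and \<open>S\<close> contains \<open>i\<close> or
  \<open>w\<close>. Exchanging \<open>i\<close> for \<open>w\<close> shows that deleting
  \<open>K - {t}\<close> is affordable, a contradiction.\<close>

lemma not_small_clique_forced:
  assumes G: "simple_graph G" and sp: "split_partition G K I" and sm: "\<not> small_clique G T K I k"
    and S: "S \<subseteq> verts G" "card S \<le> k" "hits G T S"
  shows "K \<inter> T \<subseteq> S"
proof (rule ccontr)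
  assume "\<not> K \<inter> T \<subseteq> S"
  then obtain t where t: "t \<in> K" "t \<in> T" "t \<notin> S" by blast
  have fin: "finite S" using S(1) G unfolding simple_graph_def by (intro finite_subset[OF S(1)]) simp
  have KI: "K \<union> I = verts G" using sp by (auto simp: split_partition_def)
  have finK: "finite K" using G KI by (metis finite_Un simple_graph_def)
  have KK: "{u, v} \<in> edges G" if "u \<in> K" "v \<in> K" "u \<noteq> v" for u v
    using sp that unfolding split_partition_def clique_def by blast
  have one: "u = v" if "u \<in> K - S - {t}" "v \<in> K - S - {t}" for u v
  proof (rule ccontr)
    assume "u \<noteq> v"
    then have "{t, u} \<in> edges G" "{u, v} \<in> edges G" "{t, v} \<in> edges G" using that t by (auto intro: KK)
    then show False using S(3) t that unfolding hits_def by blast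
  qed
  \<comment> \<open>The choice \<open>w = t\<close> stands for \<open>t\<close> being the only
    clique vertex that survives.\<close>
  obtain w where w: "w \<in> K" "K - {t, w} \<subseteq> S"
  proof (cases "K - S - {t} = {}")
    case True
    then show ?thesis using that[of t] t by blast
  next
    case False
    then obtain w where "w \<in> K - S - {t}" by blast
    then show ?thesis using that[of w] one by blast
  qed
  have "card (K - {t, w}) \<le> k" using card_mono[OF fin w(2)] S(2) by simp
  then obtain i where i: "t \<noteq> w" "i \<in> I" "{i, t} \<in> edges G" "{i, w} \<in> edges G"
    using sm t w unfolding small_clique_def by blast
  have "{t, i} \<in> edges G" "{t, w} \<in> edges G" using i t w by (auto simp: insert_commute intro: KK)
  then have iw: "i \<in> S \<or> w \<in> S" using S(3) i t unfolding hits_def by blast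
  have "card (K - {t}) \<le> card S"
  proof -
    have "i \<notin> K" using i(2) sp unfolding split_partition_def by blast
    have 1: "card (K - {t}) \<le> card (K - {t} - {w}) + 1"
    proof -
      have "card (K - {t}) \<le> card (insert w (K - {t} - {w}))" using finK by (intro card_mono) auto
      then show ?thesis using finK by (simp add: card_insert_if split: if_splits)
    qed
    show ?thesis
    proof (cases "w \<in> S")
      case True
      then show ?thesis using w fin by (intro card_mono) auto
    next
      case False
      then have "i \<in> S" using iw by blast
      then have "insert i (K - {t} - {w}) \<subseteq> S" using w by blast
      then have "card (insert i (K - {t} - {w})) \<le> card S" using fin by (rule card_mono[rotated])
      moreover have "card (insert i (K - {t} - {w})) = card (K - {t} - {w}) + 1"
        using \<open>i \<notin> K\<close> finK by simp
      ultimately show ?thesis using 1 by linarith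
    qed
  qed
  \<comment> \<open>The pair \<open>t, t\<close> is a witness for \<open>small_clique\<close>: its
    triangle condition is void for equal vertices.\<close>
  then have "card (K - {t, t}) \<le> k" using S(2) by simp
  then show False using sm t(1) unfolding small_clique_def by blast
qed

section \<open>Binary numbers\<close>

fun bits :: "nat \<Rightarrow> bool list" where
  "bits n = (if n = 0 then [] else odd n # bits (n div 2))"

declare bits.simps [simp del]

text \<open>A number and its little-endian bit list are the same tree, so converting between them is
  free and list folds can do arithmetic.\<close>

lemma encode_bits: "encode (bits n) = encode n"
proof (induction n rule: less_induct)
  case (less n)
  show ?case
  proof (cases "n = 0")
    case True
    then show ?thesis by (simp add: bits.simps enc_simps)
  next
    case False
    then show ?thesis using less[of "n div 2"]
      by (simp add: bits.simps[of n] enc_simps encode_nat_def enc_nat.simps[of n] encode_bool_def)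
  qed
qed

lemma ptime_bits [ptime_intros]: "ptime f \<Longrightarrow> ptime (\<lambda>e. bits (f e))"
  by (rule ptime_comp[OF ptime_same_enc[OF encode_bits]])

definition snoc_bit :: "nat \<Rightarrow> bool \<Rightarrow> nat" where
  "snoc_bit n b = 2 * n + of_bool b"

lemma encode_snoc_bit: "encode (snoc_bit n b) = (if n = 0 \<and> \<not> b then Leaf else encode (b, n))"
  by (cases b) (auto simp: snoc_bit_def enc_simps encode_nat_def encode_bool_def enc_bool_def enc_nat.simps[of "2 * n"]
      enc_nat.simps[of "Suc (2 * n)"] enc_nat.simps[of 0])

lemma size_enc_snoc_bit: "size_enc (snoc_bit n b) \<le> size_enc n + 4"
  by (cases b) (auto simp: encode_snoc_bit enc_simps)

lemma ptime_snoc_bit [ptime_intros]: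
  assumes "ptime f" "ptime g" shows "ptime (\<lambda>e. snoc_bit (f e) (g e))"
proof (rule ptime_comp2[of snoc_bit, OF _ assms])
  have "ptime (\<lambda>w :: nat \<times> bool. if fst w = 0 \<and> \<not> snd w then [] else snd w # bits (fst w))"
    by (intro ptime_intros)
  then show "ptime (\<lambda>w. snoc_bit (fst w) (snd w))"
    by (rule ptime_cong_enc) (auto simp: encode_snoc_bit enc_simps encode_bits)
qed

text \<open>Reads the most significant bit first, opposite to \<open>bits\<close>. This suits
  \<open>inc\<close>, whose carry fold leaves its digits reversed.\<close>

definition of_bits :: "bool list \<Rightarrow> nat" where
  "of_bits bs = foldl snoc_bit 0 bs"

lemma of_bits_foldl: "foldl snoc_bit n bs = n * 2 ^ length bs + of_bits bs"
proof (induction bs arbitrary: n rule: rev_induct)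
  case (snoc b bs)
  then show ?case by (simp add: of_bits_def snoc_bit_def algebra_simps)
qed (simp add: of_bits_def)

lemma of_bits_Cons: "of_bits (b # bs) = of_bool b * 2 ^ length bs + of_bits bs"
  using of_bits_foldl[of "snoc_bit 0 b" bs] by (simp add: of_bits_def snoc_bit_def)

lemma ptime_of_bits [ptime_intros]:
  assumes "ptime f" shows "ptime (\<lambda>e. of_bits (f e))"
  unfolding of_bits_def
  by (intro ptime_foldl_additive[where q = "[:4:]"] ptime_intros assms)
    (use size_enc_snoc_bit in auto)

definition carry_step :: "bool \<times> bool list \<Rightarrow> bool \<Rightarrow> bool \<times> bool list" where
  "carry_step s b = (fst s \<and> b, (fst s \<noteq> b) # snd s)"

definition carry_out :: "bool \<times> bool list \<Rightarrow> bool list" where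
  "carry_out s = (if fst s then True # snd s else snd s)"

definition inc :: "nat \<Rightarrow> nat" where
  "inc n = of_bits (carry_out (foldl carry_step (True, []) (bits n)))"

text \<open>Generalized to a pending carry \<open>c\<close> and finished low digits
  \<open>ds\<close>: the unread number, increased by the carry, has weight
  \<open>2 ^ length ds\<close>.\<close>

lemma carry_foldl:
  "of_bits (carry_out (foldl carry_step (c, ds) (bits n))) = (n + of_bool c) * 2 ^ length ds + of_bits ds"
proof (induction n arbitrary: c ds rule: less_induct)
  case (less n)
  show ?case
  proof (cases "n = 0")
    case True
    then show ?thesis by (simp add: bits.simps carry_out_def of_bits_Cons)
  next
    case False
    define m b where m: "m = n div 2" and b: "b = odd n"
    have n: "n = 2 * m + of_bool b" unfolding m b by simp
    have bits: "bits n = b # bits m" unfolding m b using False by (subst bits.simps) simp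
    have less_m: "m < n" unfolding m using False by simp
    have "of_bits (carry_out (foldl carry_step (c, ds) (bits n))) =
        of_bits (carry_out (foldl carry_step (c \<and> b, (c \<noteq> b) # ds) (bits m)))"
      unfolding bits by (simp add: carry_step_def)
    also have "\<dots> = (m + of_bool (c \<and> b)) * 2 ^ Suc (length ds) + of_bits ((c \<noteq> b) # ds)"
      using less[OF less_m] by simp
    also have "\<dots> = (n + of_bool c) * 2 ^ length ds + of_bits ds"
      unfolding n by (cases c; cases b) (simp_all add: of_bits_Cons algebra_simps)
    finally show ?thesis .
  qed
qed

lemma inc_eq_Suc: "inc n = Suc n"
  using carry_foldl[of True "[]" n] by (simp add: inc_def of_bits_def)

lemma ptime_inc [ptime_intros]:
  assumes "ptime f" shows "ptime (\<lambda>e. inc (f e))"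
  unfolding inc_def carry_out_def carry_step_def
  by (intro ptime_intros ptime_foldl_additive[where q = "[:8:]"] assms)
    (auto simp: enc_simps encode_bool_def enc_bool_def)

lemma size_enc_nat_le: "size_enc (n :: nat) \<le> 4 * n + 1"
proof (induction n rule: less_induct)
  case (less n)
  show ?case
  proof (cases "n = 0")
    case False
    then have "size_enc n = 1 + tsize (enc_bool (odd n)) + size_enc (n div 2)"
      by (simp add: encode_nat_def enc_nat.simps[of n])
    moreover have "tsize (enc_bool (odd n)) \<le> 3" by (simp add: enc_bool_def)
    moreover have "size_enc (n div 2) \<le> 4 * (n div 2) + 1" using less[of "n div 2"] False by simp
    moreover have "2 * (n div 2) \<le> n" "n div 2 < n" using False by simp_all
    ultimately show ?thesis by linarith
  qed (simp add: enc_simps)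
qed

definition binary :: "unit list \<Rightarrow> nat" where
  "binary us = foldl (\<lambda>n _. inc n) 0 us"

lemma binary_eq: "binary us = length us"
  unfolding binary_def by (induction us rule: rev_induct) (auto simp: inc_eq_Suc)

lemma ptime_binary [ptime_intros]:
  assumes "ptime f" shows "ptime (\<lambda>e. binary (f e))"
proof (rule ptime_comp[OF _ assms])
  have "size_enc (foldl (\<lambda>n _. inc n) 0 (take i us)) \<le> poly [:1, 4:] (size_enc us)" for us :: "unit list" and i
    using size_enc_nat_le[of "binary (take i us)"] length_le_size_enc[of us]
    by (simp add: binary_eq flip: binary_def)
  then show "ptime binary"
    unfolding binary_def[abs_def] by (intro ptime_foldl ptime_intros)
qed

definition cap :: "'a list \<Rightarrow> unit list \<Rightarrow> unit list" where
  "cap ys us = (if length us \<le> length ys then us else units ys)"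

text \<open>Horner's scheme from the most significant bit. A binary number can be exponentially
  large, so every intermediate value is cut off at the length of \<open>ys\<close>.\<close>

definition unary :: "'a list \<Rightarrow> nat \<Rightarrow> unit list" where
  "unary ys n = foldl (\<lambda>us b. cap ys (us @ us @ (if b then [()] else []))) [] (rev (bits n))"

lemma length_unary: "length (unary ys n) = min n (length ys)"
proof (induction n rule: less_induct)
  case (less n)
  show ?case
  proof (cases "n = 0")
    case True
    then show ?thesis by (simp add: unary_def bits.simps)
  next
    case False
    then have "unary ys n = cap ys (unary ys (n div 2) @ unary ys (n div 2) @ (if odd n then [()] else []))"
      by (simp add: unary_def bits.simps[of n])
    then have "length (unary ys n) = min (2 * length (unary ys (n div 2)) + of_bool (odd n)) (length ys)"
      by (auto simp: cap_def units_def)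
    \<comment> \<open>Cutting off early is harmless: a value that has reached the cap stays there
      when doubled.\<close>
    also have "\<dots> = min (2 * min (n div 2) (length ys) + of_bool (odd n)) (length ys)"
      using less[of "n div 2"] False by simp
    also have "\<dots> = min n (length ys)"
    proof -
      have "n = 2 * (n div 2) + of_bool (odd n)" by (simp add: mod2_eq_if flip: mod_2_eq_odd)
      then show ?thesis by (simp add: min_def)
    qed
    finally show ?thesis .
  qed
qed

lemma size_enc_units: "size_enc (us :: unit list) = 2 * length us + 1"
  by (induction us) (auto simp: enc_simps)

lemma ptime_unary [ptime_intros]:
  fixes f :: "'e::enc \<Rightarrow> 'a::enc list"
  assumes "ptime f" "ptime g" shows "ptime (\<lambda>e. unary (f e) (g e))"
proof (rule ptime_comp2[of unary, OF _ assms])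
  have "size_enc (cap (fst e) us) \<le> size_enc a + poly [:1, 2:] (size_enc (e, b))"
    for e :: "'a list \<times> nat" and us a :: "unit list" and b :: bool
    using length_le_size_enc[of "fst e"] by (cases e) (auto simp: cap_def size_enc_units units_def enc_simps)
  then show "ptime (\<lambda>w :: 'a list \<times> nat. unary (fst w) (snd w))"
    unfolding unary_def cap_def
    by (intro ptime_foldl_additive[where q = "[:1, 2:]"] ptime_intros)
qed

text \<open>Appending one bits to 0 yields the numbers \<open>2 ^ m - 1\<close>, whose encodings
  have size linear in \<open>m\<close>. They become the fresh names.\<close>

definition ones_after :: "nat \<Rightarrow> 'a list \<Rightarrow> nat" where
  "ones_after n xs = foldl (\<lambda>n _. snoc_bit n True) n xs"

lemma ones_after_eq: "ones_after n xs + 1 = (n + 1) * 2 ^ length xs"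
  unfolding ones_after_def by (induction xs arbitrary: n) (auto simp: snoc_bit_def algebra_simps)

lemma ptime_ones_after [ptime_intros]:
  assumes "ptime f" "ptime g" shows "ptime (\<lambda>e. ones_after (f e) (g e))"
  unfolding ones_after_def
  by (intro ptime_foldl_additive[where q = "[:4:]"] ptime_intros assms) (use size_enc_snoc_bit in auto)

lemma less_power_bits: "n < 2 ^ length (bits n)"
proof (induction n rule: less_induct)
  case (less n)
  show ?case
  proof (cases "n = 0")
    case False
    then have "n div 2 < 2 ^ length (bits (n div 2))" using less[of "n div 2"] by simp
    then show ?thesis using False by (simp add: bits.simps[of n])
  qed simp
qed

section \<open>The kernelization algorithm\<close>

definition adj :: "(nat \<times> nat) list \<Rightarrow> nat \<Rightarrow> nat \<Rightarrow> bool" where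
  "adj es u v \<longleftrightarrow> (u, v) \<in> set es \<or> (v, u) \<in> set es"

definition split_by :: "(nat \<times> nat) list \<Rightarrow> nat list \<Rightarrow> nat list \<Rightarrow> bool" where
  "split_by es W K \<longleftrightarrow> (\<forall>u\<in>set W. \<forall>v\<in>set W. \<not> u = v \<longrightarrow>
     (u \<in> set K \<and> v \<in> set K \<longrightarrow> adj es u v) \<and> (\<not> u \<in> set K \<and> \<not> v \<in> set K \<longrightarrow> \<not> adj es u v))"

text \<open>\<open>a\<close> is taken out of the clique, \<open>b\<close> is put in, and
  \<open>s\<close> decides about the new vertex \<open>v\<close>. Choosing \<open>a = v\<close> or
  \<open>b = v\<close> means no removal or no insertion.\<close>

definition adjust :: "nat list \<Rightarrow> nat list \<Rightarrow> nat \<Rightarrow> nat \<Rightarrow> nat \<Rightarrow> bool \<Rightarrow> nat list" where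
  "adjust W K v a b s = filter (\<lambda>x. if x = v then s else (x \<in> set K \<and> \<not> x = a) \<or> x = b) (v # W)"

abbreviation corrections :: "nat list \<Rightarrow> nat list \<Rightarrow> nat \<Rightarrow> nat list list" where
  "corrections W K v \<equiv> concat (map (\<lambda>a. concat (map (\<lambda>b.
     map (\<lambda>c. adjust W K v a b c) [True, False]) (v # W))) (v # W))"

definition extend_clique :: "(nat \<times> nat) list \<Rightarrow> nat list \<times> nat list \<Rightarrow> nat \<Rightarrow> nat list \<times> nat list" where
  "extend_clique es s v = (v # fst s,
     (case filter (\<lambda>K. split_by es (v # fst s) K) (corrections (fst s) (snd s) v)
      of [] \<Rightarrow> [] | K # Ks \<Rightarrow> K))"

definition find_clique :: "(nat \<times> nat) list \<Rightarrow> nat list \<Rightarrow> nat list" where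
  "find_clique es vs = snd (foldl (\<lambda>s v. extend_clique es s v) ([], []) vs)"

definition small_check :: "nat list \<Rightarrow> (nat \<times> nat) list \<Rightarrow> nat list \<Rightarrow> nat list \<Rightarrow> unit list \<Rightarrow> bool" where
  "small_check vs es ts K k \<longleftrightarrow> (\<exists>u\<in>set K. \<exists>w\<in>set K.
     length (filter (\<lambda>x. \<not> x = u \<and> \<not> x = w) K) \<le> length k \<and>
     \<not> (\<not> u = w \<and> (\<exists>i\<in>set vs. \<not> i \<in> set K \<and> adj es i u \<and> adj es i w \<and>
        (u \<in> set ts \<or> w \<in> set ts \<or> i \<in> set ts))))"

definition hyperedges :: "(nat \<times> nat) list \<Rightarrow> nat list \<Rightarrow> nat list \<Rightarrow> (nat \<times> nat list) list" where
  "hyperedges es ts K = map (\<lambda>t. (t, filter (\<lambda>u. \<not> u \<in> set ts \<and> adj es u t) K)) (filter (\<lambda>t. \<not> t \<in> set K) ts)"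

definition pack_step :: "nat list \<times> nat list \<Rightarrow> nat \<times> nat list \<Rightarrow> nat list \<times> nat list" where
  "pack_step s p = (case filter (\<lambda>u. \<not> u \<in> set (fst s)) (snd p) of [] \<Rightarrow> s | u # r \<Rightarrow>
     (case r of [] \<Rightarrow> s | w # r' \<Rightarrow> (u # w # fst s, fst p # snd s)))"

definition pack :: "(nat \<times> nat list) list \<Rightarrow> nat list \<times> nat list" where
  "pack hs = foldl (\<lambda>s p. pack_step s p) ([], []) hs"

text \<open>The left side is the clique outside the packing, the right side two copies of every
  packed vertex. A clique vertex sees a packed terminal that is its neighbour, and a packed clique
  vertex with which it shares an unpacked terminal. Doubling turns a crown into a
  2-expansion.\<close>

definition expansion_edges :: "nat list \<Rightarrow> (nat \<times> nat list) list \<Rightarrow> nat list \<Rightarrow> nat list \<Rightarrow>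
    (nat \<times> (bool \<times> nat) list) list" where
  "expansion_edges K hs X P = map (\<lambda>u. (u, concat (map (\<lambda>y.
     if \<exists>p\<in>set hs. u \<in> set (snd p) \<and> (if fst p \<in> set P then y = fst p else y \<in> set (snd p))
     then [(False, y), (True, y)] else []) (X @ P)))) (filter (\<lambda>u. \<not> u \<in> set X) K)"

definition copies :: "nat list \<Rightarrow> (bool \<times> nat) list" where
  "copies Y = map (\<lambda>y. (False, y)) Y @ map (\<lambda>y. (True, y)) Y"

text \<open>The triangles at \<open>v\<close> form a bipartite graph between the terminals at
  \<open>v\<close> and the rest of the clique; the crown is taken there.\<close>

definition thin_step :: "nat list \<Rightarrow> (nat \<times> nat list) list \<times> (nat \<times> nat) list \<Rightarrow> nat \<Rightarrow>
    (nat \<times> nat list) list \<times> (nat \<times> nat) list" where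
  "thin_step K s v =
     (let c = crown (map (\<lambda>p. (fst p, filter (\<lambda>u. \<not> u = v) (snd p))) (filter (\<lambda>p. v \<in> set (snd p)) (fst s)))
        (filter (\<lambda>u. \<not> u = v) K)
      in (map (\<lambda>p. (fst p, if fst p \<in> set (fst c) then filter (\<lambda>u. \<not> u = v) (snd p) else snd p)) (fst s),
          map (\<lambda>a. (v, a)) (snd c) @ snd s))"

definition thin :: "nat list \<Rightarrow> (nat \<times> nat list) list \<Rightarrow> (nat \<times> nat list) list \<times> (nat \<times> nat) list" where
  "thin K hs = foldl (\<lambda>s v. thin_step K s v) (hs, []) K"

text \<open>The part of the list from the first \<open>p\<close> on, reversed. Its length identifies
  \<open>p\<close>, so it serves as a unary index counted from the end.\<close>

definition from_on :: "'a \<Rightarrow> 'a list \<Rightarrow> 'a list" where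
  "from_on p xs = foldl (\<lambda>a q. if \<not> a = [] \<or> q = p then q # a else a) [] xs"

definition fresh :: "nat list \<Rightarrow> (nat \<times> nat) list \<Rightarrow> nat \<times> nat \<Rightarrow> nat" where
  "fresh vs F p = ones_after (ones_after 0 (concat (map (\<lambda>v. bits v) vs))) (from_on p F)"

type_synonym inst = "nat list \<times> (nat \<times> nat) list \<times> nat list \<times> bool \<times> nat"

text \<open>Old edges are kept inside the clique only; the others are regenerated from the
  hyperedges, since thinning may have removed incidences. Vertices that are neither in the clique
  nor terminals disappear.\<close>

definition assemble :: "nat list \<Rightarrow> (nat \<times> nat) list \<Rightarrow> nat list \<Rightarrow> (nat \<times> nat list) list \<Rightarrow>
    (nat \<times> nat) list \<Rightarrow> unit list \<Rightarrow> inst" where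
  "assemble vs es K hs F k =
     (let H = hs @ map (\<lambda>q. (fresh vs F q, [fst q, snd q])) F
      in (K @ map (\<lambda>p. fst p) H,
          filter (\<lambda>p. fst p \<in> set K \<and> snd p \<in> set K) es @
            concat (map (\<lambda>p. map (\<lambda>u. (fst p, u)) (snd p)) H),
          map (\<lambda>p. fst p) H, False, binary k))"

definition yes_output :: inst where "yes_output = ([], [], [], False, 0)"
text \<open>The budget is -1 (sign flag and magnitude), which no set can meet and which is below
  every budget that reaches this point.\<close>

definition no_output :: inst where "no_output = ([], [], [], True, 1)"

definition reduce_hyper :: "nat list \<Rightarrow> (nat \<times> nat) list \<Rightarrow> nat list \<Rightarrow> (nat \<times> nat list) list \<Rightarrow> unit list \<Rightarrow> inst" where
  "reduce_hyper vs es K hs k =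
     (let X = fst (pack hs); P = snd (pack hs);
          c = crown (expansion_edges K hs X P) (copies (X @ P));
          Y = filter (\<lambda>y. (False, y) \<in> set (snd c)) (X @ P);
          K1 = filter (\<lambda>u. \<not> u \<in> set (fst c) \<and> \<not> u \<in> set Y) K;
          hs1 = map (\<lambda>p. (fst p, filter (\<lambda>u. u \<in> set K1) (snd p))) (filter (\<lambda>p. \<not> fst p \<in> set Y) hs);
          r = thin K1 hs1
      in if length P \<le> length k \<and> length Y \<le> length k
         then assemble vs es K1 (filter (\<lambda>p. \<not> snd p = []) (fst r)) (snd r) (drop (length Y) k)
         else no_output)"

definition reduce :: "nat list \<Rightarrow> (nat \<times> nat) list \<Rightarrow> nat list \<Rightarrow> unit list \<Rightarrow> inst" where
  "reduce vs es ts k =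
     (let K = find_clique es vs; KT = filter (\<lambda>v. v \<in> set ts) K
      in if small_check vs es ts K k then yes_output
         else if length KT \<le> length k
         then reduce_hyper vs es (filter (\<lambda>v. \<not> v \<in> set ts) K) (hyperedges es ts K) (drop (length KT) k)
         else no_output)"

text \<open>A negative budget is returned unchanged, because the output budget must not exceed it.
  Otherwise the cap at the number of vertices makes unary arithmetic affordable.\<close>

definition kernelize :: "inst \<Rightarrow> inst" where
  "kernelize x = (if fst (snd (snd (snd x))) then ([], [], [], True, snd (snd (snd (snd x))))
     else reduce (fst x) (fst (snd x)) (fst (snd (snd x))) (unary (fst x) (snd (snd (snd (snd x))))))"

section \<open>Polynomial time of the reductions\<close>

lemma ptime_adj [ptime_intros]:
  "ptime es \<Longrightarrow> ptime u \<Longrightarrow> ptime v \<Longrightarrow> ptime (\<lambda>e. adj (es e) (u e) (v e))"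
  by (rule ptime_comp3[rotated]) (simp_all only: adj_def, intro ptime_intros)

lemma ptime_split_by [ptime_intros]:
  "ptime es \<Longrightarrow> ptime W \<Longrightarrow> ptime K \<Longrightarrow> ptime (\<lambda>e. split_by (es e) (W e) (K e))"
  by (rule ptime_comp3[rotated]) (simp_all only: split_by_def, intro ptime_intros)

lemma ptime_extend [ptime_intros]:
  "ptime es \<Longrightarrow> ptime s \<Longrightarrow> ptime v \<Longrightarrow> ptime (\<lambda>e. extend_clique (es e) (s e) (v e))"
  by (rule ptime_comp3[rotated]) (simp_all only: extend_clique_def adjust_def, intro ptime_intros)

lemma size_enc_rev: "size_enc (rev xs) = size_enc xs"
proof (induction xs)
  case (Cons x xs)
  then show ?case using size_enc_append[of "rev xs" "[x]"] by (simp add: enc_simps)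
qed simp

lemma size_enc_take: "size_enc (take i xs) \<le> size_enc xs"
proof (induction xs arbitrary: i)
  case (Cons x xs)
  then show ?case by (cases i) (auto simp: enc_simps)
qed simp

lemma extend_foldl_fst: "fst (foldl (\<lambda>s v. extend_clique es s v) s vs) = rev vs @ fst s"
  by (induction vs arbitrary: s) (auto simp: extend_clique_def)

lemma extend_snd_cases:
  "snd (extend_clique es s v) = [] \<or> (\<exists>a b c. snd (extend_clique es s v) = adjust (fst s) (snd s) v a b c)"
proof (cases "filter (\<lambda>K. split_by es (v # fst s) K) (corrections (fst s) (snd s) v)")
  case (Cons K Ks)
  then have "K \<in> set (corrections (fst s) (snd s) v)"
    by (metis (no_types, lifting) filter_eq_ConsD in_set_conv_decomp)
  then have "\<exists>a b c. K = adjust (fst s) (snd s) v a b c"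
    by (simp only: set_concat set_map image_image UN_iff) (auto simp only: set_concat set_map image_image UN_iff)
  moreover have "snd (extend_clique es s v) = K" unfolding extend_clique_def Cons by simp
  ultimately show ?thesis by simp
qed (simp add: extend_clique_def)

text \<open>Each round computes the clique anew, so the additive criterion does not apply; but the
  result is always a sublist of the vertices seen so far.\<close>

lemma size_enc_extend_snd: "size_enc (snd (extend_clique es s v)) \<le> size_enc (v # fst s)"
  using extend_snd_cases[of es s v] size_enc_filter_le[of _ "v # fst s"]
  unfolding adjust_def by (elim disjE exE) (simp add: enc_simps, simp only:)

lemma ptime_find_clique [ptime_intros]:
  assumes "ptime es" "ptime vs" shows "ptime (\<lambda>e. find_clique (es e) (vs e))"
proof (rule ptime_comp2[of find_clique, OF _ assms])
  have "size_enc (snd (foldl (\<lambda>s v. extend_clique es s v) ([], []) vs)) \<le> size_enc vs" for es vs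
  proof (cases vs rule: rev_cases)
    case (snoc ws w)
    have "size_enc (w # rev ws) = size_enc vs"
      using size_enc_rev[of "ws @ [w]"] snoc by simp
    then show ?thesis using size_enc_extend_snd[of es "foldl (\<lambda>s v. extend_clique es s v) ([], []) ws" w] snoc
      by (simp add: extend_foldl_fst)
  qed (simp add: enc_simps)
  moreover have "size_enc (fst (foldl (\<lambda>s v. extend_clique es s v) ([], []) vs)) \<le> size_enc vs" for es vs
    by (simp add: extend_foldl_fst size_enc_rev)
  moreover have size_pair: "size_enc p \<le> 1 + a + b" if "size_enc (fst p) \<le> a" "size_enc (snd p) \<le> b"
    for p :: "nat list \<times> nat list" and a b
    using that by (cases p) (simp add: enc_simps)
  ultimately have b: "size_enc (foldl (\<lambda>s v. extend_clique es s v) ([], []) (take i vs)) \<le> 1 + size_enc vs + size_enc vs" for es vs i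
    using size_enc_take[of i vs] size_pair by (meson add_le_mono le_trans le_refl)
  have "ptime (\<lambda>w. foldl (\<lambda>s v. extend_clique (fst w) s v) ([], []) (snd w))"
  proof (rule ptime_foldl[where b = "[:1, 2:]"])
    show "size_enc (foldl (\<lambda>s v. extend_clique (fst e) s v) ([], []) (take i (snd e))) \<le> poly [:1, 2:] (size_enc e)"
      for e :: "(nat \<times> nat) list \<times> nat list" and i
      using b[of "fst e" i "snd e"] by (cases e) (simp add: enc_simps)
  qed (intro ptime_intros)+
  then show "ptime (\<lambda>w. find_clique (fst w) (snd w))"
    unfolding find_clique_def by (intro ptime_intros)
qed

lemma ptime_hyperedges [ptime_intros]:
  "ptime es \<Longrightarrow> ptime ts \<Longrightarrow> ptime K \<Longrightarrow> ptime (\<lambda>e. hyperedges (es e) (ts e) (K e))"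
  by (rule ptime_comp3[rotated]) (simp_all only: hyperedges_def, intro ptime_intros)

lemma size_enc_pack_step: "size_enc (pack_step s p) \<le> size_enc s + 2 * size_enc p"
proof (cases "filter (\<lambda>u. \<not> u \<in> set (fst s)) (snd p)")
  case (Cons u r)
  note f = Cons
  show ?thesis
  proof (cases r)
    case (Cons w r')
    have "size_enc (u # w # r') \<le> size_enc (snd p)"
      using size_enc_filter_le[of "\<lambda>u. \<not> u \<in> set (fst s)" "snd p"] f Cons by simp
    then show ?thesis using f Cons by (cases s; cases p) (simp add: pack_step_def enc_simps)
  qed (simp add: pack_step_def f)
qed (simp add: pack_step_def)

lemma ptime_pack [ptime_intros]:
  assumes "ptime hs" shows "ptime (\<lambda>e. pack (hs e))"
  unfolding pack_def
proof (rule ptime_foldl_additive[where q = "[:0, 2:]"])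
  show "ptime (\<lambda>w :: 'a \<times> (nat list \<times> nat list) \<times> nat \<times> nat list. pack_step (fst (snd w)) (snd (snd w)))"
    unfolding pack_step_def by (intro ptime_intros)
  show "size_enc (pack_step s p) \<le> size_enc s + poly [:0, 2:] (size_enc (e, p))" for e :: 'a and s p
    using size_enc_pack_step[of s p] by (simp add: enc_simps)
qed (intro ptime_intros assms)+

lemma ptime_copies [ptime_intros]: "ptime Y \<Longrightarrow> ptime (\<lambda>e. copies (Y e))"
  unfolding copies_def by (intro ptime_intros)

lemma size_enc_map_le:
  assumes "\<And>x. x \<in> set xs \<Longrightarrow> size_enc (f x) \<le> size_enc x"
  shows "size_enc (map f xs) \<le> size_enc xs"
  using assms by (induction xs) (auto simp: enc_simps add_mono)

text \<open>Hyperedges only shrink, and at most \<open>length K\<close> pairs are added.\<close>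

lemma size_enc_thin_step:
  "size_enc (thin_step K s v) \<le> size_enc s + poly [:2, 4, 4:] (size_enc (K, v))"
proof -
  define c where "c = crown (map (\<lambda>p. (fst p, filter (\<lambda>u. \<not> u = v) (snd p))) (filter (\<lambda>p. v \<in> set (snd p)) (fst s)))
        (filter (\<lambda>u. \<not> u = v) K)"
  let ?S = "size_enc (K, v)"
  have A: "set (snd c) \<subseteq> set K" "length (snd c) \<le> length K"
    unfolding c_def crown_def Let_def
    by (auto intro: le_trans[OF length_filter_le])
  have "size_enc (map (\<lambda>a. (v, a)) (snd c)) \<le> 1 + length (snd c) * ((1 + ?S + ?S) + 1)"
  proof (rule size_enc_le_sum[THEN le_trans])
    show "size_enc x \<le> 1 + ?S + ?S" if x: "x \<in> set (map (\<lambda>a. (v, a)) (snd c))" for x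
    proof -
      obtain a where a: "x = (v, a)" "a \<in> set K" using x A(1) by auto
      then show ?thesis using size_enc_mem[OF a(2)] by (simp add: enc_simps)
    qed
  qed simp
  also have "\<dots> \<le> 1 + ?S * ((1 + ?S + ?S) + 1)"
  proof -
    have "length (snd c) \<le> ?S" using A(2) length_le_size_enc[of K] by (simp add: enc_simps)
    then show ?thesis by (intro add_left_mono mult_right_mono) simp_all
  qed
  finally have 1: "size_enc (map (\<lambda>a. (v, a)) (snd c)) \<le> 1 + ?S * (2 + ?S + ?S)" by simp
  have 2: "size_enc (map (\<lambda>p. (fst p, if fst p \<in> set (fst c) then filter (\<lambda>u. \<not> u = v) (snd p) else snd p)) (fst s))
      \<le> size_enc (fst s)"
    by (rule size_enc_map_le) (auto simp: enc_simps size_enc_filter_le)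
  have "thin_step K s v = (map (\<lambda>p. (fst p, if fst p \<in> set (fst c) then filter (\<lambda>u. \<not> u = v) (snd p) else snd p)) (fst s),
          map (\<lambda>a. (v, a)) (snd c) @ snd s)" unfolding thin_step_def c_def Let_def ..
  then have "size_enc (thin_step K s v) \<le> size_enc s + 1 + ?S * (2 + ?S + ?S)"
    using 1 2 size_enc_append[of "map (\<lambda>a. (v, a)) (snd c)" "snd s"]
    by (cases s) (simp add: size_enc_simps)
  then show ?thesis by (simp add: algebra_simps)
qed

lemma ptime_thin [ptime_intros]:
  assumes "ptime K" "ptime hs" shows "ptime (\<lambda>e. thin (K e) (hs e))"
proof (rule ptime_comp2[of thin, OF _ assms])
  show "ptime (\<lambda>w. thin (fst w) (snd w))"
    unfolding thin_def
  proof (rule ptime_foldl_additive[where q = "[:2, 4, 4:]"])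
    show "ptime (\<lambda>w :: (nat list \<times> (nat \<times> nat list) list) \<times> ((nat \<times> nat list) list \<times> (nat \<times> nat) list) \<times> nat.
        thin_step (fst (fst w)) (fst (snd w)) (snd (snd w)))"
      unfolding thin_step_def by (intro ptime_intros)
    show "size_enc (thin_step (fst e) s v) \<le> size_enc s + poly [:2, 4, 4:] (size_enc (e, v))"
      for e :: "nat list \<times> (nat \<times> nat list) list" and s v
    proof -
      have "size_enc (fst e, v) \<le> size_enc (e, v)" by (cases e) (simp add: enc_simps)
      then show ?thesis using size_enc_thin_step[of "fst e" s v] poly_nat_mono
        by (meson add_left_mono le_trans)
    qed
  qed (intro ptime_intros)+
qed

lemma ptime_from_on [ptime_intros]:
  assumes "ptime p" "ptime xs" shows "ptime (\<lambda>e. from_on (p e) (xs e))"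
proof (rule ptime_comp2[of from_on, OF _ assms])
  show "ptime (\<lambda>w :: 'b \<times> 'b list. from_on (fst w) (snd w))"
    unfolding from_on_def
    by (intro ptime_foldl_additive[where q = "[:0, 1:]"] ptime_intros) (auto simp: enc_simps)
qed

lemma ptime_fresh [ptime_intros]:
  "ptime vs \<Longrightarrow> ptime F \<Longrightarrow> ptime p \<Longrightarrow> ptime (\<lambda>e. fresh (vs e) (F e) (p e))"
  by (rule ptime_comp3[rotated]) (simp_all only: fresh_def, intro ptime_intros)

lemma ptime_kernelize: "ptime kernelize"
  unfolding kernelize_def[abs_def] reduce_def reduce_hyper_def small_check_def expansion_edges_def assemble_def
  by (intro ptime_intros)

section \<open>Correctness of the kernelization\<close>

text \<open>Specified only for keys of \<open>hs\<close>; \<open>hyes_cong\<close> compares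
  neighbourhoods on the terminals alone.\<close>

definition nbrs :: "('t \<times> 'v list) list \<Rightarrow> 't \<Rightarrow> 'v set" where
  "nbrs hs t = set (the (map_of hs t))"

abbreviation hyper_yes :: "nat list \<Rightarrow> (nat \<times> nat list) list \<Rightarrow> (nat \<times> nat) set \<Rightarrow> nat \<Rightarrow> bool" where
  "hyper_yes K hs \<equiv> hyes (set K) (fst ` set hs) (nbrs hs)"

definition wf_hyper :: "nat list \<Rightarrow> (nat \<times> nat list) list \<Rightarrow> bool" where
  "wf_hyper K hs \<longleftrightarrow> distinct K \<and> distinct (map fst hs) \<and>
     (\<forall>p\<in>set hs. distinct (snd p) \<and> set (snd p) \<subseteq> set K \<and> fst p \<notin> set K)"

lemma wf_hyperD:
  assumes "wf_hyper K hs"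
  shows "distinct K" "distinct (map fst hs)"
    "\<And>p. p \<in> set hs \<Longrightarrow> distinct (snd p)" "\<And>p. p \<in> set hs \<Longrightarrow> set (snd p) \<subseteq> set K"
    "\<And>p. p \<in> set hs \<Longrightarrow> fst p \<notin> set K"
  using assms unfolding wf_hyper_def by auto

lemma nbrs_mem:
  assumes "distinct (map fst hs)" "p \<in> set hs"
  shows "nbrs hs (fst p) = set (snd p)"
proof -
  have "map_of hs (fst p) = Some (snd p)" by (rule map_of_is_SomeI) (use assms in simp_all)
  then show ?thesis by (simp add: nbrs_def)
qed

lemma nbrs_subset:
  assumes "wf_hyper K hs" "t \<in> fst ` set hs"
  shows "nbrs hs t \<subseteq> set K"
proof -
  obtain p where p: "p \<in> set hs" "t = fst p" using assms(2) by blast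
  show ?thesis using nbrs_mem[OF wf_hyperD(2)[OF assms(1)] p(1)] wf_hyperD(4)[OF assms(1) p(1)] p(2) by simp
qed

lemma hyes_cong:
  assumes "K = K'" "J = J'" "\<And>t. t \<in> J' \<Longrightarrow> N t = N' t" "F = F'"
  shows "hyes K J N F k \<longleftrightarrow> hyes K' J' N' F' k"
proof -
  have "heavy J' N D = heavy J' N' D" for D unfolding heavy_def using assms(3) by auto
  then show ?thesis unfolding hyes_def assms(1,2,4) by simp
qed

lemma pack_invariant:
  assumes "distinct (map fst xs)" "\<forall>p\<in>set xs. distinct (snd p) \<and> N (fst p) = set (snd p)"
    and "foldl (\<lambda>s p. pack_step s p) ([], []) xs = (X, P)"
  shows "distinct X \<and> distinct P \<and> set P \<subseteq> fst ` set xs \<and> set X \<subseteq> (\<Union>p\<in>set xs. set (snd p)) \<and>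
    length X = 2 * length P \<and> (\<forall>p\<in>set xs. fst p \<notin> set P \<longrightarrow> card (set (snd p) - set X) \<le> 1) \<and>
    (\<forall>D. finite D \<longrightarrow> card (set P) \<le> card (D \<inter> set X) + card (heavy (set P) N D))"
  using assms
proof (induction xs arbitrary: X P rule: rev_induct)
  case Nil
  then show ?case by simp
next
  case (snoc p xs)
  obtain X0 P0 where XP0: "foldl (\<lambda>s p. pack_step s p) ([], []) xs = (X0, P0)" by fastforce
  have IH: "distinct X0" "distinct P0" "set P0 \<subseteq> fst ` set xs" "set X0 \<subseteq> (\<Union>p\<in>set xs. set (snd p))"
    "length X0 = 2 * length P0" "\<forall>p\<in>set xs. fst p \<notin> set P0 \<longrightarrow> card (set (snd p) - set X0) \<le> 1"
    "\<forall>D. finite D \<longrightarrow> card (set P0) \<le> card (D \<inter> set X0) + card (heavy (set P0) N D)"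
    using snoc.IH[OF _ _ XP0] snoc.prems(1,2) by simp_all
  have step: "pack_step (X0, P0) p = (X, P)" using snoc.prems(3) XP0 by simp
  have p: "distinct (snd p)" "N (fst p) = set (snd p)" using snoc.prems(2) by auto
  have pP0: "fst p \<notin> set P0" using IH(3) snoc.prems(1) by auto
  let ?f = "filter (\<lambda>u. \<not> u \<in> set X0) (snd p)"
  show ?case
  proof (cases "\<exists>u w r. ?f = u # w # r")
    case False
    then have f: "?f = [] \<or> (\<exists>u. ?f = [u])" by (metis list.exhaust)
    then have eq: "X = X0" "P = P0" using step unfolding pack_step_def by auto
    have "set (snd p) - set X0 = set ?f" by auto
    then have "card (set (snd p) - set X0) \<le> length ?f" by (simp only: card_length)
    moreover have "length fs \<le> 1" if "fs = [] \<or> (\<exists>u. fs = [u])" for fs :: "nat list" using that by auto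
    ultimately have "card (set (snd p) - set X0) \<le> 1" using f le_trans by blast
    then show ?thesis using IH unfolding eq by auto
  next
    case True
    then obtain u w r where f: "?f = u # w # r" by blast
    then have eq: "X = u # w # X0" "P = fst p # P0" using step unfolding pack_step_def by auto
    have "distinct ?f" using p(1) by (rule distinct_filter)
    then have uw: "u \<noteq> w" unfolding f by simp
    have "u \<in> set ?f" "w \<in> set ?f" unfolding f by simp_all
    then have in_p: "u \<in> set (snd p)" "w \<in> set (snd p)" "u \<notin> set X0" "w \<notin> set X0" by simp_all
    have "card (set (snd q) - set X) \<le> 1" if "q \<in> set xs" "fst q \<notin> set P0" for q
    \<comment> \<open>A terminal rejected earlier stays rejected, since the set of used vertices
      only grows.\<close>
    proof -
      have "card (set (snd q) - set X) \<le> card (set (snd q) - set X0)" unfolding eq by (intro card_mono) auto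
      then show ?thesis using IH(6) that by fastforce
    qed
    moreover have "card (set P) \<le> card (D \<inter> set X) + card (heavy (set P) N D)" if D: "finite D" for D
    proof -
      have IHD: "card (set P0) \<le> card (D \<inter> set X0) + card (heavy (set P0) N D)" using IH(7) D by blast
      have sub: "heavy (set P0) N D \<subseteq> heavy (set P) N D" unfolding eq heavy_def by auto
      have finh: "finite (heavy (set P) N D)" by simp
      have cP: "card (set P) = Suc (card (set P0))" unfolding eq using pP0 by simp
      show ?thesis
      proof (cases "fst p \<in> heavy (set P) N D")
        case True
        have "fst p \<notin> heavy (set P0) N D" using pP0 heavy_subset[of "set P0" N D] by blast
        then have "Suc (card (heavy (set P0) N D)) = card (insert (fst p) (heavy (set P0) N D))" by simp
        also have "\<dots> \<le> card (heavy (set P) N D)" using True sub finh by (intro card_mono) auto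
        finally have "Suc (card (heavy (set P0) N D)) \<le> card (heavy (set P) N D)" .
        moreover have "card (D \<inter> set X0) \<le> card (D \<inter> set X)" unfolding eq using D by (intro card_mono) auto
        ultimately show ?thesis using IHD cP by linarith
      next
        case False
        have "u \<in> D \<or> w \<in> D"
        proof (rule ccontr)
          assume "\<not> (u \<in> D \<or> w \<in> D)"
          then have "fst p \<in> heavy (set P) N D"
            using in_p uw by (intro heavyI[of _ _ _ u _ w]) (auto simp: p(2) eq)
          then show False using False by blast
        qed
        then obtain z where z: "z \<in> D" "z = u \<or> z = w" by blast
        have "Suc (card (D \<inter> set X0)) = card (insert z (D \<inter> set X0))" using z in_p D by auto
        also have "\<dots> \<le> card (D \<inter> set X)" unfolding eq using z D by (intro card_mono) auto
        finally have "Suc (card (D \<inter> set X0)) \<le> card (D \<inter> set X)" .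
        moreover have "card (heavy (set P0) N D) \<le> card (heavy (set P) N D)" using sub finh by (rule card_mono[rotated])
        ultimately show ?thesis using IHD cP by linarith
      qed
    qed
    moreover have "distinct X" "distinct P" unfolding eq using IH(1,2) uw in_p pP0 by simp_all
    moreover have "set P \<subseteq> fst ` set (xs @ [p])" unfolding eq using IH(3) by auto
    moreover have "set X \<subseteq> (\<Union>p\<in>set (xs @ [p]). set (snd p))" unfolding eq using IH(4) in_p by auto
    moreover have "length X = 2 * length P" unfolding eq using IH(5) by simp
    ultimately show ?thesis unfolding eq by auto
  qed
qed

lemma pack_correct:
  assumes wf: "wf_hyper K hs" and XP: "pack hs = (X, P)"
  shows "distinct X" "distinct P" "set P \<subseteq> fst ` set hs" "set X \<subseteq> set K" "length X = 2 * length P"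
    "\<And>t. t \<in> fst ` set hs - set P \<Longrightarrow> card (nbrs hs t - set X) \<le> 1"
    "hyper_yes K hs {} k \<Longrightarrow> length P \<le> k"
proof -
  note D = wf_hyperD[OF wf]
  have "\<forall>p\<in>set hs. distinct (snd p) \<and> nbrs hs (fst p) = set (snd p)"
    using D(3) nbrs_mem[OF D(2)] by blast
  note inv = pack_invariant[OF D(2) this XP[unfolded pack_def]]
  show d: "distinct X" "distinct P" "set P \<subseteq> fst ` set hs" "length X = 2 * length P" using inv by simp_all
  have "set X \<subseteq> (\<Union>p\<in>set hs. set (snd p))" using inv by simp
  then show "set X \<subseteq> set K" using D(4) by blast
  show "card (nbrs hs t - set X) \<le> 1" if t: "t \<in> fst ` set hs - set P" for t
  proof -
    obtain p where p: "p \<in> set hs" "t = fst p" using t by blast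
    then show ?thesis using inv t nbrs_mem[OF D(2) p(1)] by simp
  qed
  assume "hyper_yes K hs {} k"
  then obtain E where E: "E \<subseteq> set K" "card E + card (heavy (fst ` set hs) (nbrs hs) E) \<le> k"
    unfolding hyes_def by blast
  have finE: "finite E" using E(1) by (rule finite_subset) simp
  have "card (set P) \<le> card (E \<inter> set X) + card (heavy (set P) (nbrs hs) E)" using inv finE by blast
  moreover have "card (E \<inter> set X) \<le> card E" using finE by (intro card_mono) auto
  moreover have "card (heavy (set P) (nbrs hs) E) \<le> card (heavy (fst ` set hs) (nbrs hs) E)"
    using d(3) by (intro card_mono) (auto simp: heavy_def)
  ultimately show "length P \<le> k" using E(2) distinct_card[OF d(2)] by linarith
qed

text \<open>Both kinds of adjacency in the expansion graph come from a terminal, so closedness of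
  the crown gives the two closure conditions of \<open>hyes_crown_delete\<close>, and the matching
  supplies its private vertices.\<close>

lemma expansion_correct:
  assumes wf: "wf_hyper K hs" and XP: "pack hs = (X, P)"
    and c: "crown (expansion_edges K hs X P) (copies (X @ P)) = (L, R)"
    and Y: "Y = filter (\<lambda>y. (False, y) \<in> set R) (X @ P)"
    and K1: "K1 = filter (\<lambda>u. \<not> u \<in> set L \<and> \<not> u \<in> set Y) K"
    and hs1: "hs1 = map (\<lambda>p. (fst p, filter (\<lambda>u. u \<in> set K1) (snd p))) (filter (\<lambda>p. \<not> fst p \<in> set Y) hs)"
  shows "wf_hyper K1 hs1" "length K1 \<le> 8 * length P" "fst ` set hs1 \<subseteq> fst ` set hs" "set K1 \<subseteq> set K"
    "hyper_yes K hs {} k \<longleftrightarrow> length Y \<le> k \<and>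
       hyper_yes K1 hs1 {} (k - length Y)"
proof -
  note D = wf_hyperD[OF wf]
  note pk = pack_correct[OF wf XP]
  let ?ls = "expansion_edges K hs X P"
  let ?J = "fst ` set hs" and ?N = "nbrs hs"
  have KJ: "set K \<inter> ?J = {}" using D(5) by blast
  have dXP: "distinct (X @ P)" using pk(1-4) KJ by auto
  define E where "E u y \<longleftrightarrow> (\<exists>p\<in>set hs. u \<in> set (snd p) \<and> (if fst p \<in> set P then y = fst p else y \<in> set (snd p)))" for u y
  have ls: "?ls = map (\<lambda>u. (u, concat (map (\<lambda>y. if E u y then [(False, y), (True, y)] else []) (X @ P))))
      (filter (\<lambda>u. \<not> u \<in> set X) K)"
    unfolding expansion_edges_def E_def ..
  have fst_ls: "map fst ?ls = filter (\<lambda>u. \<not> u \<in> set X) K"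
    unfolding ls by (simp add: comp_def)
  have ns_mem: "(b, y) \<in> set ns \<longleftrightarrow> y \<in> set (X @ P) \<and> E u y"
    if "(u, ns) \<in> set ?ls" for u ns b y
  proof -
    have "ns = concat (map (\<lambda>y. if E u y then [(False, y), (True, y)] else []) (X @ P))"
      using that unfolding ls by auto
    then show ?thesis by (cases b) (auto split: if_splits)
  qed
  have copies_mem: "(b, y) \<in> set (copies (X @ P)) \<longleftrightarrow> y \<in> set (X @ P)" for b y
    unfolding copies_def by (cases b) auto
  have 1: "distinct (map fst ?ls)" unfolding fst_ls using D(1) by simp
  have 2: "\<forall>(l, ns)\<in>set ?ls. set ns \<subseteq> set (copies (X @ P))"
    using ns_mem copies_mem by auto
  have 3: "distinct (copies (X @ P))"
    unfolding copies_def using dXP by (auto simp: distinct_map inj_on_def)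
  note cr = crown_correct[OF 1 2 3 c]
  have fls: "fst ` set ?ls = set K - set X"
    using arg_cong[OF fst_ls, of set] by auto
  have LK: "set L \<subseteq> set K - set X" using cr(1) fls by simp
  have ex_ns: "\<exists>ns. (u, ns) \<in> set ?ls" if "u \<in> set L" for u
    using cr(1) that by force
  have LE: "(b, y) \<in> set R" if "u \<in> set L" "y \<in> set (X @ P)" "E u y" for u y b
  proof -
    obtain ns where ns: "(u, ns) \<in> set ?ls" using ex_ns[OF \<open>u \<in> set L\<close>] by blast
    then have "(b, y) \<in> set ns" using ns_mem that by blast
    then show ?thesis using cr(3)[OF ns that(1)] by blast
  qed
  obtain f where f: "inj_on f (set R)"
    "\<forall>r\<in>set R. f r \<in> set L \<and> (\<exists>ns. (f r, ns) \<in> set ?ls \<and> r \<in> set ns)"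
    using cr(4) by blast
  have fE: "f (b, y) \<in> set L \<and> E (f (b, y)) y \<and> y \<in> set (X @ P)" if "(b, y) \<in> set R" for b y
    using f(2) that ns_mem by blast
  have Yset: "y \<in> set Y \<longleftrightarrow> y \<in> set (X @ P) \<and> (False, y) \<in> set R" for y unfolding Y by auto
  \<comment> \<open>The two copies of \<open>y\<close> have the same left neighbours, so a crown
    containing one of them contains both; testing \<open>False\<close> in \<open>Y\<close> is
    enough.\<close>
  have YR: "(b, y) \<in> set R" if "y \<in> set Y" for b y
    using that fE[of False y] LE[of "f (False, y)" y b] Yset by blast
  have Edest: "\<exists>t\<in>?J. u \<in> ?N t \<and> (if t \<in> set P then y = t else y \<in> ?N t)" if e: "E u y" for u y
  proof -
    obtain p where p: "p \<in> set hs" "u \<in> set (snd p)" "if fst p \<in> set P then y = fst p else y \<in> set (snd p)"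
      using e unfolding E_def by blast
    show ?thesis by (rule bexI[of _ "fst p"]) (use p nbrs_mem[OF D(2) p(1)] in simp_all)
  qed
  have Eintro: "E u y" if t: "t \<in> ?J" "u \<in> ?N t" "if t \<in> set P then y = t else y \<in> ?N t" for u y t
  proof -
    obtain p where p: "p \<in> set hs" "t = fst p" using t by blast
    show ?thesis unfolding E_def by (rule bexI[OF _ p(1)]) (use that(2,3) nbrs_mem[OF D(2) p(1)] p(2) in \<open>auto split: if_splits\<close>)
  qed
  have NK: "?N t \<subseteq> set K" if "t \<in> ?J" for t using nbrs_subset[OF wf that] .
  have dY: "distinct Y" unfolding Y using dXP by (rule distinct_filter)
  have cY: "card (set Y) = length Y" using dY by (rule distinct_card)
  have main: "hyes (set K) ?J ?N {} k \<longleftrightarrow> card (set Y) \<le> k \<and>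
      hyes (set K - set L - set Y) (?J - set Y) (\<lambda>t. ?N t \<inter> (set K - set L - set Y)) {} (k - card (set Y))"
  proof (rule hyes_crown_delete[of _ _ _ "set X" "set P" _ _ f])
    show "finite (set K)" "finite ?J" by simp_all
    show "set K \<inter> ?J = {}" by (rule KJ)
    show "set X \<subseteq> set K" "set P \<subseteq> ?J" using pk by simp_all
    show "set L \<subseteq> set K - set X" by (rule LK)
    show "set Y \<subseteq> set X \<union> set P" using Yset by auto
    show "inj_on f (UNIV \<times> set Y)" by (rule inj_on_subset[OF f(1)]) (use YR in auto)
    show "?N t \<subseteq> set K" if "t \<in> ?J" for t using NK[OF that] .
    show "card (?N t - set X) \<le> 1" if "t \<in> ?J - set P" for t using pk(6)[OF that] .
    show "?N t \<inter> set X \<subseteq> set Y" if "u \<in> set L" "t \<in> ?J - set P" "u \<in> ?N t" for u t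
      using that LE[of u _ False] Eintro[of t u] Yset by auto
    show "p \<in> set Y" if "u \<in> set L" "p \<in> set P" "u \<in> ?N p" for u p
      using that LE[of u p False] Eintro[of p u p] Yset pk(3) by auto
    show "f (b, y) \<in> set L" if "y \<in> set Y" for b y using fE[OF YR[OF that]] by blast
    show "\<exists>t\<in>?J - set P. y \<in> ?N t \<and> f (b, y) \<in> ?N t" if y: "y \<in> set Y \<inter> set X" for b y
    proof -
      have "E (f (b, y)) y" using fE[OF YR] y by blast
      then obtain t where t: "t \<in> ?J" "f (b, y) \<in> ?N t" "if t \<in> set P then y = t else y \<in> ?N t"
        using Edest by blast
      have "y \<in> set K" using y pk(4) by blast
      \<comment> \<open>A packed \<open>t\<close> would have to equal \<open>y\<close>, but
        \<open>y\<close> is in the clique.\<close>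
      then have "t \<notin> set P" using t KJ by (auto split: if_splits)
      then show ?thesis using t by auto
    qed
    show "f (b, y) \<in> ?N y" if y: "y \<in> set Y \<inter> set P" for b y
    proof -
      have "E (f (b, y)) y" using fE[OF YR] y by blast
      then obtain t where t: "t \<in> ?J" "f (b, y) \<in> ?N t" "if t \<in> set P then y = t else y \<in> ?N t"
        using Edest by blast
      have "y \<notin> set K" using y pk(3) KJ by blast
      then have "t = y" using t NK[OF t(1)] by (auto split: if_splits)
      then show ?thesis using t by simp
    qed
  qed
  have K1s: "set K1 = set K - set L - set Y" unfolding K1 by auto
  have hs1_mem: "p \<in> set hs1 \<longleftrightarrow> (\<exists>q\<in>set hs. fst q \<notin> set Y \<and> p = (fst q, filter (\<lambda>u. u \<in> set K1) (snd q)))" for p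
    unfolding hs1 by auto
  have fst_hs1: "map fst hs1 = filter (\<lambda>t. t \<notin> set Y) (map fst hs)"
    unfolding hs1 by (simp add: comp_def filter_map)
  have J1: "fst ` set hs1 = ?J - set Y" using arg_cong[OF fst_hs1, of set] by auto
  show wf1: "wf_hyper K1 hs1"
    unfolding wf_hyper_def
  proof (intro conjI ballI)
    show "distinct K1" unfolding K1 using D(1) by simp
    show "distinct (map fst hs1)" unfolding fst_hs1 using D(2) by simp
    fix p assume "p \<in> set hs1"
    then obtain q where q: "q \<in> set hs" "p = (fst q, filter (\<lambda>u. u \<in> set K1) (snd q))" using hs1_mem by blast
    show "distinct (snd p)" using q D(3) by simp
    show "set (snd p) \<subseteq> set K1" using q by auto
    show "fst p \<notin> set K1" using q D(5)[OF q(1)] K1s by auto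
  qed
  show "fst ` set hs1 \<subseteq> ?J" using J1 by blast
  show "set K1 \<subseteq> set K" using K1s by blast
  have N1: "nbrs hs1 t = ?N t \<inter> (set K - set L - set Y)" if t: "t \<in> fst ` set hs1" for t
  proof -
    obtain p where p: "p \<in> set hs1" "t = fst p" using t by blast
    obtain q where q: "q \<in> set hs" "p = (fst q, filter (\<lambda>u. u \<in> set K1) (snd q))" using p(1) hs1_mem by blast
    show ?thesis using nbrs_mem[OF wf_hyperD(2)[OF wf1] p(1)] nbrs_mem[OF D(2) q(1)] p(2) q(2) K1s by auto
  qed
  have "hyes (set K - set L - set Y) (?J - set Y) (\<lambda>t. ?N t \<inter> (set K - set L - set Y)) {} m \<longleftrightarrow>
      hyper_yes K1 hs1 {} m" for m
    by (rule hyes_cong) (use K1s J1 N1 in auto)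
  then show "hyes (set K) ?J ?N {} k \<longleftrightarrow> length Y \<le> k \<and> hyper_yes K1 hs1 {} (k - length Y)"
    using main unfolding cY by simp
  \<comment> \<open>What survives lies in \<open>X\<close>, of size \<open>2 * length P\<close>, or
    is an uncrowned left vertex. The crown bounds the latter by the number of copies, twice
    \<open>3 * length P\<close>.\<close>
  have "length K1 = card (set K1)" using distinct_card[OF wf_hyperD(1)[OF wf1]] by simp
  also have "\<dots> \<le> card (set X \<union> (set K - set X - set L))" unfolding K1s by (intro card_mono) auto
  also have "\<dots> \<le> card (set X) + card (set K - set X - set L)" by (rule card_Un_le)
  also have "card (set K - set X - set L) \<le> card (set (copies (X @ P)))"
    using cr(5) unfolding fls by (rule le_trans) (intro card_mono, auto)
  also have "card (set (copies (X @ P))) \<le> 2 * length (X @ P)"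
    using card_length[of "copies (X @ P)"] by (simp add: copies_def)
  also have "card (set X) \<le> length X" by (rule card_length)
  finally show "length K1 \<le> 8 * length P" using pk(5) by simp
qed

section \<open>Thinning to quadratically many incidences\<close>

definition deg :: "(nat \<times> nat list) list \<Rightarrow> nat \<Rightarrow> nat" where
  "deg hs v = length (filter (\<lambda>p. v \<in> set (snd p)) hs)"

lemma sum_deg:
  assumes "\<And>p. p \<in> set hs \<Longrightarrow> distinct (snd p) \<and> set (snd p) \<subseteq> A" "finite A"
  shows "(\<Sum>v\<in>A. deg hs v) = (\<Sum>p\<leftarrow>hs. length (snd p))"
  using assms(1)
proof (induction hs)
  case (Cons p hs)
  have "(\<Sum>v\<in>A. of_bool (v \<in> set (snd p)) :: nat) = card (A \<inter> set (snd p))"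
    using assms(2) by (simp add: of_bool_def sum.If_cases Int_def)
  also have "\<dots> = length (snd p)" using Cons.prems[of p] by (simp add: distinct_card Int_absorb1)
  finally have "(\<Sum>v\<in>A. of_bool (v \<in> set (snd p)) :: nat) = length (snd p)" .
  moreover have "deg (p # hs) v = of_bool (v \<in> set (snd p)) + deg hs v" for v by (simp add: deg_def)
  ultimately show ?case using Cons by (simp add: sum.distrib)
qed (simp add: deg_def)

text \<open>Terminals still at \<open>v\<close> are the left vertices outside the crown, at most
  \<open>length rs - length A\<close> many. So they and the new pairs together number at most
  \<open>length K\<close>, while no other vertex changes its degree.\<close>

lemma thin_step_correct:
  assumes wf: "wf_hyper K hs" and v: "v \<in> set K" and st: "thin_step K (hs, F) v = (hs', F')"
  shows "wf_hyper K hs'" "map fst hs' = map fst hs"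
    "hyper_yes K hs (set F) k \<longleftrightarrow> hyper_yes K hs' (set F') k"
    "\<exists>A. F' = map (\<lambda>a. (v, a)) A @ F \<and> distinct A \<and> set A \<subseteq> set K - {v} \<and> deg hs' v + length A \<le> length K"
    "\<And>w. w \<noteq> v \<Longrightarrow> deg hs' w = deg hs w"
proof -
  note D = wf_hyperD[OF wf]
  define ls where "ls = map (\<lambda>p. (fst p, filter (\<lambda>u. \<not> u = v) (snd p))) (filter (\<lambda>p. v \<in> set (snd p)) hs)"
  define rs where "rs = filter (\<lambda>u. \<not> u = v) K"
  obtain B A where c: "crown ls rs = (B, A)" by fastforce
  have hs': "hs' = map (\<lambda>p. (fst p, if fst p \<in> set B then filter (\<lambda>u. \<not> u = v) (snd p) else snd p)) hs"
    and F': "F' = map (\<lambda>a. (v, a)) A @ F"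
    using st c unfolding thin_step_def ls_def[symmetric] rs_def[symmetric] fst_conv Let_def by auto
  let ?J = "fst ` set hs" and ?N = "nbrs hs"
  have fst_ls: "map fst ls = map fst (filter (\<lambda>p. v \<in> set (snd p)) hs)" unfolding ls_def by (simp add: comp_def)
  have 1: "distinct (map fst ls)" unfolding fst_ls using D(2) by (rule distinct_map_filter)
  have ls_mem: "(t, ns) \<in> set ls \<longleftrightarrow> (\<exists>p\<in>set hs. v \<in> set (snd p) \<and> t = fst p \<and> ns = filter (\<lambda>u. \<not> u = v) (snd p))" for t ns
    unfolding ls_def by auto
  have ls_dest: "t \<in> ?J \<and> v \<in> ?N t \<and> set ns = ?N t - {v}" if tns: "(t, ns) \<in> set ls" for t ns
  proof -
    obtain p where p: "p \<in> set hs" "v \<in> set (snd p)" "t = fst p" "ns = filter (\<lambda>u. \<not> u = v) (snd p)"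
      using iffD1[OF ls_mem tns] by (elim bexE conjE)
    then show ?thesis using nbrs_mem[OF D(2) p(1)] by auto
  qed
  have 2: "\<forall>(l, ns)\<in>set ls. set ns \<subseteq> set rs"
    using ls_dest nbrs_subset[OF wf] unfolding rs_def by fastforce
  have 3: "distinct rs" unfolding rs_def using D(1) by simp
  note cr = crown_correct[OF 1 2 3 c]
  have AK: "set A \<subseteq> set K - {v}" using cr(2) unfolding rs_def by auto
  have BJ: "set B \<subseteq> ?J" using cr(1) ls_dest by fastforce
  have NB: "v \<in> ?N t \<and> ?N t - {v} \<subseteq> set A" if tB: "t \<in> set B" for t
  proof -
    obtain ns where ns: "(t, ns) \<in> set ls" using cr(1) tB by force
    show ?thesis using ls_dest[OF ns] cr(3)[OF ns tB] by simp
  qed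
  obtain f where f: "inj_on f (set A)" "\<forall>r\<in>set A. f r \<in> set B \<and> (\<exists>ns. (f r, ns) \<in> set ls \<and> r \<in> set ns)"
    using cr(4) by blast
  have f2: "f a \<in> set B \<and> a \<in> ?N (f a)" if "a \<in> set A" for a using f(2) that ls_dest by blast
  have eq: "hyes (set K) ?J ?N (set F) k \<longleftrightarrow>
      hyes (set K) ?J (\<lambda>t. if t \<in> set B then ?N t - {v} else ?N t) (set F \<union> {v} \<times> set A) k"
    by (rule hyes_crown_vertex[of _ _ _ _ _ _ f]) (use NB AK BJ f(1) f2 nbrs_subset[OF wf] in auto)
  show fst_eq: "map fst hs' = map fst hs" unfolding hs' by (simp add: comp_def)
  show wf': "wf_hyper K hs'"
    unfolding wf_hyper_def fst_eq
  proof (intro conjI ballI)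
    show "distinct K" "distinct (map fst hs)" by (rule D)+
    fix p assume "p \<in> set hs'"
    then obtain q where q: "q \<in> set hs"
      "p = (fst q, if fst q \<in> set B then filter (\<lambda>u. \<not> u = v) (snd q) else snd q)" unfolding hs' by auto
    show "distinct (snd p)" "set (snd p) \<subseteq> set K" "fst p \<notin> set K"
      using D(3)[OF q(1)] D(4)[OF q(1)] D(5)[OF q(1)] unfolding q(2) by auto
  qed
  have J': "fst ` set hs' = ?J" using arg_cong[OF fst_eq, of set] by simp
  have N': "nbrs hs' t = (if t \<in> set B then ?N t - {v} else ?N t)" if "t \<in> ?J" for t
  proof -
    obtain p where p: "p \<in> set hs" "t = fst p" using \<open>t \<in> ?J\<close> by blast
    let ?p = "(fst p, if fst p \<in> set B then filter (\<lambda>u. \<not> u = v) (snd p) else snd p)"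
    have "?p \<in> set hs'" unfolding hs' using p(1) by auto
    from nbrs_mem[OF wf_hyperD(2)[OF wf'] this] show ?thesis using nbrs_mem[OF D(2) p(1)] p(2) by auto
  qed
  have "hyes (set K) ?J (\<lambda>t. if t \<in> set B then ?N t - {v} else ?N t) (set F \<union> {v} \<times> set A) k \<longleftrightarrow>
      hyper_yes K hs' (set F') k"
    by (rule hyes_cong) (use J' N' F' in auto)
  then show "hyes (set K) ?J ?N (set F) k \<longleftrightarrow> hyper_yes K hs' (set F') k"
    using eq by simp
  show "deg hs' w = deg hs w" if "w \<noteq> v" for w
    unfolding deg_def hs' filter_map length_map comp_def
    by (rule arg_cong[of _ _ length], rule filter_cong) (use that in auto)
  have dA: "distinct A" using c 3 unfolding crown_def Let_def by auto
  have "deg hs' v = length (filter (\<lambda>p. v \<in> set (snd p) \<and> fst p \<notin> set B) hs)"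
    unfolding deg_def hs' filter_map length_map comp_def
    by (rule arg_cong[of _ _ length], rule filter_cong) auto
  also have "\<dots> = card (fst ` set (filter (\<lambda>p. v \<in> set (snd p) \<and> fst p \<notin> set B) hs))"
  proof -
    have "distinct (map fst (filter (\<lambda>p. v \<in> set (snd p) \<and> fst p \<notin> set B) hs))"
      using D(2) by (rule distinct_map_filter)
    from distinct_card[OF this] show ?thesis by simp
  qed
  also have "fst ` set (filter (\<lambda>p. v \<in> set (snd p) \<and> fst p \<notin> set B) hs) = fst ` set ls - set B"
    unfolding ls_def by force
  finally have "deg hs' v \<le> card (set rs - set A)" using cr(5) by simp
  moreover have "card (set rs - set A) = length rs - length A"
    using card_Diff_subset[of "set A" "set rs"] cr(2) distinct_card[OF 3] distinct_card[OF dA] by simp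
  moreover have "length A \<le> length rs"
    using card_mono[OF _ cr(2)] distinct_card[OF 3] distinct_card[OF dA] by simp
  moreover have "length rs \<le> length K" unfolding rs_def by (rule length_filter_le)
  ultimately have "deg hs' v + length A \<le> length K" by linarith
  then show "\<exists>A. F' = map (\<lambda>a. (v, a)) A @ F \<and> distinct A \<and> set A \<subseteq> set K - {v} \<and> deg hs' v + length A \<le> length K"
    using F' dA AK by blast
qed

text \<open>Since a step touches the degree of its own vertex only, the bound
  \<open>length K\<close> per processed vertex is never spoiled and adds up; double counting turns
  degrees into incidences.\<close>

lemma thin_correct:
  assumes wf: "wf_hyper K hs" and th: "thin K hs = (hs', F)"
  shows "wf_hyper K hs'" "fst ` set hs' = fst ` set hs"
    "\<And>k. hyper_yes K hs {} k \<longleftrightarrow> hyper_yes K hs' (set F) k"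
    "distinct F" "\<And>u v. (u, v) \<in> set F \<Longrightarrow> u \<in> set K \<and> v \<in> set K \<and> u \<noteq> v"
    "(\<Sum>p\<leftarrow>hs'. length (snd p)) + length F \<le> length K * length K"
proof -
  have "wf_hyper K hs1 \<and> map fst hs1 = map fst hs \<and>
      (\<forall>k. hyper_yes K hs {} k \<longleftrightarrow> hyper_yes K hs1 (set F1) k) \<and>
      distinct F1 \<and> (\<forall>u v. (u, v) \<in> set F1 \<longrightarrow> u \<in> set W \<and> v \<in> set K \<and> u \<noteq> v) \<and>
      (\<Sum>v\<in>set W. deg hs1 v) + length F1 \<le> length W * length K"
    if "set W \<subseteq> set K" "distinct W" "foldl (\<lambda>s v. thin_step K s v) (hs, []) W = (hs1, F1)" for W hs1 F1
    using that
  proof (induction W arbitrary: hs1 F1 rule: rev_induct)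
    case Nil
    then show ?case using wf by simp
  next
    case (snoc v W)
    obtain hs0 F0 where s0: "foldl (\<lambda>s v. thin_step K s v) (hs, []) W = (hs0, F0)" by fastforce
    have IH: "wf_hyper K hs0" "map fst hs0 = map fst hs"
      "\<forall>k. hyper_yes K hs {} k \<longleftrightarrow> hyper_yes K hs0 (set F0) k"
      "distinct F0" "\<forall>u v. (u, v) \<in> set F0 \<longrightarrow> u \<in> set W \<and> v \<in> set K \<and> u \<noteq> v"
      "(\<Sum>v\<in>set W. deg hs0 v) + length F0 \<le> length W * length K"
      using snoc.IH[OF _ _ s0] snoc.prems(1,2) by simp_all
    have st: "thin_step K (hs0, F0) v = (hs1, F1)" and vK: "v \<in> set K" and vW: "v \<notin> set W"
      using snoc.prems s0 by simp_all
    note S = thin_step_correct[OF IH(1) vK st]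
    obtain A where A: "F1 = map (\<lambda>a. (v, a)) A @ F0" "distinct A" "set A \<subseteq> set K - {v}"
      "deg hs1 v + length A \<le> length K" using S(4) by blast
    have "(\<Sum>w\<in>set W. deg hs1 w) = (\<Sum>w\<in>set W. deg hs0 w)"
      by (rule sum.cong[OF refl], rule S(5)) (use vW in auto)
    then have "(\<Sum>w\<in>set (W @ [v]). deg hs1 w) + length F1 \<le> length (W @ [v]) * length K"
      using IH(6) A(1,4) vW by simp
    \<comment> \<open>All pairs of this step start with \<open>v\<close>, and older ones start with
      vertices processed before.\<close>
    moreover have "distinct F1" unfolding A(1) using A(2) IH(4,5) vW by (auto simp: distinct_map inj_on_def)
    moreover have "\<forall>u w. (u, w) \<in> set F1 \<longrightarrow> u \<in> set (W @ [v]) \<and> w \<in> set K \<and> u \<noteq> w"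
      using A(1,3) IH(5) by auto
    ultimately show ?case using S(1,2,3) IH(2,3) by simp
  qed
  from this[of K hs' F] wf_hyperD(1)[OF wf] th
  have inv: "wf_hyper K hs'" "map fst hs' = map fst hs"
      "\<forall>k. hyper_yes K hs {} k \<longleftrightarrow> hyper_yes K hs' (set F) k"
      "distinct F" "\<forall>u v. (u, v) \<in> set F \<longrightarrow> u \<in> set K \<and> v \<in> set K \<and> u \<noteq> v"
      "(\<Sum>v\<in>set K. deg hs' v) + length F \<le> length K * length K"
    unfolding thin_def by simp_all
  show "wf_hyper K hs'" by (rule inv(1))
  show "fst ` set hs' = fst ` set hs" using arg_cong[OF inv(2), of set] by simp
  show "hyper_yes K hs {} k \<longleftrightarrow> hyper_yes K hs' (set F) k" for k
    using inv(3) by blast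
  show "distinct F" by (rule inv(4))
  show "u \<in> set K \<and> v \<in> set K \<and> u \<noteq> v" if "(u, v) \<in> set F" for u v using inv(5) that by blast
  have "(\<Sum>v\<in>set K. deg hs' v) = (\<Sum>p\<leftarrow>hs'. length (snd p))"
    by (rule sum_deg) (use wf_hyperD[OF inv(1)] in auto)
  then show "(\<Sum>p\<leftarrow>hs'. length (snd p)) + length F \<le> length K * length K" using inv(6) by simp
qed

section \<open>Finding a split partition\<close>

abbreviation edge_of :: "nat \<times> nat \<Rightarrow> nat set" where
  "edge_of \<equiv> \<lambda>(u, v). {u, v}"

lemma adj_iff_edge: "adj es u v \<longleftrightarrow> {u, v} \<in> set (map edge_of es)"
  unfolding adj_def by (force simp: doubleton_eq_iff)

lemma concat_mapI: "x \<in> set xs \<Longrightarrow> y \<in> set (f x) \<Longrightarrow> y \<in> set (concat (map f xs))"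
  by auto

text \<open>A clique and an independent set share at most one vertex. Hence the partition found for \<open>W\<close>
  and the restriction of a partition of \<open>G\<close> differ by at most one vertex on either side, and one of
  the polynomially many corrections tried by \<open>extend_clique\<close> succeeds.\<close>

lemma extend_split_by:
  assumes G: "split_partition G K I" "set (map edge_of es) = edges G" "set (v # W) \<subseteq> verts G" "v \<notin> set W"
    and K0: "split_by es W K0" "set K0 \<subseteq> set W" and ex: "extend_clique es (W, K0) v = (W', K')"
  shows "W' = v # W" "split_by es W' K'" "set K' \<subseteq> set W'"
proof -
  have VKI: "K \<union> I = verts G" "clique G K" "independent_set G I" using G(1) by (simp_all add: split_partition_def)
  have KK: "adj es x y" if "x \<in> K" "y \<in> K" "x \<noteq> y" for x y
    using VKI(2) that unfolding clique_def adj_iff_edge G(2) by blast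
  have II: "\<not> adj es x y" if "x \<in> set (v # W)" "y \<in> set (v # W)" "x \<notin> K" "y \<notin> K" for x y
  proof -
    have "x \<in> I" "y \<in> I" using that G(3) VKI(1) by blast+
    then show ?thesis using VKI(3) unfolding independent_set_def adj_iff_edge G(2) by blast
  qed
  have sb: "(x \<in> set K0 \<and> y \<in> set K0 \<longrightarrow> adj es x y) \<and> (x \<notin> set K0 \<and> y \<notin> set K0 \<longrightarrow> \<not> adj es x y)"
    if "x \<in> set W" "y \<in> set W" "x \<noteq> y" for x y
    using K0(1) that unfolding split_by_def by blast
  have rem: "x = y" if xy: "x \<in> set K0 - K" "y \<in> set K0 - K" for x y
  proof (rule ccontr)
    assume "x \<noteq> y"
    then have "adj es x y" using sb[of x y] xy K0(2) by blast
    moreover have "\<not> adj es x y" using II[of x y] xy K0(2) by auto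
    ultimately show False by blast
  qed
  have add: "x = y" if xy: "x \<in> set W \<inter> K - set K0" "y \<in> set W \<inter> K - set K0" for x y
  proof (rule ccontr)
    assume "x \<noteq> y"
    then have "\<not> adj es x y" using sb[of x y] xy by blast
    moreover have "adj es x y" using KK[of x y] xy \<open>x \<noteq> y\<close> by blast
    ultimately show False by blast
  qed
  \<comment> \<open>If no vertex has to leave, \<open>v\<close> is the dummy choice, as it is not in
    \<open>W\<close>; the same holds for \<open>b\<close>.\<close>
  obtain a where a: "a \<in> set (v # W)" "\<forall>x\<in>set W. x \<in> set K0 \<and> x \<noteq> a \<longleftrightarrow> x \<in> set K0 \<and> x \<in> K"
  proof (cases "set K0 - K = {}")
    case True
    show ?thesis by (rule that[of v]) (use True G(4) in auto)
  next
    case False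
    then obtain a where "a \<in> set K0 - K" by blast
    then show ?thesis using that[of a] rem K0(2) by auto
  qed
  obtain b where b: "b \<in> set (v # W)" "\<forall>x\<in>set W. x = b \<longleftrightarrow> x \<in> K \<and> x \<notin> set K0"
  proof (cases "set W \<inter> K - set K0 = {}")
    case True
    show ?thesis by (rule that[of v]) (use True G(4) in auto)
  next
    case False
    then obtain b where bb: "b \<in> set W \<inter> K - set K0" by blast
    show ?thesis by (rule that[of b]) (use bb add in auto)
  qed
  let ?c = "adjust W K0 v a b (v \<in> K)"
  have cs: "x \<in> set ?c \<longleftrightarrow> x \<in> set (v # W) \<and> x \<in> K" for x
    unfolding adjust_def using a(2) b(2) G(4) by auto
  have ok: "split_by es (v # W) ?c"
    unfolding split_by_def cs using KK II by blast
  define cs where "cs = corrections W K0 v"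
  let ?F = "filter (\<lambda>K. split_by es (v # W) K) cs"
  have "?c \<in> set cs"
  proof -
    have "?c \<in> set (map (\<lambda>c. adjust W K0 v a b c) [True, False])" by (cases "v \<in> K") auto
    then show ?thesis unfolding cs_def by (rule concat_mapI[OF a(1) concat_mapI[OF b(1)]])
  qed
  then have "?c \<in> set ?F" using ok by simp
  then obtain K1 Ks where F: "?F = K1 # Ks" by (cases ?F) auto
  have W'K': "W' = v # W" "K' = K1" using ex unfolding extend_clique_def fst_conv snd_conv cs_def[symmetric] F by simp_all
  show "W' = v # W" by (rule W'K'(1))
  have "K1 \<in> set ?F" unfolding F by simp
  then show "split_by es W' K'" unfolding W'K' by simp
  have "set (adjust W K0 v a b c) \<subseteq> set (v # W)" for a b c unfolding adjust_def by (rule filter_is_subset)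
  then show "set K' \<subseteq> set W'"
    using extend_snd_cases[of es "(W, K0)" v] unfolding ex W'K'(1) fst_conv snd_conv by (elim disjE exE) auto
qed

lemma find_clique_correct:
  assumes G: "split_partition G K I" "set (map edge_of es) = edges G" "set vs = verts G" "distinct vs"
    and simple: "simple_graph G"
  shows "distinct (find_clique es vs)"
    "split_partition G (set (find_clique es vs)) (verts G - set (find_clique es vs))"
proof -
  have inv: "split_by es W K0 \<and> set K0 \<subseteq> set W \<and> W = rev xs \<and> distinct K0"
    if "set xs \<subseteq> verts G" "distinct xs" "foldl (\<lambda>s v. extend_clique es s v) ([], []) xs = (W, K0)" for xs W K0
    using that
  proof (induction xs arbitrary: W K0 rule: rev_induct)
    case Nil
    then show ?case by (simp add: split_by_def)
  next
    case (snoc v xs)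
    obtain W1 K1 where s1: "foldl (\<lambda>s v. extend_clique es s v) ([], []) xs = (W1, K1)" by fastforce
    have IH: "split_by es W1 K1" "set K1 \<subseteq> set W1" "W1 = rev xs" "distinct K1"
    proof -
      have "set xs \<subseteq> verts G" "distinct xs" using snoc.prems(1,2) by simp_all
      from snoc.IH[OF this s1] show "split_by es W1 K1" "set K1 \<subseteq> set W1" "W1 = rev xs" "distinct K1"
        by blast+
    qed
    have ex: "extend_clique es (W1, K1) v = (W, K0)" using snoc.prems(3) s1 by simp
    have vW: "set (v # W1) \<subseteq> verts G" "v \<notin> set W1" using IH(3) snoc.prems(1,2) by simp_all
    note E = extend_split_by[OF G(1,2) vW IH(1,2) ex]
    have "distinct (v # W1)" using IH(3) snoc.prems(2) by simp
    then have "distinct (adjust W1 K1 v a b c)" for a b c unfolding adjust_def by (rule distinct_filter)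
    then have "distinct K0" using extend_snd_cases[of es "(W1, K1)" v] unfolding ex fst_conv snd_conv by fastforce
    then show ?case using E IH(3) by simp
  qed
  obtain W K0 where s: "foldl (\<lambda>s v. extend_clique es s v) ([], []) vs = (W, K0)" by fastforce
  have i: "split_by es W K0" "set K0 \<subseteq> set W" "W = rev vs" "distinct K0"
    using inv[OF _ G(4) s] G(3) by blast+
  have K0: "find_clique es vs = K0" unfolding find_clique_def s by simp
  have sub: "set K0 \<subseteq> verts G" using i(2,3) G(3) by simp
  have sb: "(x \<in> set K0 \<and> y \<in> set K0 \<longrightarrow> {x, y} \<in> edges G) \<and> (x \<notin> set K0 \<and> y \<notin> set K0 \<longrightarrow> {x, y} \<notin> edges G)"
    if "x \<in> verts G" "y \<in> verts G" "x \<noteq> y" for x y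
    using i(1) that unfolding split_by_def i(3) set_rev G(3) adj_iff_edge G(2) by blast
  \<comment> \<open>\<open>split_by\<close> compares distinct vertices only, whereas independence
    also speaks of \<open>{x, x}\<close>, so loops are excluded here.\<close>
  have irr: "{x, y} \<notin> edges G" if "x = y" for x y using simple_graph_edge(1)[OF simple] that by blast
  show "distinct (find_clique es vs)" unfolding K0 by (rule i(4))
  show "split_partition G (set (find_clique es vs)) (verts G - set (find_clique es vs))"
    unfolding K0 split_partition_def
  proof (intro conjI)
    show "set K0 \<union> (verts G - set K0) = verts G" using sub by blast
    show "set K0 \<inter> (verts G - set K0) = {}" by blast
    show "clique G (set K0)" unfolding clique_def using sb sub by blast
    show "independent_set G (verts G - set K0)" unfolding independent_set_def
    proof (intro conjI ballI)
      fix u w assume "u \<in> verts G - set K0" "w \<in> verts G - set K0"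
      then show "{u, w} \<notin> edges G" using sb[of u w] irr[of u w] by blast
    qed blast
  qed
qed

section \<open>Names for the new terminals\<close>

lemma foldl_from_on: "foldl (\<lambda>a q. if \<not> a = [] \<or> q = p then q # a else a) a xs =
    (if a = [] then rev (dropWhile (\<lambda>q. q \<noteq> p) xs) else rev xs @ a)"
  by (induction xs arbitrary: a) auto

lemma from_on_eq: "from_on p xs = rev (dropWhile (\<lambda>q. q \<noteq> p) xs)"
  unfolding from_on_def foldl_from_on by simp

lemma from_on_inj:
  assumes "p \<in> set xs" "q \<in> set xs" "length (from_on p xs) = length (from_on q xs)"
  shows "p = q"
proof -
  let ?d = "\<lambda>p. dropWhile (\<lambda>q. q \<noteq> p) xs" and ?t = "\<lambda>p. takeWhile (\<lambda>q. q \<noteq> p) xs"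
  have "length (?t p) + length (?d p) = length xs" "length (?t q) + length (?d q) = length xs"
    by (metis length_append takeWhile_dropWhile_id)+
  then have "length (?t p) = length (?t q)" using assms(3) unfolding from_on_eq by simp
  then have eq: "?d p = ?d q" unfolding dropWhile_eq_drop by simp
  have ne: "?d p \<noteq> []" "?d q \<noteq> []" using assms(1,2) by auto
  have hp: "hd (?d p) = p" and hq: "hd (?d q) = q"
    using hd_dropWhile[OF ne(1)] hd_dropWhile[OF ne(2)] by simp_all
  show ?thesis using hp unfolding eq hq by (rule sym)
qed

text \<open>The name of \<open>p\<close> is \<open>2 ^ (L + j) - 1\<close>, where \<open>L\<close>
  is the total bit length of the old names and \<open>j\<close> the index of \<open>p\<close> from
  the end. An old name has at most \<open>L\<close> bits, and different pairs have different
  \<open>j\<close>.\<close>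

lemma fresh_props:
  shows "p \<in> set F \<Longrightarrow> fresh vs F p \<notin> set vs" "inj_on (fresh vs F) (set F)"
proof -
  let ?L = "length (concat (map (\<lambda>v. bits v) vs))"
  have f: "fresh vs F p + 1 = 2 ^ (?L + length (from_on p F))" for p
    unfolding fresh_def ones_after_eq using ones_after_eq[of 0 "concat (map (\<lambda>v. bits v) vs)"]
    by (simp add: power_add)
  show "fresh vs F p \<notin> set vs" if "p \<in> set F"
  proof
    assume v: "fresh vs F p \<in> set vs"
    have "x \<in> set xs \<Longrightarrow> length (bits x) \<le> length (concat (map (\<lambda>v. bits v) xs))" for x xs
      by (induction xs) auto
    from this[OF v] have len: "length (bits (fresh vs F p)) \<le> ?L" .
    \<comment> \<open>The index starts at 1; \<open>2 ^ L - 1\<close> itself has only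
      \<open>L\<close> bits and might be an old name.\<close>
    have pos: "length (from_on p F) > 0" using that by (auto simp: from_on_eq)
    have "length (bits (fresh vs F p)) \<le> ?L + length (from_on p F) - 1" using len pos by linarith
    then have "(2::nat) ^ length (bits (fresh vs F p)) \<le> 2 ^ (?L + length (from_on p F) - 1)"
      by (rule power_increasing) simp
    moreover have "(2::nat) ^ (?L + length (from_on p F)) = 2 * 2 ^ (?L + length (from_on p F) - 1)"
      using pos by (cases "?L + length (from_on p F)") simp_all
    moreover have "(1::nat) \<le> 2 ^ (?L + length (from_on p F) - 1)" by simp
    ultimately show False using less_power_bits[of "fresh vs F p"] f[of p] by linarith
  qed
  show "inj_on (fresh vs F) (set F)"
  proof (rule inj_onI)
    fix p q assume pq: "p \<in> set F" "q \<in> set F" "fresh vs F p = fresh vs F q"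
    have "(2::nat) ^ (?L + length (from_on p F)) = 2 ^ (?L + length (from_on q F))" using f[of p] f[of q] pq(3) by simp
    then have "length (from_on p F) = length (from_on q F)" by simp
    then show "p = q" by (rule from_on_inj[OF pq(1,2)])
  qed
qed

text \<open>With at most \<open>8 * k\<close> clique vertices there are at most
  \<open>8 * k + 64 * k^2\<close> vertices and \<open>3 * 64 * k^2\<close> edges; 200 covers both,
  also for \<open>k = 0\<close>.\<close>

definition kernel_ok :: "bool \<Rightarrow> nat \<Rightarrow> inst \<Rightarrow> bool" where
  "kernel_ok yes k y \<longleftrightarrow> (\<exists>G' T' k'. encodes_instance (encode y) G' T' k' \<and> split_sfvs_instance G' T' k' \<and>
     (yes \<longleftrightarrow> yes_instance G' T' k') \<and> card (verts G') \<le> 200 * k\<^sup>2 \<and> card (edges G') \<le> 200 * k\<^sup>2 \<and>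
     k' \<le> int k \<and> (\<exists>K' I'. split_partition G' K' I' \<and> card K' \<le> 10 * k))"

lemma encodes_instance_iff:
  "encodes_instance x G T k \<longleftrightarrow> (\<exists>vs es ts. distinct vs \<and> set vs = verts G \<and>
     distinct (map edge_of es) \<and> set (map edge_of es) = edges G \<and> distinct ts \<and> set ts = T \<and>
     x = encode (vs, es, ts, k < 0, nat \<bar>k\<bar>))"
proof -
  have "enc_list enc_nat vs = encode vs" for vs
    by (simp add: encode_list_def encode_nat_def)
  moreover have "enc_edge = encode"
    by (rule ext) (simp add: enc_edge_def encode_prod_def encode_nat_def)
  then have "enc_list enc_edge es = encode es" for es by (simp add: encode_list_def)
  moreover have "enc_int k = encode (k < 0, nat \<bar>k\<bar>)"
    by (simp add: enc_int_def enc_simps encode_bool_def encode_nat_def)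
  ultimately show ?thesis unfolding encodes_instance_def by (simp add: enc_simps)
qed

lemma empty_output:
  fixes k :: int
  assumes G: "G = \<lparr>verts = {} :: nat set, edges = {}\<rparr>"
  shows "encodes_instance (encode ([] :: nat list, [] :: (nat \<times> nat) list, [] :: nat list, k < 0, nat \<bar>k\<bar>)) G {} k"
    "split_sfvs_instance G {} k" "yes_instance G {} k \<longleftrightarrow> 0 \<le> k" "split_partition G {} {}"
proof -
  show "encodes_instance (encode ([] :: nat list, [] :: (nat \<times> nat) list, [] :: nat list, k < 0, nat \<bar>k\<bar>)) G {} k"
    unfolding encodes_instance_iff G
    by (intro exI[of _ "[] :: nat list"] exI[of _ "[] :: (nat \<times> nat) list"]) simp
  show sp: "split_partition G {} {}"
    by (simp add: G split_partition_def clique_def independent_set_def)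
  then show "split_sfvs_instance G {} k"
    unfolding split_sfvs_instance_def split_graph_def by (auto simp: simple_graph_def G)
  show "yes_instance G {} k \<longleftrightarrow> 0 \<le> k"
    unfolding yes_instance_def is_T_cycle_def by (auto simp: G)
qed

lemma yes_output_ok: "yes \<Longrightarrow> kernel_ok yes k yes_output"
  using empty_output(1-3)[OF refl, of 0] empty_output(4)[OF refl] unfolding kernel_ok_def yes_output_def
  by (intro exI[of _ "\<lparr>verts = {}, edges = {}\<rparr>"] exI[of _ "{}"] exI[of _ 0]) auto

lemma no_output_ok: "\<not> yes \<Longrightarrow> kernel_ok yes k no_output"
  using empty_output(1-3)[OF refl, of "-1"] empty_output(4)[OF refl] unfolding kernel_ok_def no_output_def
  by (intro exI[of _ "\<lparr>verts = {}, edges = {}\<rparr>"] exI[of _ "{}"] exI[of _ "-1"]) auto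

section \<open>The kernel as a split graph\<close>

lemma distinct_incidences:
  assumes "distinct (map fst hs)" "\<And>p. p \<in> set hs \<Longrightarrow> distinct (snd p)"
  shows "distinct (concat (map (\<lambda>p. map (\<lambda>u. (fst p, u)) (snd p)) hs))"
  using assms
proof (induction hs)
  case (Cons p hs)
  have "distinct (map (\<lambda>u. (fst p, u)) (snd p))" using Cons.prems(2)[of p] by (simp add: distinct_map inj_on_def)
  moreover have "set (map (\<lambda>u. (fst p, u)) (snd p)) \<inter> set (concat (map (\<lambda>p. map (\<lambda>u. (fst p, u)) (snd p)) hs)) = {}"
    using Cons.prems(1) by force
  ultimately show ?case using Cons by simp
qed simp

text \<open>All terminals of the new graph lie on its independent side, so there is no clique
  terminal to force and its answer is exactly that of the hypergraph problem.\<close>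

lemma assemble_graph:
  assumes wf: "wf_hyper K H" and es: "distinct (map edge_of es)"
    and irr: "\<And>u v. (u, v) \<in> set es \<Longrightarrow> u \<noteq> v"
    and cl: "\<And>u v. u \<in> set K \<Longrightarrow> v \<in> set K \<Longrightarrow> u \<noteq> v \<Longrightarrow> {u, v} \<in> set (map edge_of es)"
    and es': "es' = filter (\<lambda>p. fst p \<in> set K \<and> snd p \<in> set K) es @
        concat (map (\<lambda>p. map (\<lambda>u. (fst p, u)) (snd p)) H)"
    and G: "G = \<lparr>verts = set (K @ map fst H), edges = set (map edge_of es')\<rparr>"
  shows "distinct (K @ map fst H)" "distinct (map edge_of es')" "simple_graph G"
    "split_partition G (set K) (fst ` set H)"
    "yes_instance G (fst ` set H) (int k) \<longleftrightarrow> hyper_yes K H {} k"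
    "card (edges G) \<le> length K * length K + (\<Sum>p\<leftarrow>H. length (snd p))"
proof -
  note D = wf_hyperD[OF wf]
  let ?A = "filter (\<lambda>p. fst p \<in> set K \<and> snd p \<in> set K) es"
  let ?B = "concat (map (\<lambda>p. map (\<lambda>u. (fst p, u)) (snd p)) H)"
  let ?J = "fst ` set H"
  have KJ: "set K \<inter> ?J = {}" using D(5) by blast
  show dV: "distinct (K @ map fst H)" using D(1,2) KJ by simp
  have B: "(t, u) \<in> set ?B \<longleftrightarrow> t \<in> ?J \<and> u \<in> nbrs H t" for t u
  proof
    assume "(t, u) \<in> set ?B"
    then obtain p where p: "p \<in> set H" "t = fst p" "u \<in> set (snd p)" by auto
    then show "t \<in> ?J \<and> u \<in> nbrs H t" using nbrs_mem[OF D(2) p(1)] by simp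
  next
    assume tu: "t \<in> ?J \<and> u \<in> nbrs H t"
    then obtain p where p: "p \<in> set H" "t = fst p" by blast
    then have "u \<in> set (snd p)" using nbrs_mem[OF D(2) p(1)] tu by simp
    then have "(t, u) \<in> set (map (\<lambda>u. (fst p, u)) (snd p))" using p(2) by simp
    then show "(t, u) \<in> set ?B" by (rule concat_mapI[OF p(1)])
  qed
  have NK: "nbrs H t \<subseteq> set K" if "t \<in> ?J" for t using nbrs_subset[OF wf that] .
  have eA: "{u, v} \<in> set (map edge_of ?A) \<longleftrightarrow> {u, v} \<in> set (map edge_of es) \<and> u \<in> set K \<and> v \<in> set K" for u v
    unfolding adj_iff_edge[symmetric] adj_def by auto
  have eB: "{u, v} \<in> set (map edge_of ?B) \<longleftrightarrow> (u \<in> ?J \<and> v \<in> nbrs H u) \<or> (v \<in> ?J \<and> u \<in> nbrs H v)" for u v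
    unfolding adj_iff_edge[symmetric] adj_def B by blast
  have E: "edges G = set (map edge_of ?A) \<union> set (map edge_of ?B)" unfolding G es' by simp
  have e: "{u, v} \<in> edges G \<longleftrightarrow> ({u, v} \<in> set (map edge_of es) \<and> u \<in> set K \<and> v \<in> set K) \<or>
      (u \<in> ?J \<and> v \<in> nbrs H u) \<or> (v \<in> ?J \<and> u \<in> nbrs H v)" for u v
    unfolding E using eA eB by blast
  have dA: "distinct (map edge_of ?A)" using es by (rule distinct_map_filter)
  have dB: "distinct (map edge_of ?B)"
    unfolding distinct_map
  proof
    show "distinct ?B" using D(2,3) by (rule distinct_incidences)
    show "inj_on edge_of (set ?B)"
    proof (rule inj_onI, clarify)
      fix t u t' u' assume "(t, u) \<in> set ?B" "(t', u') \<in> set ?B" and eq: "{t, u} = {t', u'}"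
      then have "t \<in> ?J" "t' \<in> ?J" "u \<in> set K" "u' \<in> set K" using B NK by blast+
      then show "t = t' \<and> u = u'" using eq KJ unfolding doubleton_eq_iff by blast
    qed
  qed
  have "set (map edge_of ?A) \<inter> set (map edge_of ?B) = {}"
  proof (rule ccontr)
    assume "set (map edge_of ?A) \<inter> set (map edge_of ?B) \<noteq> {}"
    then obtain x where x: "x \<in> set (map edge_of ?A)" "x \<in> set (map edge_of ?B)" by blast
    then obtain p where p: "p \<in> set ?B" "x = edge_of p" by (metis (no_types, lifting) imageE list.set_map)
    obtain t u where "p = (t, u)" by fastforce
    then have tu: "(t, u) \<in> set ?B" "{t, u} \<in> set (map edge_of ?A)" using p x(1) by simp_all
    have "t \<in> ?J" using tu(1) B by blast
    moreover have "t \<in> set K" using tu(2) eA by blast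
    ultimately show False using KJ by blast
  qed
  then show dE: "distinct (map edge_of es')" unfolding es' map_append distinct_append using dA dB by simp
  show sg: "simple_graph G"
    unfolding simple_graph_def
  proof (intro conjI ballI)
    show "finite (verts G)" unfolding G by simp
    fix x assume x: "x \<in> edges G"
    then obtain u v where uv: "x = {u, v}" "(u, v) \<in> set ?A \<or> (u, v) \<in> set ?B" unfolding E by auto
    have "u \<in> verts G \<and> v \<in> verts G \<and> u \<noteq> v"
    proof (cases "(u, v) \<in> set ?A")
      case True
      then show ?thesis using irr[of u v] unfolding G by simp
    next
      case False
      then have "u \<in> ?J" "v \<in> set K" using uv(2) B NK by blast+
      then show ?thesis using KJ unfolding G by auto
    qed
    then show "x \<subseteq> verts G" "card x = 2" unfolding uv(1) by simp_all
  qed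
  have VG: "verts G = set K \<union> ?J" unfolding G by simp
  show sp: "split_partition G (set K) ?J"
    unfolding split_partition_def
  proof (intro conjI)
    show "set K \<union> ?J = verts G" using VG by simp
    show "set K \<inter> ?J = {}" by (rule KJ)
    show "clique G (set K)" unfolding clique_def VG e using cl by blast
    show "independent_set G ?J" unfolding independent_set_def VG e using KJ NK by blast
  qed
  have "yes_instance G ?J (int k) \<longleftrightarrow> card (set K \<inter> ?J) \<le> k \<and>
     hyes (set K - ?J) (?J - set K) (\<lambda>t. {u \<in> set K - ?J. {u, t} \<in> edges G}) {} (k - card (set K \<inter> ?J))"
    by (rule yes_instance_iff_hyes[OF sg sp]) (use VG KJ in auto)
  also have "\<dots> \<longleftrightarrow> hyes (set K - ?J) (?J - set K) (\<lambda>t. {u \<in> set K - ?J. {u, t} \<in> edges G}) {} k"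
    unfolding KJ by simp
  also have "\<dots> \<longleftrightarrow> hyes (set K) ?J (nbrs H) {} k"
  proof (rule hyes_cong)
    show "set K - ?J = set K" "?J - set K = ?J" using KJ by blast+
    show "{u \<in> set K - ?J. {u, t} \<in> edges G} = nbrs H t" if "t \<in> ?J" for t
      unfolding e using that KJ NK by blast
  qed simp
  finally show "yes_instance G ?J (int k) \<longleftrightarrow> hyes (set K) ?J (nbrs H) {} k" .
  have "card (set (map edge_of ?A)) \<le> card (edge_of ` (set K \<times> set K))" by (intro card_mono) auto
  also have "\<dots> \<le> card (set K \<times> set K)" by (intro card_image_le) simp
  also have "\<dots> = length K * length K" using D(1) by (simp add: card_cartesian_product distinct_card)
  finally have "card (set (map edge_of ?A)) \<le> length K * length K" .
  moreover have "card (set (map edge_of ?B)) \<le> (\<Sum>p\<leftarrow>H. length (snd p))"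
    using card_length[of "map edge_of ?B"] by (simp add: length_concat comp_def)
  ultimately show "card (edges G) \<le> length K * length K + (\<Sum>p\<leftarrow>H. length (snd p))"
    unfolding E using card_Un_le[of "set (map edge_of ?A)" "set (map edge_of ?B)"] by linarith
qed

text \<open>\<open>J\<close> and \<open>N\<close> describe the terminals before those without
  neighbours are dropped. Each remaining one has an incidence, so the bound on incidences also
  bounds the vertices.\<close>

lemma assemble_ok:
  assumes wf: "wf_hyper K hs" and ne: "\<And>p. p \<in> set hs \<Longrightarrow> snd p \<noteq> []"
    and vs: "set K \<subseteq> set vs" "fst ` set hs \<subseteq> set vs"
    and es: "distinct (map edge_of es)" and irr: "\<And>u v. (u, v) \<in> set es \<Longrightarrow> u \<noteq> v"
    and cl: "\<And>u v. u \<in> set K \<Longrightarrow> v \<in> set K \<Longrightarrow> u \<noteq> v \<Longrightarrow> {u, v} \<in> set (map edge_of es)"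
    and F: "distinct F" "\<And>u v. (u, v) \<in> set F \<Longrightarrow> u \<in> set K \<and> v \<in> set K \<and> u \<noteq> v"
    and J: "fst ` set hs \<subseteq> J" "J \<subseteq> set vs" "finite J" "\<And>t. t \<in> fst ` set hs \<Longrightarrow> N t = nbrs hs t"
      "\<And>t. t \<in> J - fst ` set hs \<Longrightarrow> N t = {}"
    and yes: "yes \<longleftrightarrow> hyes (set K) J N (set F) (length k)"
    and size: "(\<Sum>p\<leftarrow>hs. length (snd p)) + length F \<le> length K * length K"
    and small: "length K \<le> 8 * m" "length k \<le> m"
  shows "kernel_ok yes m (assemble vs es K hs F k)"
proof -
  note D = wf_hyperD[OF wf]
  let ?nm = "fresh vs F"
  define H where "H = hs @ map (\<lambda>q. (?nm q, [fst q, snd q])) F"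
  define es' where "es' = filter (\<lambda>p. fst p \<in> set K \<and> snd p \<in> set K) es @
        concat (map (\<lambda>p. map (\<lambda>u. (fst p, u)) (snd p)) H)"
  define G where "G = \<lparr>verts = set (K @ map fst H), edges = set (map edge_of es')\<rparr>"
  have nm: "?nm q \<notin> set vs" if "q \<in> set F" for q using fresh_props(1)[OF that] .
  have inj: "inj_on ?nm (set F)" by (rule fresh_props(2))
  have fstH: "map fst H = map fst hs @ map ?nm F" unfolding H_def by (simp add: comp_def)
  have wfH: "wf_hyper K H"
    unfolding wf_hyper_def
  proof (intro conjI ballI)
    show "distinct K" by (rule D)
    have "distinct (map ?nm F)" using F(1) inj by (simp add: distinct_map)
    moreover have "set (map fst hs) \<inter> set (map ?nm F) = {}" using nm vs(2) by auto
    ultimately show "distinct (map fst H)" unfolding fstH using D(2) by simp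
    fix p assume "p \<in> set H"
    then consider "p \<in> set hs" | q where "q \<in> set F" "p = (?nm q, [fst q, snd q])" unfolding H_def by auto
    then have "distinct (snd p) \<and> set (snd p) \<subseteq> set K \<and> fst p \<notin> set K"
    proof cases
      case 1
      then show ?thesis using D(3-5) by blast
    next
      case 2
      have "fst q \<in> set K \<and> snd q \<in> set K \<and> fst q \<noteq> snd q" using F(2)[of "fst q" "snd q"] 2(1) by simp
      then show ?thesis using 2 nm[OF 2(1)] vs(1) by auto
    qed
    then show "distinct (snd p)" "set (snd p) \<subseteq> set K" "fst p \<notin> set K" by blast+
  qed
  note A = assemble_graph[OF wfH es irr cl es'_def G_def]
  have JH: "fst ` set H = fst ` set hs \<union> ?nm ` set F" using arg_cong[OF fstH, of set] by simp
  have nH: "nbrs H (fst p) = set (snd p)" if "p \<in> set H" for p by (rule nbrs_mem[OF wf_hyperD(2)[OF wfH] that])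
  have "hyes (set K) J N (set F) (length k) \<longleftrightarrow>
      hyes (set K) (fst ` set hs \<union> ?nm ` set F) (\<lambda>t. if t \<in> J then N t else nbrs H t) {} (length k)"
  proof (rule hyes_pairs_as_terminals)
    show "finite (set K)" "finite J" "finite (set F)" using J(3) by simp_all
    show "u \<in> set K \<and> v \<in> set K \<and> u \<noteq> v" if "(u, v) \<in> set F" for u v using F(2)[OF that] .
    show "inj_on ?nm (set F)" by (rule inj)
    show d: "?nm ` set F \<inter> J = {}" using nm J(2) by blast
    show "(if ?nm (u, v) \<in> J then N (?nm (u, v)) else nbrs H (?nm (u, v))) = {u, v}" if uv: "(u, v) \<in> set F" for u v
    proof -
      have "?nm (u, v) \<notin> J" using d uv by blast
      moreover have "(?nm (u, v), [u, v]) \<in> set H" unfolding H_def using uv by force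
      ultimately show ?thesis using nH[of "(?nm (u, v), [u, v])"] by simp
    qed
    show "(if t \<in> J then N t else nbrs H t) = N t" if "t \<in> J" for t using that by simp
    show "fst ` set hs \<subseteq> J" by (rule J(1))
    show "N t = {}" if "t \<in> J - fst ` set hs" for t using J(5)[OF that] .
  qed
  also have "\<dots> \<longleftrightarrow> hyper_yes K H {} (length k)"
  proof (rule hyes_cong)
    show "fst ` set hs \<union> ?nm ` set F = fst ` set H" by (rule JH[symmetric])
    fix t assume t: "t \<in> fst ` set H"
    show "(if t \<in> J then N t else nbrs H t) = nbrs H t"
    proof (cases "t \<in> J")
      case True
      then have "t \<in> fst ` set hs" using t nm J(2) unfolding JH by blast
      then obtain p where p: "p \<in> set hs" "t = fst p" by blast
      have "p \<in> set H" using p(1) unfolding H_def by simp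
      from nH[OF this] nbrs_mem[OF D(2) p(1)] have "nbrs H t = nbrs hs t" using p(2) by simp
      then show ?thesis using J(4)[OF \<open>t \<in> fst ` set hs\<close>] by simp
    qed simp
  qed simp_all
  finally have Y: "yes \<longleftrightarrow> yes_instance G (fst ` set H) (int (length k))" using yes A(5) by simp
  have out: "assemble vs es K hs F k = (K @ map fst H, es', map fst H, False, length k)"
    unfolding assemble_def H_def[symmetric] es'_def Let_def binary_eq by simp
  have enc: "encodes_instance (encode (assemble vs es K hs F k)) G (fst ` set H) (int (length k))"
    unfolding encodes_instance_iff out
    by (rule exI[of _ "K @ map fst H"], rule exI[of _ es'], rule exI[of _ "map fst H"])
      (use A(1,2) in \<open>simp add: G_def\<close>)
  have inst: "split_sfvs_instance G (fst ` set H) (int (length k))"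
    unfolding split_sfvs_instance_def split_graph_def using A(3,4) by (auto simp: G_def)
  have "length hs \<le> (\<Sum>p\<leftarrow>hs. length (snd p))" using ne
  proof (induction hs)
    case (Cons p hs)
    have "1 \<le> length (snd p)" using Cons.prems[of p] by (simp add: Suc_le_eq)
    moreover have "length hs \<le> (\<Sum>p\<leftarrow>hs. length (snd p))" using Cons by simp
    ultimately show ?case by simp
  qed simp
  then have "length (K @ map fst H) \<le> length K + length K * length K" using size by (simp add: fstH)
  then have cV: "card (verts G) \<le> length K + length K * length K"
    unfolding G_def using card_length[of "K @ map fst H"] by simp
  have "(\<Sum>p\<leftarrow>H. length (snd p)) = (\<Sum>p\<leftarrow>hs. length (snd p)) + 2 * length F"
    unfolding H_def by (simp add: comp_def sum_list_triv)
  \<comment> \<open>The clique accounts for one \<open>length K * length K\<close>. A pair in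
    \<open>F\<close> makes two edges, so the incidences are at most twice the bound in
    \<open>size\<close>.\<close>
  then have cE: "card (edges G) \<le> 3 * (length K * length K)" using A(6) size by linarith
  have KK: "length K * length K \<le> 64 * m\<^sup>2"
    using mult_mono[OF small(1) small(1)] by (simp add: power2_eq_square)
  have "8 * m \<le> 8 * m\<^sup>2" by (simp add: power2_eq_square)
  then have "card (verts G) \<le> 200 * m\<^sup>2" "card (edges G) \<le> 200 * m\<^sup>2" using cV cE KK small(1) by linarith+
  moreover have "card (set K) \<le> 10 * m" using card_length[of K] small(1) by linarith
  ultimately show ?thesis
    unfolding kernel_ok_def using enc inst Y A(4) small(2) by (metis of_nat_le_iff)
qed

lemma reduce_hyper_ok:
  assumes wf: "wf_hyper K hs" and vs: "set K \<subseteq> set vs" "fst ` set hs \<subseteq> set vs"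
    and es: "distinct (map edge_of es)" and irr: "\<And>u v. (u, v) \<in> set es \<Longrightarrow> u \<noteq> v"
    and cl: "\<And>u v. u \<in> set K \<Longrightarrow> v \<in> set K \<Longrightarrow> u \<noteq> v \<Longrightarrow> {u, v} \<in> set (map edge_of es)"
    and yes: "yes \<longleftrightarrow> hyper_yes K hs {} (length k)" and m: "length k \<le> m"
  shows "kernel_ok yes m (reduce_hyper vs es K hs k)"
proof -
  obtain X P where XP: "pack hs = (X, P)" by fastforce
  obtain L R where c: "crown (expansion_edges K hs X P) (copies (X @ P)) = (L, R)" by fastforce
  define Y where "Y = filter (\<lambda>y. (False, y) \<in> set R) (X @ P)"
  define K1 where "K1 = filter (\<lambda>u. \<not> u \<in> set L \<and> \<not> u \<in> set Y) K"
  define hs1 where "hs1 = map (\<lambda>p. (fst p, filter (\<lambda>u. u \<in> set K1) (snd p))) (filter (\<lambda>p. \<not> fst p \<in> set Y) hs)"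
  obtain hs2 F where th: "thin K1 hs1 = (hs2, F)" by fastforce
  have red: "reduce_hyper vs es K hs k = (if length P \<le> length k \<and> length Y \<le> length k
      then assemble vs es K1 (filter (\<lambda>p. \<not> snd p = []) hs2) F (drop (length Y) k) else no_output)"
    unfolding reduce_hyper_def XP fst_conv snd_conv Let_def c Y_def[symmetric] K1_def[symmetric] hs1_def[symmetric] th ..
  note E = expansion_correct[OF wf XP c Y_def K1_def hs1_def]
  note T = thin_correct[OF E(1) th]
  note D2 = wf_hyperD[OF T(1)]
  show ?thesis
  proof (cases "length P \<le> length k \<and> length Y \<le> length k")
    case False
    have "\<not> yes"
    proof
      assume "yes"
      then have h: "hyper_yes K hs {} (length k)" using yes by simp
      have "length P \<le> length k" by (rule pack_correct(7)[OF wf XP h])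
      moreover have "length Y \<le> length k" using h unfolding E(5) by simp
      ultimately show False using False by simp
    qed
    then show ?thesis unfolding red if_not_P[OF False] by (rule no_output_ok)
  next
    case True
    \<comment> \<open>Thinning can leave terminals without neighbours, whose number incidences would
      not control.\<close>
    let ?hs = "filter (\<lambda>p. \<not> snd p = []) hs2"
    have sub: "fst ` set ?hs \<subseteq> fst ` set hs2" by auto
    have wf3: "wf_hyper K1 ?hs"
      unfolding wf_hyper_def using D2 distinct_map_filter[OF D2(2)] by auto
    have nb: "nbrs hs2 t = nbrs ?hs t" if t: "t \<in> fst ` set ?hs" for t
    proof -
      obtain p where p: "p \<in> set ?hs" "t = fst p" using t by blast
      then have "p \<in> set hs2" by simp
      from nbrs_mem[OF D2(2) this] nbrs_mem[OF wf_hyperD(2)[OF wf3] p(1)] show ?thesis using p(2) by simp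
    qed
    have nb0: "nbrs hs2 t = {}" if t: "t \<in> fst ` set hs2 - fst ` set ?hs" for t
    proof -
      obtain p where p: "p \<in> set hs2" "t = fst p" using t by blast
      then have "snd p = []" using t by auto
      then show ?thesis using nbrs_mem[OF D2(2) p(1)] p(2) by simp
    qed
    have vs2: "fst ` set hs2 \<subseteq> set vs" using T(2) E(3) vs(2) by simp
    have vs1: "set K1 \<subseteq> set vs" using E(4) vs(1) by simp
    have y: "yes \<longleftrightarrow> hyper_yes K1 hs2 (set F) (length (drop (length Y) k))"
      using yes unfolding E(5) T(3) using True by simp
    have "(\<Sum>p\<leftarrow>?hs. length (snd p)) = (\<Sum>p\<leftarrow>hs2. length (snd p))" by (induction hs2) auto
    then have sz: "(\<Sum>p\<leftarrow>?hs. length (snd p)) + length F \<le> length K1 * length K1" using T(6) by simp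
    have "kernel_ok yes m (assemble vs es K1 ?hs F (drop (length Y) k))"
    proof (rule assemble_ok[OF wf3 _ vs1 _ es irr _ T(4) T(5) sub vs2 _ _ nb0 y sz])
      show "fst ` set ?hs \<subseteq> set vs" using sub vs2 by (rule subset_trans)
      show "{u, v} \<in> set (map edge_of es)" if "u \<in> set K1" "v \<in> set K1" "u \<noteq> v" for u v
        using cl that E(4) by blast
      show "length K1 \<le> 8 * m" using E(2) True m by linarith
      show "length (drop (length Y) k) \<le> m" using m by simp
    qed (use nb in simp_all)
    then show ?thesis unfolding red using True by simp
  qed
qed

lemma reduce_ok:
  assumes G: "simple_graph G" "split_graph G" and T: "T \<subseteq> verts G"
    and vs: "distinct vs" "set vs = verts G"
    and es: "distinct (map edge_of es)" "set (map edge_of es) = edges G"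
    and ts: "distinct ts" "set ts = T"
    and yes: "yes \<longleftrightarrow> yes_instance G T (int (length k))"
  shows "kernel_ok yes (length k) (reduce vs es ts k)"
proof -
  obtain K0 I0 where sp0: "split_partition G K0 I0" using G(2) unfolding split_graph_def by blast
  define K where "K = find_clique es vs"
  let ?I = "verts G - set K"
  have dK: "distinct K" and sp: "split_partition G (set K) ?I"
    using find_clique_correct[OF sp0 es(2) vs(2,1) G(1)] unfolding K_def by simp_all
  have KV: "set K \<subseteq> verts G" using sp unfolding split_partition_def by blast
  have adj: "adj es u v \<longleftrightarrow> {u, v} \<in> edges G" for u v unfolding adj_iff_edge es(2) ..
  define KT where "KT = filter (\<lambda>v. v \<in> set ts) K"
  have red: "reduce vs es ts k = (if small_check vs es ts K k then yes_output
         else if length KT \<le> length k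
         then reduce_hyper vs es (filter (\<lambda>v. \<not> v \<in> set ts) K) (hyperedges es ts K) (drop (length KT) k)
         else no_output)"
    unfolding reduce_def K_def[symmetric] Let_def KT_def ..
  have len: "length (filter (\<lambda>x. \<not> x = u \<and> \<not> x = w) K) = card (set K - {u, w})" for u w
  proof -
    have "set (filter (\<lambda>x. \<not> x = u \<and> \<not> x = w) K) = set K - {u, w}" by auto
    then show ?thesis using distinct_card[OF distinct_filter[OF dK], of "\<lambda>x. \<not> x = u \<and> \<not> x = w"] by simp
  qed
  have check: "small_check vs es ts K k \<longleftrightarrow> small_clique G T (set K) ?I (length k)"
    unfolding small_check_def small_clique_def len adj vs(2) ts(2) by blast
  show ?thesis
  proof (cases "small_check vs es ts K k")
    case True
    then have "yes" using small_clique_yes[OF G(1) sp] check yes by simp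
    then show ?thesis unfolding red using True yes_output_ok by simp
  next
    case False
    have "set KT = set K \<inter> T" unfolding KT_def ts(2) by auto
    moreover have "distinct KT" unfolding KT_def using dK by (rule distinct_filter)
    ultimately have cKT: "length KT = card (set K \<inter> T)" using distinct_card by metis
    let ?K = "filter (\<lambda>v. \<not> v \<in> set ts) K" and ?hs = "hyperedges es ts K"
    have sK: "set ?K = set K - T" using ts(2) by auto
    have fh: "map fst ?hs = filter (\<lambda>t. \<not> t \<in> set K) ts" unfolding hyperedges_def by (simp add: comp_def)
    have J: "fst ` set ?hs = T - set K" using arg_cong[OF fh, of set] ts(2) by auto
    have h_mem: "\<exists>t. p = (t, filter (\<lambda>u. \<not> u \<in> set ts \<and> adj es u t) K) \<and> t \<in> T - set K" if "p \<in> set ?hs" for p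
      using that ts(2) unfolding hyperedges_def by auto
    have wf: "wf_hyper ?K ?hs"
      unfolding wf_hyper_def
    proof (intro conjI ballI)
      show "distinct ?K" using dK by (rule distinct_filter)
      show "distinct (map fst ?hs)" unfolding fh using ts(1) by (rule distinct_filter)
      fix p assume "p \<in> set ?hs"
      then obtain t where t: "p = (t, filter (\<lambda>u. \<not> u \<in> set ts \<and> adj es u t) K)" "t \<in> T - set K" using h_mem by blast
      show "distinct (snd p)" unfolding t(1) snd_conv using dK by (rule distinct_filter)
      show "set (snd p) \<subseteq> set ?K" unfolding t(1) by auto
      show "fst p \<notin> set ?K" using t by simp
    qed
    have N: "nbrs ?hs t = {u \<in> set K - T. {u, t} \<in> edges G}" if t: "t \<in> T - set K" for t
    proof -
      have "(t, filter (\<lambda>u. \<not> u \<in> set ts \<and> adj es u t) K) \<in> set ?hs"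
        unfolding hyperedges_def using t ts(2) by auto
      from nbrs_mem[OF wf_hyperD(2)[OF wf] this] show ?thesis using ts(2) adj by auto
    qed
    have iff: "yes \<longleftrightarrow> length KT \<le> length k \<and>
        hyper_yes ?K ?hs {} (length k - length KT)"
    proof -
      have "yes_instance G T (int (length k)) \<longleftrightarrow> card (set K \<inter> T) \<le> length k \<and>
        hyes (set K - T) (T - set K) (\<lambda>t. {u \<in> set K - T. {u, t} \<in> edges G}) {} (length k - card (set K \<inter> T))"
        by (rule yes_instance_iff_hyes[OF G(1) sp T]) (use not_small_clique_forced[OF G(1) sp] check False in blast)
      moreover have "hyes (set K - T) (T - set K) (\<lambda>t. {u \<in> set K - T. {u, t} \<in> edges G}) {} j \<longleftrightarrow>
          hyper_yes ?K ?hs {} j" for j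
        by (rule hyes_cong) (use sK J N in simp_all)
      ultimately show ?thesis using yes unfolding cKT by simp
    qed
    show ?thesis
    proof (cases "length KT \<le> length k")
      case True
      have "kernel_ok yes (length k) (reduce_hyper vs es ?K ?hs (drop (length KT) k))"
      proof (rule reduce_hyper_ok[OF wf _ _ es(1)])
        show "set ?K \<subseteq> set vs" using KV vs(2) by auto
        show "fst ` set ?hs \<subseteq> set vs" unfolding J using T vs(2) by auto
        show "u \<noteq> v" if "(u, v) \<in> set es" for u v
        proof -
          have "{u, v} \<in> edges G" using that es(2) unfolding adj[symmetric] adj_def by simp
          then show ?thesis by (rule simple_graph_edge(1)[OF G(1)])
        qed
        show "{u, v} \<in> set (map edge_of es)" if "u \<in> set ?K" "v \<in> set ?K" "u \<noteq> v" for u v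
          using sp that unfolding es(2) split_partition_def clique_def by simp
        show "yes \<longleftrightarrow> hyper_yes ?K ?hs {} (length (drop (length KT) k))"
          using iff True by simp
        show "length (drop (length KT) k) \<le> length k" by simp
      qed
      then show ?thesis unfolding red using False True by simp
    next
      case f: False
      then have "\<not> yes" using iff by simp
      then show ?thesis unfolding red using False f no_output_ok by simp
    qed
  qed
qed

text \<open>No solution has more elements than the graph has vertices, so truncating the budget in
  \<open>unary\<close> is sound.\<close>

lemma yes_instance_min:
  assumes "simple_graph G" "0 \<le> k"
  shows "yes_instance G T k \<longleftrightarrow> yes_instance G T (int (min (nat k) (card (verts G))))"
proof -
  have "int (card S) \<le> k \<longleftrightarrow> int (card S) \<le> int (min (nat k) (card (verts G)))" if "S \<subseteq> verts G" for S
    using card_mono[OF _ that] assms by (auto simp: simple_graph_def)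
  then show ?thesis unfolding yes_instance_def by auto
qed

text \<open>The clique bound is stated for \<open>0 \<le> k\<close> because no cardinality is at
  most a negative number. The kernel is bounded in the truncated budget, which is at most
  \<open>k\<close>.\<close>

theorem theorem1:
  "\<exists>(P :: com) (c :: nat).
     polynomial_time_on P
       {x. \<exists>G T k. split_sfvs_instance G T k \<and> encodes_instance x G T k} \<and>
     (\<forall>G T k x. split_sfvs_instance G T k \<and> encodes_instance x G T k \<longrightarrow>
        (\<exists>G' T' k' y.
           computes P x y \<and> encodes_instance y G' T' k' \<and>
           split_sfvs_instance G' T' k' \<and>
           (yes_instance G T k \<longleftrightarrow> yes_instance G' T' k') \<and>
           int (card (verts G')) \<le> int c * k\<^sup>2 \<and>
           int (card (edges G')) \<le> int c * k\<^sup>2 \<and>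
           k' \<le> k \<and>
           (0 \<le> k \<longrightarrow> (\<exists>K' I'. split_partition G' K' I' \<and> int (card K') \<le> 10 * k))))"
proof -
  obtain P p where P: "realizes 0 P p kernelize" using ptimeE[OF ptime_kernelize] .
  have run: "\<exists>t. runs P (encode x) t (encode (kernelize x)) \<and> t \<le> poly p (size_enc x)" for x
    by (rule realizesE[OF P, of "(\<lambda>_. Leaf)(0 := encode x)" x]) (auto simp: runs_def)
  show ?thesis
  proof (intro exI[of _ P] exI[of _ 200] conjI allI impI)
    show "polynomial_time_on P {x. \<exists>G T k. split_sfvs_instance G T k \<and> encodes_instance x G T k}"
      unfolding polynomial_time_on_def
    proof (intro exI[of _ p] ballI)
      fix x assume "x \<in> {x. \<exists>G T k. split_sfvs_instance G T k \<and> encodes_instance x G T k}"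
      then obtain i :: inst where "x = encode i" unfolding encodes_instance_iff by blast
      then show "\<exists>t y. runs P x t y \<and> t \<le> poly p (tsize x)" using run[of i] by blast
    qed
  next
    fix G :: "nat ugraph" and T k x
    assume "split_sfvs_instance G T k \<and> encodes_instance x G T k"
    then obtain vs es ts where G: "split_graph G" "T \<subseteq> verts G"
      and i: "distinct vs" "set vs = verts G" "distinct (map edge_of es)" "set (map edge_of es) = edges G"
        "distinct ts" "set ts = T" and x: "x = encode (vs, es, ts, k < 0, nat \<bar>k\<bar>)"
      unfolding split_sfvs_instance_def encodes_instance_iff by blast
    have sg: "simple_graph G" using G(1) by (simp add: split_graph_def)
    have comp: "computes P x (encode (kernelize (vs, es, ts, k < 0, nat \<bar>k\<bar>)))"
      unfolding computes_def x using run by blast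
    show "\<exists>G' T' k' y.
           computes P x y \<and> encodes_instance y G' T' k' \<and>
           split_sfvs_instance G' T' k' \<and>
           (yes_instance G T k \<longleftrightarrow> yes_instance G' T' k') \<and>
           int (card (verts G')) \<le> int 200 * k\<^sup>2 \<and>
           int (card (edges G')) \<le> int 200 * k\<^sup>2 \<and>
           k' \<le> k \<and>
           (0 \<le> k \<longrightarrow> (\<exists>K' I'. split_partition G' K' I' \<and> int (card K') \<le> 10 * k))"
    proof (cases "k < 0")
      case True
      \<comment> \<open>Both instances have the same negative budget and hence no solution, and the
        empty graph satisfies the size bounds trivially.\<close>
      let ?G = "\<lparr>verts = {} :: nat set, edges = {}\<rparr>"
      have "kernelize (vs, es, ts, k < 0, nat \<bar>k\<bar>) = ([], [], [], k < 0, nat \<bar>k\<bar>)"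
        using True unfolding kernelize_def by simp
      then have "computes P x (encode ([] :: nat list, [] :: (nat \<times> nat) list, [] :: nat list, k < 0, nat \<bar>k\<bar>))"
        using comp by simp
      moreover have "\<not> yes_instance G T k" using True unfolding yes_instance_def by auto
      moreover have "\<not> yes_instance ?G {} k" using empty_output(3)[OF refl, of k] True by simp
      ultimately show ?thesis
        by (intro exI[of _ ?G] exI[of _ "{}"] exI[of _ k]
            exI[of _ "encode ([] :: nat list, [] :: (nat \<times> nat) list, [] :: nat list, k < 0, nat \<bar>k\<bar>)"] conjI)
          (use empty_output(1,2)[OF refl, of k] True in simp_all)
    next
      case False
      let ?k = "unary vs (nat \<bar>k\<bar>)"
      have lk: "length ?k = min (nat k) (card (verts G))"
        using length_unary[of vs "nat \<bar>k\<bar>"] distinct_card[OF i(1)] i(2) False by simp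
      have ker: "kernelize (vs, es, ts, k < 0, nat \<bar>k\<bar>) = reduce vs es ts ?k"
        unfolding kernelize_def fst_conv snd_conv if_not_P[OF False] ..
      have "kernel_ok (yes_instance G T k) (length ?k) (kernelize (vs, es, ts, k < 0, nat \<bar>k\<bar>))"
        unfolding ker by (rule reduce_ok[OF sg G i]) (unfold lk, rule yes_instance_min[OF sg], use False in simp)
      then obtain G' T' k' where out:
        "encodes_instance (encode (kernelize (vs, es, ts, k < 0, nat \<bar>k\<bar>))) G' T' k'" "split_sfvs_instance G' T' k'"
        "yes_instance G T k \<longleftrightarrow> yes_instance G' T' k'" "card (verts G') \<le> 200 * (length ?k)\<^sup>2"
        "card (edges G') \<le> 200 * (length ?k)\<^sup>2" "k' \<le> int (length ?k)"
        "\<exists>K' I'. split_partition G' K' I' \<and> card K' \<le> 10 * length ?k"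
        unfolding kernel_ok_def by blast
      have le: "int (length ?k) \<le> k" using lk False by linarith
      then have "(int (length ?k))\<^sup>2 \<le> k\<^sup>2" by (rule power_mono) simp
      then have "int (200 * (length ?k)\<^sup>2) \<le> int 200 * k\<^sup>2" by simp
      then have "int (card (verts G')) \<le> int 200 * k\<^sup>2" "int (card (edges G')) \<le> int 200 * k\<^sup>2"
        using out(4,5) by linarith+
      moreover have "\<exists>K' I'. split_partition G' K' I' \<and> int (card K') \<le> 10 * k"
      proof -
        obtain K' I' where K': "split_partition G' K' I'" "card K' \<le> 10 * length ?k" using out(7) by blast
        then have "int (card K') \<le> 10 * k" using le by linarith
        then show ?thesis using K'(1) by blast
      qed
      moreover have "k' \<le> k" using out(6) le by linarith
      ultimately show ?thesis using comp out(1-3) by blast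
    qed
  qed
qed

end
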